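(* Let $R$ be an associative ring with identity. The three morphisms of abelian groups $$\iota_R:G_0(R)\to G(R),\qquad \gamma_R:G(R)\to K_0(R\text{-mod},\oplus),\qquad \kappa_R:K_0(R\text{-mod},\oplus)\to G_0(R)$$ are all isomorphisms. Moreover, beginning at any of the three abelian groups, the composition obtained by going once around the triangle is the identity morphism; that is, $\kappa_R\circ\gamma_R\circ\iota_R$, $\iota_R\circ\kappa_R\circ\gamma_R$ and $\gamma_R\circ\iota_R\circ\kappa_R$ are the identity morphisms of $G_0(R)$, $G(R)$ and $K_0(R\text{-mod},\oplus)$, respectively.
   Context: For $n\ge1$, $L'_n(R)$ is the collection of pairs $(B\,|\,A)$ of matrices over $R$ such that $A$ has $n$ columns and $B$ has the same number of rows as $A$ (the number of rows, and the number of columns of $B$, are arbitrary). $(B\,|\,A)\le_n(B'\,|\,A')$ holds if there are matrices $U,V,G$ over $R$, of appropriate size, with $UB=B'V$ and $UA=A'+B'G$; this is a pre-order, and $\approx_n$ is the associated equivalence relation. $L_n(R)$ is the set of $\approx_n$-classes $[B\,|\,A]$ with the induced partial order. Write $[A]:=[\mathbf 0\,|\,A]$. The minimum element of $L_n(R)$ is $0_n=[\mathbf 0\,|\,I_n]$. $K_0(R\text{-mod},\oplus)$ is the free abelian group on the isomorphism classes $\{M\}$ of finitely presented left $R$-modules modulo the relations $\{M\oplus N\}=\{M\}+\{N\}$. For an $m\times n$ matrix $A$ over $R$, $\{A\}$ denotes the class $\{M_A\}$ of the cokernel $M_A$ of the map ${}_RR^m\to{}_RR^n$ given by right multiplication by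 $A$ on row vectors. $G(R)$ (the Goursat group) is the free abelian group on the elements of $\bigcup_{n\ge1}L_n(R)$ modulo the relations: (1) $[B,A\,|\,A']-[B\,|\,A']=[B,A'\,|\,A]-[B\,|\,A]$ for any three matrices $A,A',B$ with the same number of rows; (2) $\left[\begin{array}{cc|cc}B&\mathbf 0&A&\mathbf 0\\ \mathbf 0&B'&\mathbf 0&A'\end{array}\right]=[B\,|\,A]+[B'\,|\,A']$ for $[B\,|\,A]\in L_m(R)$, $[B'\,|\,A']\in L_n(R)$; (3) $0_n=0$ for all $n\ge1$. $G_0(R)$ (the 0-dimensional Goursat group) is the free abelian group on the elements of $L_1(R)$ modulo the relations: (1) $[B,A\,|\,A']-[B\,|\,A']=[B,A'\,|\,A]-[B\,|\,A]$ whenever $A,A'$ are column matrices and $A,A',B$ have the same number of rows; (2) $0_1=0$. The morphisms are the (well-defined) group morphisms given on generators by $\iota_R([B\,|\,A])=[B\,|\,A]$; $\gamma_R([B\,|\,A])=\{(B,A)\}-\{B\}$, where $(B,A)$ is the concatenated matrix; and $\kappa_R(\{A\})=\sum_{i=1}^n[A_1,\dots,A_{i-1}\,|\,A_i]$, where $A=(A_1,\dots,A_n)$ is written as a row of its columns (the $i=1$ term being $[A_1]=[\mathbf 0\,|\,A_1]$). *)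

theory Defs
  imports "Jordan_Normal_Form.Matrix" "HOL-Algebra.Free_Abelian_Groups"
    "HOL-Algebra.AbelCoset" "HOL-Algebra.Generated_Groups"
begin

text \<open>
  The ring is a type of sort \<open>{ring, monoid_mult}\<close>, i.e. an associative ring with identity.  The
  class \<open>ring_1\<close> is not used, because it excludes the zero ring.  Matrices may have no rows or no
  columns.
\<close>

section \<open>Abelian groups given by generators and relations\<close>

definition presented_group :: "'g set \<Rightarrow> ('g \<Rightarrow>\<^sub>0 int) set \<Rightarrow> ('g \<Rightarrow>\<^sub>0 int) set monoid" where
  "presented_group S Rels = free_Abelian_group S Mod generate (free_Abelian_group S) Rels"

definition presented_gen :: "'g set \<Rightarrow> ('g \<Rightarrow>\<^sub>0 int) set \<Rightarrow> 'g \<Rightarrow> ('g \<Rightarrow>\<^sub>0 int) set" where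
  "presented_gen S Rels x =
     generate (free_Abelian_group S) Rels #>\<^bsub>free_Abelian_group S\<^esub> frag_of x"


section \<open>Block matrices\<close>

definition hcat :: "'a mat \<Rightarrow> 'a mat \<Rightarrow> 'a mat" where
  "hcat B A = mat (dim_row B) (dim_col B + dim_col A)
     (\<lambda>(i, j). if j < dim_col B then B $$ (i, j) else A $$ (i, j - dim_col B))"

definition block_diag :: "'a::zero mat \<Rightarrow> 'a mat \<Rightarrow> 'a mat" where
  "block_diag A A' =
     four_block_mat A (0\<^sub>m (dim_row A) (dim_col A')) (0\<^sub>m (dim_row A') (dim_col A)) A'"

text \<open>The block consisting of the \<open>k\<close> columns \<open>i, \<dots>, i + k - 1\<close> of \<open>A\<close>, counted from 0.\<close>

definition col_block :: "'a mat \<Rightarrow> nat \<Rightarrow> nat \<Rightarrow> 'a mat" where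
  "col_block A i k = mat (dim_row A) k (\<lambda>(r, c). A $$ (r, i + c))"


section \<open>The partially ordered sets of matrix pairs\<close>

text \<open>The pair \<open>(B | A)\<close> is represented by \<open>(B, A)\<close>.\<close>

definition L_pairs :: "nat \<Rightarrow> ('a mat \<times> 'a mat) set" where
  "L_pairs n = {(B, A). dim_col A = n \<and> dim_row B = dim_row A}"

definition L_le :: "nat \<Rightarrow> 'a::ring mat \<times> 'a mat \<Rightarrow> 'a mat \<times> 'a mat \<Rightarrow> bool" where
  "L_le n = (\<lambda>(B, A) (B', A'). \<exists>U V G.
     U \<in> carrier_mat (dim_row A') (dim_row A) \<and>
     V \<in> carrier_mat (dim_col B') (dim_col B) \<and>
     G \<in> carrier_mat (dim_col B') n \<and>
     U * B = B' * V \<and> U * A = A' + B' * G)"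

definition L_rel :: "nat \<Rightarrow> (('a::ring mat \<times> 'a mat) \<times> ('a mat \<times> 'a mat)) set" where
  "L_rel n = {(p, q). p \<in> L_pairs n \<and> q \<in> L_pairs n \<and> L_le n p q \<and> L_le n q p}"

definition L_set :: "nat \<Rightarrow> ('a::ring mat \<times> 'a mat) set set" where
  "L_set n = L_pairs n // L_rel n"

definition L_class :: "'a::ring mat \<Rightarrow> 'a mat \<Rightarrow> ('a mat \<times> 'a mat) set" where
  "L_class B A = L_rel (dim_col A) `` {(B, A)}"

definition L_zero :: "nat \<Rightarrow> ('a::{ring,monoid_mult} mat \<times> 'a mat) set" where
  "L_zero n = L_class (0\<^sub>m n 0) (1\<^sub>m n)"

lemma one_mult_mat: "A \<in> carrier_mat m n \<Longrightarrow> 1\<^sub>m m * A = (A :: 'a::{ring,monoid_mult} mat)"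
proof (intro eq_matI)
  fix i j assume A: "A \<in> carrier_mat m n" and ij: "i < dim_row A" "j < dim_col A"
  then have "(1\<^sub>m m * A) $$ (i, j) = (\<Sum>k = 0..<m. (if i = k then 1 else 0) * A $$ (k, j))"
    by (simp add: scalar_prod_def)
  also have "\<dots> = (\<Sum>k = 0..<m. if i = k then A $$ (k, j) else 0)"
    by (rule sum.cong) auto
  also have "\<dots> = A $$ (i, j)" using A ij by simp
  finally show "(1\<^sub>m m * A) $$ (i, j) = A $$ (i, j)" .
qed auto

lemma mult_one_mat: "A \<in> carrier_mat m n \<Longrightarrow> A * 1\<^sub>m n = (A :: 'a::{ring,monoid_mult} mat)"
proof (intro eq_matI)
  fix i j assume A: "A \<in> carrier_mat m n" and ij: "i < dim_row A" "j < dim_col A"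
  then have "(A * 1\<^sub>m n) $$ (i, j) = (\<Sum>k = 0..<n. A $$ (i, k) * (if k = j then 1 else 0))"
    by (simp add: scalar_prod_def)
  also have "\<dots> = (\<Sum>k = 0..<n. if k = j then A $$ (i, k) else 0)"
    by (rule sum.cong) auto
  also have "\<dots> = A $$ (i, j)" using A ij by simp
  finally show "(A * 1\<^sub>m n) $$ (i, j) = A $$ (i, j)" .
qed auto

lemma L_le_refl:
  fixes B A :: "'a::{ring,monoid_mult} mat"
  assumes "(B, A) \<in> L_pairs n"
  shows "L_le n (B, A) (B, A)"
proof -
  let ?m = "dim_row A" and ?k = "dim_col B"
  have A: "A \<in> carrier_mat ?m n" and B: "B \<in> carrier_mat ?m ?k"
    using assms by (auto simp: L_pairs_def)
  have "1\<^sub>m ?m * B = B * 1\<^sub>m ?k"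
    unfolding one_mult_mat[OF B] mult_one_mat[OF B] ..
  moreover have "1\<^sub>m ?m * A = A + B * 0\<^sub>m ?k n"
    unfolding one_mult_mat[OF A] right_mult_zero_mat[OF B] right_add_zero_mat[OF A] ..
  ultimately show ?thesis
    unfolding L_le_def case_prod_conv
    by (intro exI[of _ "1\<^sub>m ?m"] exI[of _ "1\<^sub>m ?k"] exI[of _ "0\<^sub>m ?k n"] conjI one_carrier_mat
        zero_carrier_mat)
qed

lemma L_le_trans:
  fixes B A B' A' B'' A'' :: "'a::ring mat"
  assumes "(B, A) \<in> L_pairs n" "(B', A') \<in> L_pairs n" "(B'', A'') \<in> L_pairs n"
    and "L_le n (B, A) (B', A')" "L_le n (B', A') (B'', A'')"
  shows "L_le n (B, A) (B'', A'')"
proof -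
  obtain U V G where 1: "U \<in> carrier_mat (dim_row A') (dim_row A)"
    "V \<in> carrier_mat (dim_col B') (dim_col B)" "G \<in> carrier_mat (dim_col B') n"
    "U * B = B' * V" "U * A = A' + B' * G"
    using assms(4) by (auto simp: L_le_def)
  obtain U' V' G' where 2: "U' \<in> carrier_mat (dim_row A'') (dim_row A')"
    "V' \<in> carrier_mat (dim_col B'') (dim_col B')" "G' \<in> carrier_mat (dim_col B'') n"
    "U' * B' = B'' * V'" "U' * A' = A'' + B'' * G'"
    using assms(5) by (auto simp: L_le_def)
  let ?m = "dim_row A" and ?m' = "dim_row A'" and ?m'' = "dim_row A''"
  let ?k = "dim_col B" and ?k' = "dim_col B'" and ?k'' = "dim_col B''"
  have c: "A \<in> carrier_mat ?m n" "B \<in> carrier_mat ?m ?k"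
    "A' \<in> carrier_mat ?m' n" "B' \<in> carrier_mat ?m' ?k'"
    "A'' \<in> carrier_mat ?m'' n" "B'' \<in> carrier_mat ?m'' ?k''"
    using assms(1-3) by (auto simp: L_pairs_def)
  have "(U' * U) * B = U' * (U * B)" by (rule assoc_mult_mat[OF 2(1) 1(1) c(2)])
  also have "\<dots> = (U' * B') * V"
    unfolding 1(4) by (rule assoc_mult_mat[OF 2(1) c(4) 1(2), symmetric])
  also have "\<dots> = B'' * (V' * V)"
    unfolding 2(4) by (rule assoc_mult_mat[OF c(6) 2(2) 1(2)])
  finally have B: "(U' * U) * B = B'' * (V' * V)" .
  note G = mult_carrier_mat[OF c(4) 1(3)] mult_carrier_mat[OF c(6) 2(3)]
    mult_carrier_mat[OF 2(2) 1(3)]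
  have "(U' * U) * A = U' * (U * A)" by (rule assoc_mult_mat[OF 2(1) 1(1) c(1)])
  also have "\<dots> = U' * A' + U' * (B' * G)"
    unfolding 1(5) by (rule mult_add_distrib_mat[OF 2(1) c(3) G(1)])
  also have "U' * (B' * G) = (U' * B') * G"
    by (rule assoc_mult_mat[OF 2(1) c(4) 1(3), symmetric])
  also have "\<dots> = B'' * (V' * G)"
    unfolding 2(4) by (rule assoc_mult_mat[OF c(6) 2(2) 1(3)])
  also have "U' * A' + B'' * (V' * G) = A'' + (B'' * G' + B'' * (V' * G))"
    unfolding 2(5) by (rule assoc_add_mat[OF c(5) G(2) mult_carrier_mat[OF c(6) G(3)]])
  also have "B'' * G' + B'' * (V' * G) = B'' * (G' + V' * G)"
    by (rule mult_add_distrib_mat[OF c(6) 2(3) G(3), symmetric])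
  finally have A: "(U' * U) * A = A'' + B'' * (G' + V' * G)" .
  show ?thesis
    unfolding L_le_def case_prod_conv
    using A B mult_carrier_mat[OF 2(1) 1(1)] mult_carrier_mat[OF 2(2) 1(2)]
      add_carrier_mat[OF G(3), of G']
    by (intro exI[of _ "U' * U"] exI[of _ "V' * V"] exI[of _ "G' + V' * G"]) simp
qed

lemma equiv_L_rel: "equiv (L_pairs n) (L_rel n :: (('a::{ring,monoid_mult} mat \<times> 'a mat) \<times> _) set)"
proof (rule equivI)
  show "L_rel n \<subseteq> L_pairs n \<times> L_pairs n" by (auto simp: L_rel_def)
  show "refl_on (L_pairs n) (L_rel n :: (('a mat \<times> 'a mat) \<times> _) set)"
    by (auto simp: refl_on_def L_rel_def intro: L_le_refl)
  show "sym (L_rel n)" by (auto simp: sym_def L_rel_def)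
  show "trans (L_rel n)"
    unfolding trans_def L_rel_def
  proof (safe, goal_cases)
    case 1
    then show ?case by - (rule L_le_trans)
  next
    case 2
    then show ?case by - (rule L_le_trans)
  qed
qed

text \<open>
  In \<open>[A] = [0 | A]\<close> the zero block may have any number of columns; the definitions use the block
  without columns.
\<close>

lemma L_class_zero_block:
  fixes A :: "'a::{ring,monoid_mult} mat"
  shows "L_class (0\<^sub>m (dim_row A) k) A = L_class (0\<^sub>m (dim_row A) 0) A"
proof -
  let ?m = "dim_row A" and ?n = "dim_col A"
  have le: "L_le ?n (0\<^sub>m ?m k, A) (0\<^sub>m ?m l, A)" for k l
  proof -
    have "1\<^sub>m ?m * 0\<^sub>m ?m k = (0\<^sub>m ?m k :: 'a mat)" "1\<^sub>m ?m * A = A"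
      "0\<^sub>m ?m l * 0\<^sub>m l k = (0\<^sub>m ?m k :: 'a mat)"
      "0\<^sub>m ?m l * 0\<^sub>m l ?n = (0\<^sub>m ?m ?n :: 'a mat)" "A + 0\<^sub>m ?m ?n = A"
      by (rule one_mult_mat[of _ _ k] one_mult_mat[of _ _ ?n] right_mult_zero_mat[of _ _ l]
          right_add_zero_mat[of _ ?m]; simp)+
    then show ?thesis
      unfolding L_le_def case_prod_conv
      by (intro exI[of _ "1\<^sub>m ?m"] exI[of _ "0\<^sub>m l k"] exI[of _ "0\<^sub>m l ?n"]) auto
  qed
  have "((0\<^sub>m ?m k, A), (0\<^sub>m ?m 0, A)) \<in> L_rel ?n"
    using le by (auto simp: L_rel_def L_pairs_def)
  then show ?thesis unfolding L_class_def by (rule equiv_class_eq[OF equiv_L_rel])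
qed


section \<open>The Goursat groups\<close>

text \<open>Since the sets \<open>L_set n\<close> are pairwise disjoint, their disjoint union is the ordinary one.\<close>

definition G_gens :: "'a::{ring,monoid_mult} itself \<Rightarrow> ('a mat \<times> 'a mat) set set" where
  "G_gens R = (\<Union>n\<in>{1..}. L_set n)"

definition G_rels :: "'a::{ring,monoid_mult} itself \<Rightarrow> (('a mat \<times> 'a mat) set \<Rightarrow>\<^sub>0 int) set" where
  "G_rels R =
     {(frag_of (L_class (hcat B A) A') - frag_of (L_class B A')) -
      (frag_of (L_class (hcat B A') A) - frag_of (L_class B A)) | B A A'.
        dim_row A = dim_row B \<and> dim_row A' = dim_row B \<and> dim_col A \<ge> 1 \<and> dim_col A' \<ge> 1}
   \<union> {frag_of (L_class (block_diag B B') (block_diag A A')) -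
      (frag_of (L_class B A) + frag_of (L_class B' A')) | B A B' A'.
        \<exists>m\<ge>1. \<exists>n\<ge>1. (B, A) \<in> L_pairs m \<and> (B', A') \<in> L_pairs n}
   \<union> {frag_of (L_zero n) | n. n \<ge> 1}"

definition goursat_group ::
    "'a::{ring,monoid_mult} itself \<Rightarrow> (('a mat \<times> 'a mat) set \<Rightarrow>\<^sub>0 int) set monoid" where
  "goursat_group R = presented_group (G_gens R) (G_rels R)"

definition G_gen ::
    "'a::{ring,monoid_mult} itself \<Rightarrow> 'a mat \<Rightarrow> 'a mat \<Rightarrow> (('a mat \<times> 'a mat) set \<Rightarrow>\<^sub>0 int) set" where
  "G_gen R B A = presented_gen (G_gens R) (G_rels R) (L_class B A)"

definition G0_rels :: "'a::{ring,monoid_mult} itself \<Rightarrow> (('a mat \<times> 'a mat) set \<Rightarrow>\<^sub>0 int) set" where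
  "G0_rels R =
     {(frag_of (L_class (hcat B A) A') - frag_of (L_class B A')) -
      (frag_of (L_class (hcat B A') A) - frag_of (L_class B A)) | B A A'.
        dim_row A = dim_row B \<and> dim_row A' = dim_row B \<and> dim_col A = 1 \<and> dim_col A' = 1}
   \<union> {frag_of (L_zero 1)}"

definition goursat_group0 ::
    "'a::{ring,monoid_mult} itself \<Rightarrow> (('a mat \<times> 'a mat) set \<Rightarrow>\<^sub>0 int) set monoid" where
  "goursat_group0 R = presented_group (L_set 1) (G0_rels R)"

definition G0_gen ::
    "'a::{ring,monoid_mult} itself \<Rightarrow> 'a mat \<Rightarrow> 'a mat \<Rightarrow> (('a mat \<times> 'a mat) set \<Rightarrow>\<^sub>0 int) set" where
  "G0_gen R B A = presented_gen (L_set 1) (G0_rels R) (L_class B A)"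


section \<open>Left modules\<close>

text \<open>
  The locale \<open>module\<close> requires a commutative ring of scalars.  Only the record type is reused here;
  its fields \<open>mult\<close> and \<open>one\<close> play no role.
\<close>

locale left_module = abelian_group M
  for M :: "('a::{ring,monoid_mult}, 'b) module" (structure) +
  assumes smult_closed: "x \<in> carrier M \<Longrightarrow> r \<odot> x \<in> carrier M"
    and smult_l_distr: "x \<in> carrier M \<Longrightarrow> (r + s) \<odot> x = r \<odot> x \<oplus> s \<odot> x"
    and smult_r_distr: "x \<in> carrier M \<Longrightarrow> y \<in> carrier M \<Longrightarrow> r \<odot> (x \<oplus> y) = r \<odot> x \<oplus> r \<odot> y"
    and smult_assoc: "x \<in> carrier M \<Longrightarrow> (r * s) \<odot> x = r \<odot> (s \<odot> x)"
    and smult_one: "x \<in> carrier M \<Longrightarrow> 1 \<odot> x = x"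

definition lmod_hom :: "('a, 'b) module \<Rightarrow> ('a, 'c) module \<Rightarrow> ('b \<Rightarrow> 'c) set" where
  "lmod_hom M N = {f \<in> carrier M \<rightarrow> carrier N.
     (\<forall>x\<in>carrier M. \<forall>y\<in>carrier M. f (x \<oplus>\<^bsub>M\<^esub> y) = f x \<oplus>\<^bsub>N\<^esub> f y) \<and>
     (\<forall>r. \<forall>x\<in>carrier M. f (r \<odot>\<^bsub>M\<^esub> x) = r \<odot>\<^bsub>N\<^esub> f x)}"

definition lmod_isomorphic :: "('a, 'b) module \<Rightarrow> ('a, 'c) module \<Rightarrow> bool" where
  "lmod_isomorphic M N \<longleftrightarrow> (\<exists>f\<in>lmod_hom M N. bij_betw f (carrier M) (carrier N))"

definition lmod_sum :: "('a, 'b) module \<Rightarrow> ('a, 'c) module \<Rightarrow> ('a, 'b \<times> 'c) module" where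
  "lmod_sum M N = \<lparr>carrier = carrier M \<times> carrier N, mult = undefined, one = undefined,
     ring.zero = (\<zero>\<^bsub>M\<^esub>, \<zero>\<^bsub>N\<^esub>),
     ring.add = (\<lambda>(x, y) (x', y'). (x \<oplus>\<^bsub>M\<^esub> x', y \<oplus>\<^bsub>N\<^esub> y')),
     smult = (\<lambda>r (x, y). (r \<odot>\<^bsub>M\<^esub> x, r \<odot>\<^bsub>N\<^esub> y))\<rparr>"

text \<open>The elements of the quotient module are the cosets; \<open>r(x + N) = rx + N\<close>.\<close>

definition lmod_quot :: "('a, 'b) module \<Rightarrow> 'b set \<Rightarrow> ('a, 'b set) module" where
  "lmod_quot M N = \<lparr>carrier = a_rcosets\<^bsub>M\<^esub> N, mult = undefined, one = undefined,
     ring.zero = N, ring.add = set_add M,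
     smult = (\<lambda>r X. \<Union>x\<in>X. N +>\<^bsub>M\<^esub> (r \<odot>\<^bsub>M\<^esub> x))\<rparr>"

definition free_lmod :: "nat \<Rightarrow> ('a::{ring,monoid_mult}, 'a vec) module" where
  "free_lmod n = \<lparr>carrier = carrier_vec n, mult = undefined, one = undefined,
     ring.zero = 0\<^sub>v n, ring.add = (+), smult = (\<cdot>\<^sub>v)\<rparr>"

definition finitely_presented :: "('a::{ring,monoid_mult}, 'b) module \<Rightarrow> bool" where
  "finitely_presented M \<longleftrightarrow> left_module M \<and>
     (\<exists>m n. \<exists>f\<in>lmod_hom (free_lmod m) (free_lmod n). \<exists>g\<in>lmod_hom (free_lmod n) M.
        g ` carrier (free_lmod n) = carrier M \<and>
        {x \<in> carrier (free_lmod n). g x = \<zero>\<^bsub>M\<^esub>} = f ` carrier (free_lmod m))"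

definition row_mult_mat :: "'a::semiring_0 vec \<Rightarrow> 'a mat \<Rightarrow> 'a vec" where
  "row_mult_mat v A = vec (dim_col A) (\<lambda>j. v \<bullet> col A j)"

definition coker_mod :: "'a::{ring,monoid_mult} mat \<Rightarrow> ('a, 'a vec set) module" where
  "coker_mod A = lmod_quot (free_lmod (dim_col A))
     ((\<lambda>v. row_mult_mat v A) ` carrier (free_lmod (dim_row A)))"


section \<open>The Grothendieck group of finitely presented left modules\<close>

text \<open>
  Isomorphism classes are formed among modules whose elements are sets of vectors over the ring.
  Lemma \<open>finitely_presented_representative\<close> below shows that every finitely presented left module,
  over any type, is isomorphic to one of these.  The class \<open>{M}\<close> is defined for modules \<open>M\<close> over
  any type, in particular for direct sums.
\<close>

definition lmod_class :: "('a::{ring,monoid_mult}, 'b) module \<Rightarrow> ('a, 'a vec set) module set" where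
  "lmod_class M = {N. finitely_presented N \<and> lmod_isomorphic N M}"

definition K0_gens :: "'a::{ring,monoid_mult} itself \<Rightarrow> ('a, 'a vec set) module set set" where
  "K0_gens R = {lmod_class M | M :: ('a, 'a vec set) module. finitely_presented M}"

definition K0_rels ::
    "'a::{ring,monoid_mult} itself \<Rightarrow> (('a, 'a vec set) module set \<Rightarrow>\<^sub>0 int) set" where
  "K0_rels R =
     {frag_of (lmod_class (lmod_sum M N)) - (frag_of (lmod_class M) + frag_of (lmod_class N)) |
        (M :: ('a, 'a vec set) module) (N :: ('a, 'a vec set) module).
        finitely_presented M \<and> finitely_presented N}"

definition K0 ::
    "'a::{ring,monoid_mult} itself \<Rightarrow> (('a, 'a vec set) module set \<Rightarrow>\<^sub>0 int) set monoid" where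
  "K0 R = presented_group (K0_gens R) (K0_rels R)"

definition K0_mat ::
    "'a::{ring,monoid_mult} itself \<Rightarrow> 'a mat \<Rightarrow> (('a, 'a vec set) module set \<Rightarrow>\<^sub>0 int) set" where
  "K0_mat R A = presented_gen (K0_gens R) (K0_rels R) (lmod_class (coker_mod A))"

lemma left_module_free_lmod: "left_module (free_lmod n :: ('a::{ring,monoid_mult}, 'a vec) module)"
proof (rule left_module.intro)
  show "abelian_group (free_lmod n :: ('a, 'a vec) module)"
  proof (rule abelian_groupI)
    fix x :: "'a vec" assume "x \<in> carrier (free_lmod n)"
    then show "\<exists>y\<in>carrier (free_lmod n). y \<oplus>\<^bsub>free_lmod n\<^esub> x = \<zero>\<^bsub>free_lmod n\<^esub>"
      by (intro bexI[of _ "- x"]) (auto simp: free_lmod_def)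
  qed (auto simp: free_lmod_def comm_add_vec)
  show "left_module_axioms (free_lmod n :: ('a, 'a vec) module)"
    by unfold_locales
      (auto simp: free_lmod_def distrib_left distrib_right mult.assoc intro!: eq_vecI)
qed

lemma row_mult_mat_hom:
  "(\<lambda>v. row_mult_mat v A) \<in> lmod_hom (free_lmod (dim_row A)) (free_lmod (dim_col A))"
  for A :: "'a::{ring,monoid_mult} mat"
  by (auto simp: lmod_hom_def free_lmod_def row_mult_mat_def scalar_prod_def sum.distrib
      distrib_right sum_distrib_left mult.assoc intro!: eq_vecI)

context left_module
begin

lemma quotient_module:
  assumes sub: "subgroup K (add_monoid M)" and smult: "\<And>r x. x \<in> K \<Longrightarrow> r \<odot> x \<in> K"
  shows "left_module (lmod_quot M K)"
    and "(\<lambda>x. K +> x) \<in> lmod_hom M (lmod_quot M K)"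
    and "(\<lambda>x. K +> x) ` carrier M = carrier (lmod_quot M K)"
    and "{x \<in> carrier M. K +> x = \<zero>\<^bsub>lmod_quot M K\<^esub>} = K"
proof -
  interpret K: abelian_subgroup K M
    using sub by (intro abelian_subgroupI3 additive_subgroup.intro abelian_group_axioms)
  have KM: "K \<subseteq> carrier M" by (rule K.a_subset)
  have carr: "carrier (lmod_quot M K) = (\<lambda>x. K +> x) ` carrier M"
    by (auto simp: lmod_quot_def A_RCOSETS_def')
  have add: "(K +> x) \<oplus>\<^bsub>lmod_quot M K\<^esub> (K +> y) = K +> (x \<oplus> y)"
    if "x \<in> carrier M" "y \<in> carrier M" for x y
    using K.a_rcos_sum that by (simp add: lmod_quot_def)
  have sm: "r \<odot>\<^bsub>lmod_quot M K\<^esub> (K +> x) = K +> (r \<odot> x)" if x: "x \<in> carrier M" for r x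
  proof -
    have "K +> (r \<odot> z) = K +> (r \<odot> x)" if z: "z \<in> K +> x" for z
    proof -
      obtain k where k: "k \<in> K" "z = k \<oplus> x" using z by (auto simp: a_r_coset_def')
      then have "r \<odot> z = (r \<odot> k) \<oplus> (r \<odot> x)" using KM x by (auto intro: smult_r_distr)
      then have "r \<odot> z \<in> K +> (r \<odot> x)" using smult[OF k(1)] by (auto simp: a_r_coset_def')
      then show ?thesis using a_repr_independence[OF _ _ sub] x smult_closed by auto
    qed
    then have "(\<Union>z\<in>K +> x. K +> (r \<odot> z)) = (\<Union>z\<in>K +> x. K +> (r \<odot> x))"
      by (intro SUP_cong refl)
    also have "\<dots> = K +> (r \<odot> x)" using K.a_rcos_self[OF x] by blast
    finally show ?thesis by (simp add: lmod_quot_def)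
  qed
  have zero: "\<zero>\<^bsub>lmod_quot M K\<^esub> = K +> \<zero>"
    using KM by (simp add: lmod_quot_def)
  show hom: "(\<lambda>x. K +> x) \<in> lmod_hom M (lmod_quot M K)"
    using add sm by (auto simp: lmod_hom_def carr)
  show "(\<lambda>x. K +> x) ` carrier M = carrier (lmod_quot M K)" by (simp add: carr)
  show "{x \<in> carrier M. K +> x = \<zero>\<^bsub>lmod_quot M K\<^esub>} = K"
    using a_coset_join1[OF _ _ sub] a_coset_join2[OF _ sub] KM by (auto simp: lmod_quot_def)
  have "abelian_group (lmod_quot M K)"
  proof (rule abelian_groupI)
    fix X assume "X \<in> carrier (lmod_quot M K)"
    then obtain x where x: "x \<in> carrier M" "X = K +> x" by (auto simp: carr)
    then have "(K +> \<ominus> x) \<oplus>\<^bsub>lmod_quot M K\<^esub> X = \<zero>\<^bsub>lmod_quot M K\<^esub>"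
      by (simp add: add zero l_neg)
    with x show "\<exists>Y\<in>carrier (lmod_quot M K). Y \<oplus>\<^bsub>lmod_quot M K\<^esub> X = \<zero>\<^bsub>lmod_quot M K\<^esub>"
      by (auto simp: carr)
  qed (auto simp: carr add zero a_ac)
  moreover have "left_module_axioms (lmod_quot M K)"
    by unfold_locales
      (auto simp: carr add sm smult_closed smult_l_distr smult_r_distr smult_assoc smult_one)
  ultimately show "left_module (lmod_quot M K)" by (rule left_module.intro)
qed

end

lemma finitely_presented_coker_mod: "finitely_presented (coker_mod A)"
  for A :: "'a::{ring,monoid_mult} mat"
proof -
  let ?F = "free_lmod (dim_row A) :: ('a, 'a vec) module"
  let ?E = "free_lmod (dim_col A) :: ('a, 'a vec) module"
  let ?f = "\<lambda>v. row_mult_mat v A" and ?K = "(\<lambda>v. row_mult_mat v A) ` carrier ?F"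
  interpret F: left_module ?F by (rule left_module_free_lmod)
  interpret E: left_module ?E by (rule left_module_free_lmod)
  note f = row_mult_mat_hom[of A]
  have "group_hom (add_monoid ?F) (add_monoid ?E) ?f"
    using f by (intro group_hom.intro group_hom_axioms.intro F.a_group E.a_group)
      (auto simp: hom_def lmod_hom_def)
  then have sub: "subgroup ?K (add_monoid ?E)"
    using group_hom.img_is_subgroup by fastforce
  have sm: "r \<odot>\<^bsub>?E\<^esub> x \<in> ?K" if "x \<in> ?K" for r x
  proof -
    obtain v where v: "v \<in> carrier ?F" "x = ?f v" using \<open>x \<in> ?K\<close> by blast
    then have "r \<odot>\<^bsub>?E\<^esub> x = ?f (r \<odot>\<^bsub>?F\<^esub> v)" using f by (simp add: lmod_hom_def)
    then show ?thesis using F.smult_closed[OF v(1)] by blast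
  qed
  show ?thesis
    unfolding finitely_presented_def coker_mod_def
    using E.quotient_module[OF sub sm] f by blast
qed

lemma finitely_presented_transport:
  fixes M :: "('a::{ring,monoid_mult}, 'b) module" and N :: "('a, 'c) module"
  assumes fp: "finitely_presented M"
    and bij: "bij_betw h (carrier N) (carrier M)" and hom: "h \<in> lmod_hom N M"
    and zero: "\<zero>\<^bsub>N\<^esub> \<in> carrier N" "h \<zero>\<^bsub>N\<^esub> = \<zero>\<^bsub>M\<^esub>"
    and add: "\<And>x y. x \<in> carrier N \<Longrightarrow> y \<in> carrier N \<Longrightarrow> x \<oplus>\<^bsub>N\<^esub> y \<in> carrier N"
    and smult: "\<And>r x. x \<in> carrier N \<Longrightarrow> r \<odot>\<^bsub>N\<^esub> x \<in> carrier N"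
  shows "finitely_presented N"
proof -
  interpret M: left_module M using fp by (simp add: finitely_presented_def)
  have inj: "x = y" if "x \<in> carrier N" "y \<in> carrier N" "h x = h y" for x y
    using bij that by (auto simp: bij_betw_def inj_on_def)
  have h: "h x \<in> carrier M" if "x \<in> carrier N" for x
    using bij that by (auto simp: bij_betw_def)
  have h_add: "h (x \<oplus>\<^bsub>N\<^esub> y) = h x \<oplus>\<^bsub>M\<^esub> h y" if "x \<in> carrier N" "y \<in> carrier N" for x y
    using hom that by (auto simp: lmod_hom_def)
  have h_smult: "h (r \<odot>\<^bsub>N\<^esub> x) = r \<odot>\<^bsub>M\<^esub> h x" if "x \<in> carrier N" for r x
    using hom that by (auto simp: lmod_hom_def)
  note simps = zero add smult h h_add h_smult
  have "abelian_group N"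
  proof (rule abelian_groupI)
    fix x assume x: "x \<in> carrier N"
    have "\<ominus>\<^bsub>M\<^esub> h x \<in> h ` carrier N" using bij x h by (simp add: bij_betw_def)
    then obtain y where y: "y \<in> carrier N" "h y = \<ominus>\<^bsub>M\<^esub> h x" by auto
    have "y \<oplus>\<^bsub>N\<^esub> x = \<zero>\<^bsub>N\<^esub>" using x y by (intro inj) (simp_all add: simps M.l_neg)
    with y show "\<exists>y\<in>carrier N. y \<oplus>\<^bsub>N\<^esub> x = \<zero>\<^bsub>N\<^esub>" by auto
  qed (simp_all add: zero add, (rule inj; simp add: simps M.a_ac)+)
  moreover have "left_module_axioms N"
    by unfold_locales
      (simp_all add: smult, (rule inj; simp add: simps M.smult_closed M.smult_l_distr
        M.smult_r_distr M.smult_assoc M.smult_one)+)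
  ultimately have "left_module N" by (rule left_module.intro)
  moreover obtain m n f g where f: "f \<in> lmod_hom (free_lmod m) (free_lmod n)"
    and g: "g \<in> lmod_hom (free_lmod n) M" "g ` carrier (free_lmod n) = carrier M"
      "{x \<in> carrier (free_lmod n). g x = \<zero>\<^bsub>M\<^esub>} = f ` carrier (free_lmod m)"
    using fp by (auto simp: finitely_presented_def)
  define g' where "g' x = inv_into (carrier N) h (g x)" for x
  have g': "g' x \<in> carrier N" "h (g' x) = g x" if "x \<in> carrier (free_lmod n)" for x
  proof -
    have "g x \<in> h ` carrier N" using g(2) that bij by (auto simp: bij_betw_def)
    then show "g' x \<in> carrier N" "h (g' x) = g x"
      by (auto simp: g'_def inv_into_into f_inv_into_f)
  qed
  have free: "x \<oplus>\<^bsub>free_lmod n\<^esub> y \<in> carrier (free_lmod n)"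
    "r \<odot>\<^bsub>free_lmod n\<^esub> x \<in> carrier (free_lmod n)"
    if "x \<in> carrier (free_lmod n)" "y \<in> carrier (free_lmod n)" for r and x y :: "'a vec"
    using that by (simp_all add: free_lmod_def)
  have "g' \<in> lmod_hom (free_lmod n) N"
    unfolding lmod_hom_def
  proof (intro CollectI conjI ballI allI funcsetI)
    fix r x y assume xy: "x \<in> carrier (free_lmod n :: ('a, 'a vec) module)"
      "y \<in> carrier (free_lmod n :: ('a, 'a vec) module)"
    show "g' (x \<oplus>\<^bsub>free_lmod n\<^esub> y) = g' x \<oplus>\<^bsub>N\<^esub> g' y"
      using g(1) xy by (intro inj) (simp_all add: g' simps free lmod_hom_def)
  next
    fix r x assume x: "x \<in> carrier (free_lmod n :: ('a, 'a vec) module)"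
    show "g' (r \<odot>\<^bsub>free_lmod n\<^esub> x) = r \<odot>\<^bsub>N\<^esub> g' x"
      using g(1) x by (intro inj) (simp_all add: g' simps free(2)[OF x x] lmod_hom_def)
  qed (use g' in simp)
  moreover have "g' ` carrier (free_lmod n) = carrier N"
  proof
    show "g' ` carrier (free_lmod n) \<subseteq> carrier N" using g' by auto
    show "carrier N \<subseteq> g' ` carrier (free_lmod n)"
    proof
      fix y assume y: "y \<in> carrier N"
      then obtain x where x: "x \<in> carrier (free_lmod n)" "g x = h y"
        using g(2) h by (metis imageE)
      then have "g' x = y" using y g' by (intro inj) auto
      with x show "y \<in> g' ` carrier (free_lmod n)" by auto
    qed
  qed
  moreover have "g' x = \<zero>\<^bsub>N\<^esub> \<longleftrightarrow> g x = \<zero>\<^bsub>M\<^esub>" if "x \<in> carrier (free_lmod n)" for x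
    using g'[OF that] zero inj by metis
  then have "{x \<in> carrier (free_lmod n). g' x = \<zero>\<^bsub>N\<^esub>} = f ` carrier (free_lmod m)"
    using g(3) by auto
  ultimately show ?thesis using f unfolding finitely_presented_def by blast
qed

lemma finitely_presented_representative:
  fixes M :: "('a::{ring,monoid_mult}, 'b) module"
  assumes fp: "finitely_presented M"
  shows "\<exists>N :: ('a, 'a vec set) module. finitely_presented N \<and> lmod_isomorphic N M"
proof -
  interpret M: left_module M using fp by (simp add: finitely_presented_def)
  obtain n g where g: "g ` carrier (free_lmod n :: ('a, 'a vec) module) = carrier M"
    using fp by (auto simp: finitely_presented_def)
  define p where "p y = {x \<in> carrier (free_lmod n). g x = y}" for y
  define h where "h = inv_into (carrier M) p"
  have "inj_on p (carrier M)"
  proof (rule inj_onI)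
    fix y z assume yz: "y \<in> carrier M" "z \<in> carrier M" "p y = p z"
    then obtain x where "x \<in> carrier (free_lmod n)" "g x = y" using g by (metis imageE)
    then have "x \<in> p z" using yz by (auto simp: p_def)
    then show "y = z" using \<open>g x = y\<close> by (auto simp: p_def)
  qed
  then have hp: "h (p y) = y" if "y \<in> carrier M" for y
    using that by (simp add: h_def inv_into_f_f)
  define N :: "('a, 'a vec set) module" where
    "N = \<lparr>carrier = p ` carrier M, mult = undefined, one = undefined, ring.zero = p \<zero>\<^bsub>M\<^esub>,
       ring.add = (\<lambda>X Y. p (h X \<oplus>\<^bsub>M\<^esub> h Y)), smult = (\<lambda>r X. p (r \<odot>\<^bsub>M\<^esub> h X))\<rparr>"
  have bij: "bij_betw h (carrier N) (carrier M)"
    by (rule bij_betwI[where g = p]) (auto simp: N_def hp)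
  have hom: "h \<in> lmod_hom N M"
    by (auto simp: lmod_hom_def N_def hp M.smult_closed)
  have "finitely_presented N"
    by (rule finitely_presented_transport[OF fp bij hom]) (auto simp: N_def hp M.smult_closed)
  with bij hom show ?thesis by (auto simp: lmod_isomorphic_def)
qed


section \<open>The three morphisms\<close>

text \<open>
  Each morphism is the group homomorphism with the prescribed values on all representatives of the
  generators; \<open>extensional\<close> fixes its values outside the carrier.  The groups are written
  multiplicatively.
\<close>

definition is_iota where
  "is_iota (R :: 'a::{ring,monoid_mult} itself) f \<longleftrightarrow>
     f \<in> hom (goursat_group0 R) (goursat_group R) \<and>
     f \<in> extensional (carrier (goursat_group0 R)) \<and>
     (\<forall>(B, A) \<in> L_pairs 1. f (G0_gen R B A) = G_gen R B A)"

definition is_gamma where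
  "is_gamma (R :: 'a::{ring,monoid_mult} itself) f \<longleftrightarrow>
     f \<in> hom (goursat_group R) (K0 R) \<and>
     f \<in> extensional (carrier (goursat_group R)) \<and>
     (\<forall>n\<ge>1. \<forall>(B, A) \<in> L_pairs n.
        f (G_gen R B A) = K0_mat R (hcat B A) \<otimes>\<^bsub>K0 R\<^esub> inv\<^bsub>K0 R\<^esub> (K0_mat R B))"

text \<open>
  With columns counted from 0, the summand with index \<open>i\<close> is the class of
  \<open>(A\<^sub>0, \<dots>, A\<^sub>i\<^sub>-\<^sub>1 | A\<^sub>i)\<close>; for \<open>i = 0\<close> the left block has no columns.
\<close>

definition is_kappa where
  "is_kappa (R :: 'a::{ring,monoid_mult} itself) f \<longleftrightarrow>
     f \<in> hom (K0 R) (goursat_group0 R) \<and>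
     f \<in> extensional (carrier (K0 R)) \<and>
     (\<forall>A. f (K0_mat R A) =
        finprod (goursat_group0 R) (\<lambda>i. G0_gen R (col_block A 0 i) (col_block A i 1)) {..<dim_col A})"

definition iota where "iota R = (THE f. is_iota R f)"

definition gamma where "gamma R = (THE f. is_gamma R f)"

definition kappa where "kappa R = (THE f. is_kappa R f)"

end

theory Submission
  imports Defs
begin

text \<open>
  Write \<open>M\<close> for the cokernel of \<open>(B, A)\<close> and \<open>x\<close> for the tuple of its generators that belong to the
  columns of \<open>A\<close>.  The relation \<open>(B | A) \<le> (B' | A')\<close> says that some homomorphism \<open>M' \<rightarrow> M\<close> maps \<open>x'\<close>
  to \<open>x\<close>, where \<open>M'\<close> and \<open>x'\<close> belong to \<open>(B' | A')\<close>, and \<open>B\<close> presents \<open>M/x\<close>.  So elements of the Goursat groups are combinations of modules with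
  a tuple, taken up to homomorphisms in both directions, and \<open>\<gamma>\<close> sends such a module to \<open>{M} - {M/x}\<close>,
  while \<open>\<kappa>\<close> sums the one-dimensional steps by which the generators of a module are reached one after
  the other.

  \<open>\<gamma>\<close> is well defined (\<open>gamma_value_cong\<close>): a homomorphism \<open>M' \<rightarrow> M\<close> with \<open>x' \<mapsto> x\<close> splits the amalgam
  of \<open>M\<close> and \<open>M'\<close> over \<open>x = x'\<close> as \<open>M \<oplus> M'/x'\<close>.  With homomorphisms in both directions this gives
  \<open>M \<oplus> M'/x' \<cong> M' \<oplus> M/x\<close>.

  \<open>\<kappa>\<close> is well defined (\<open>kappa_value_cong\<close>): the exchange relation says that neighbouring columns can
  be exchanged, so the sum does not depend on the order of the columns.  Two presentations of one
  module have a common enlargement on the union of their generators, up to row operations, which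
  change nothing.  Redundant generators do not change the sum either: listed first, they contribute
  terms \<open>0\<^sub>1\<close>, and in the other terms they can be eliminated.

  Two of the three cycles are then telescoping sums.  For \<open>\<iota> \<circ> \<kappa> \<circ> \<gamma>\<close>, the elements of \<open>G(R)\<close> must be
  reduced to one-dimensional ones by \<open>[B | A, a] = [B | A] + [B, A | a]\<close> (\<open>G_gen_split\<close>).  This
  follows from one instance of the exchange relation, in which \<open>a\<close> competes with a copy of
  \<open>(A, a)\<close>, together with the relation for block diagonal pairs.
\<close>

section \<open>Groups given by generators and relations\<close>

lemma hom_frag:
  assumes "F \<in> hom (free_Abelian_group S) H" "group H"
    and "Poly_Mapping.keys x \<subseteq> S" "Poly_Mapping.keys y \<subseteq> S"
  shows "F x \<in> carrier H" "F (x + y) = F x \<otimes>\<^bsub>H\<^esub> F y" "F (x - y) = F x \<otimes>\<^bsub>H\<^esub> inv\<^bsub>H\<^esub> F y"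
proof -
  interpret F: group_hom "free_Abelian_group S" H F
    using assms by (intro group_hom.intro) (auto simp: group_hom_axioms_def)
  show "F x \<in> carrier H" "F (x + y) = F x \<otimes>\<^bsub>H\<^esub> F y"
    using F.hom_closed[of x] F.hom_mult[of x y] assms by simp_all
  have "F (x + - y) = F x \<otimes>\<^bsub>H\<^esub> F (- y)" using F.hom_mult[of x "- y"] assms by simp
  also have "F (- y) = inv\<^bsub>H\<^esub> F y" using F.hom_inv[of y] assms by simp
  finally show "F (x - y) = F x \<otimes>\<^bsub>H\<^esub> inv\<^bsub>H\<^esub> F y" by simp
qed

text \<open>
  All relators of the three groups, apart from \<open>0\<^sub>n\<close>, have one of these two shapes.  Here the
  vanishing of a relator becomes an equation without inverses.
\<close>

lemma hom_frag_relation: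
  assumes F: "F \<in> hom (free_Abelian_group S) H" and H: "comm_group H"
    and S: "a \<in> S" "b \<in> S" "c \<in> S"
  shows "F (frag_of a - (frag_of b + frag_of c)) = \<one>\<^bsub>H\<^esub> \<longleftrightarrow>
      F (frag_of a) = F (frag_of b) \<otimes>\<^bsub>H\<^esub> F (frag_of c)" (is ?sum)
    and "d \<in> S \<Longrightarrow> F ((frag_of a - frag_of b) - (frag_of c - frag_of d)) = \<one>\<^bsub>H\<^esub> \<longleftrightarrow>
      F (frag_of a) \<otimes>\<^bsub>H\<^esub> F (frag_of d) = F (frag_of c) \<otimes>\<^bsub>H\<^esub> F (frag_of b)" (is "_ \<Longrightarrow> ?diff")
proof -
  interpret H: comm_group H by (rule H)
  note hom = hom_frag[OF F H.is_group]
  have k: "Poly_Mapping.keys (frag_of x :: 'a \<Rightarrow>\<^sub>0 int) \<subseteq> S" if "x \<in> S" for x using that by simp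
  have kd: "Poly_Mapping.keys (frag_of x - frag_of y :: 'a \<Rightarrow>\<^sub>0 int) \<subseteq> S" if "x \<in> S" "y \<in> S" for x y
    using keys_diff[of "frag_of x" "frag_of y"] that by auto
  have ks: "Poly_Mapping.keys (frag_of x + frag_of y :: 'a \<Rightarrow>\<^sub>0 int) \<subseteq> S" if "x \<in> S" "y \<in> S" for x y
    using keys_add[of "frag_of x" "frag_of y"] that by auto
  have eq: "x \<otimes>\<^bsub>H\<^esub> inv\<^bsub>H\<^esub> y = \<one>\<^bsub>H\<^esub> \<longleftrightarrow> x = y" if "x \<in> carrier H" "y \<in> carrier H" for x y
    using that by (metis H.inv_closed H.inv_inv H.inv_equality H.r_inv)
  show ?sum
    using S by (simp add: hom(1,2,3)[OF k k] hom(3)[OF k ks] hom(2)[OF k k] eq hom(1)[OF k k])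
  show ?diff if d: "d \<in> S"
  proof -
    note c = hom(1)[OF k k, of _ d]
    have "F ((frag_of a - frag_of b) - (frag_of c - frag_of d)) = \<one>\<^bsub>H\<^esub> \<longleftrightarrow>
      F (frag_of a) \<otimes>\<^bsub>H\<^esub> inv\<^bsub>H\<^esub> F (frag_of b) = F (frag_of c) \<otimes>\<^bsub>H\<^esub> inv\<^bsub>H\<^esub> F (frag_of d)"
      using S d by (simp add: hom(3)[OF kd kd] hom(3)[OF k k] eq c)
    also have "\<dots> \<longleftrightarrow> (F (frag_of a) \<otimes>\<^bsub>H\<^esub> inv\<^bsub>H\<^esub> F (frag_of b)) \<otimes>\<^bsub>H\<^esub> (F (frag_of b) \<otimes>\<^bsub>H\<^esub> F (frag_of d)) =
      (F (frag_of c) \<otimes>\<^bsub>H\<^esub> inv\<^bsub>H\<^esub> F (frag_of d)) \<otimes>\<^bsub>H\<^esub> (F (frag_of b) \<otimes>\<^bsub>H\<^esub> F (frag_of d))"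
      using S d c by simp
    also have "(F (frag_of a) \<otimes>\<^bsub>H\<^esub> inv\<^bsub>H\<^esub> F (frag_of b)) \<otimes>\<^bsub>H\<^esub> (F (frag_of b) \<otimes>\<^bsub>H\<^esub> F (frag_of d)) =
      F (frag_of a) \<otimes>\<^bsub>H\<^esub> F (frag_of d)"
      using S d c by (simp add: H.m_assoc H.inv_solve_left flip: H.m_assoc[of "inv\<^bsub>H\<^esub> F (frag_of b)"])
    also have "(F (frag_of c) \<otimes>\<^bsub>H\<^esub> inv\<^bsub>H\<^esub> F (frag_of d)) \<otimes>\<^bsub>H\<^esub> (F (frag_of b) \<otimes>\<^bsub>H\<^esub> F (frag_of d)) =
      F (frag_of c) \<otimes>\<^bsub>H\<^esub> F (frag_of b)"
    proof -
      have "F (frag_of b) \<otimes>\<^bsub>H\<^esub> F (frag_of d) = F (frag_of d) \<otimes>\<^bsub>H\<^esub> F (frag_of b)"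
        using S d c by (simp add: H.m_comm)
      then show ?thesis
        using S d c by (simp add: H.m_assoc flip: H.m_assoc[of "inv\<^bsub>H\<^esub> F (frag_of d)"])
    qed
    finally show ?thesis .
  qed
qed

locale presentation =
  fixes S :: "'g set" and Rels :: "('g \<Rightarrow>\<^sub>0 int) set"
  assumes rels: "Rels \<subseteq> carrier (free_Abelian_group S)"
begin

abbreviation "N \<equiv> generate (free_Abelian_group S) Rels"
abbreviation "P \<equiv> presented_group S Rels"
abbreviation "gen \<equiv> presented_gen S Rels"

lemma subgroup_rels: "subgroup N (free_Abelian_group S)"
  by (rule group.generate_is_subgroup[OF group_free_Abelian_group rels])

lemma normal_rels: "N \<lhd> free_Abelian_group S"
  by (rule comm_group.subgroup_imp_normal[OF abelian_free_Abelian_group subgroup_rels])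

lemma comm_group_presented: "comm_group P"
  unfolding presented_group_def
  by (rule comm_group.abelian_FactGroup[OF abelian_free_Abelian_group subgroup_rels])

definition proj where "proj x = N #>\<^bsub>free_Abelian_group S\<^esub> x"

lemma proj_hom: "proj \<in> hom (free_Abelian_group S) P"
  unfolding presented_group_def proj_def by (rule normal.r_coset_hom_Mod[OF normal_rels])

lemma proj_frag_of: "proj (frag_of x) = gen x"
  by (simp add: presented_gen_def proj_def)

lemma proj_surj: "carrier P = proj ` carrier (free_Abelian_group S)"
  by (auto simp: presented_group_def FactGroup_def RCOSETS_def proj_def)

lemma proj_rel:
  assumes "r \<in> Rels"
  shows "proj r = \<one>\<^bsub>P\<^esub>"
proof -
  have "r \<in> carrier (free_Abelian_group S)" using assms rels by blast
  moreover have "r \<in> N" using assms by (rule generate.incl)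
  ultimately have "proj r = N"
    unfolding proj_def by (rule group.coset_join2[OF group_free_Abelian_group _ subgroup_rels])
  then show ?thesis by (simp add: presented_group_def FactGroup_def)
qed

lemma gen_closed: "x \<in> S \<Longrightarrow> gen x \<in> carrier P"
  by (simp flip: proj_frag_of add: proj_surj)

lemma gen_relation:
  assumes S: "a \<in> S" "b \<in> S" "c \<in> S"
  shows "frag_of a - (frag_of b + frag_of c) \<in> Rels \<Longrightarrow> gen a = gen b \<otimes>\<^bsub>P\<^esub> gen c"
    and "(frag_of a - frag_of b) - (frag_of c - frag_of d) \<in> Rels \<Longrightarrow> d \<in> S \<Longrightarrow>
      gen a \<otimes>\<^bsub>P\<^esub> gen d = gen c \<otimes>\<^bsub>P\<^esub> gen b"
    and "frag_of a \<in> Rels \<Longrightarrow> gen a = \<one>\<^bsub>P\<^esub>"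
  using hom_frag_relation(1)[OF proj_hom comm_group_presented S]
    hom_frag_relation(2)[OF proj_hom comm_group_presented S, of d] proj_rel[of "frag_of a"]
    proj_rel[of "frag_of a - (frag_of b + frag_of c)"]
    proj_rel[of "(frag_of a - frag_of b) - (frag_of c - frag_of d)"]
  by (simp_all add: proj_frag_of)

text \<open>
  The differences of generators generate the free group, so a homomorphism is determined by its
  values on the generators.
\<close>

lemma hom_eqI:
  assumes f: "f \<in> hom P H" and g: "g \<in> hom P H" and H: "group H"
    and eq: "\<And>x. x \<in> S \<Longrightarrow> f (gen x) = g (gen x)" and x: "x \<in> carrier P"
  shows "f x = g x"
proof -
  have fp: "f \<circ> proj \<in> hom (free_Abelian_group S) H" "g \<circ> proj \<in> hom (free_Abelian_group S) H"
    by (rule Group.hom_compose[OF proj_hom f], rule Group.hom_compose[OF proj_hom g])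
  obtain y where y: "Poly_Mapping.keys y \<subseteq> S" "x = proj y" using x by (auto simp: proj_surj)
  have "Poly_Mapping.keys y \<subseteq> S \<and> (f \<circ> proj) y = (g \<circ> proj) y"
    using y(1)
  proof (induction y rule: frag_induction)
    case zero
    have one: "\<one>\<^bsub>P\<^esub> = proj 0" using hom_one[OF proj_hom] comm_group_presented by (simp add: comm_group_def)
    show ?case
      using hom_one[OF f] hom_one[OF g] comm_group_presented H by (simp add: comm_group_def one)
  next
    case (one x) then show ?case using eq by (simp add: proj_frag_of)
  next
    case (diff a b)
    then show ?case
      using hom_frag(3)[OF fp(1) H, of a b] hom_frag(3)[OF fp(2) H, of a b]
        keys_diff[of a b] by auto
  qed
  with y show ?thesis by simp
qed


text \<open>
  The universal property.  The relators are to be killed by an arbitrary homomorphic extension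
  \<open>F\<close> of \<open>f\<close>: this gives access to the values of \<open>F\<close> on formal differences of generators
  without a formula for \<open>F\<close>.
\<close>

lemma hom_exists:
  assumes H: "comm_group H" and f: "\<And>x. x \<in> S \<Longrightarrow> f x \<in> carrier H"
    and kill: "\<And>F r. \<lbrakk>F \<in> hom (free_Abelian_group S) H; \<And>x. x \<in> S \<Longrightarrow> F (frag_of x) = f x; r \<in> Rels\<rbrakk>
      \<Longrightarrow> F r = \<one>\<^bsub>H\<^esub>"
  shows "\<exists>h\<in>hom P H. h \<in> extensional (carrier P) \<and> (\<forall>x\<in>S. h (gen x) = f x)"
proof -
  interpret H: comm_group H by (rule H)
  obtain F where F: "F \<in> hom (free_Abelian_group S) H" "\<And>x. x \<in> S \<Longrightarrow> F (frag_of x) = f x"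
    using H.free_Abelian_group_universal[of f S] f by (auto simp: image_subset_iff)
  interpret F: group_hom "free_Abelian_group S" H F
    using F(1) by (intro group_hom.intro) (auto simp: group_hom_axioms_def)
  \<comment> \<open>The kernel of \<open>F\<close> is a subgroup containing the relators, hence all that they generate.\<close>
  have N: "F x = \<one>\<^bsub>H\<^esub>" if "x \<in> N" for x
  proof -
    have "N \<subseteq> kernel (free_Abelian_group S) H F"
    proof (rule group.generate_subgroup_incl[OF group_free_Abelian_group _ F.subgroup_kernel])
      show "Rels \<subseteq> kernel (free_Abelian_group S) H F"
      proof
        fix r assume "r \<in> Rels"
        then show "r \<in> kernel (free_Abelian_group S) H F"
          unfolding kernel_def using kill[OF F] rels by blast
      qed
    qed
    then show ?thesis using that by (auto simp: kernel_def)
  qed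
  define h where "h = restrict (\<lambda>X. F (SOME x. x \<in> X)) (carrier P)"
  have h: "h (proj x) = F x" if x: "x \<in> carrier (free_Abelian_group S)" for x
  proof -
    have "x \<in> proj x" unfolding proj_def using x by (rule group.rcos_self[OF group_free_Abelian_group _ subgroup_rels])
    then have "(SOME y. y \<in> proj x) \<in> proj x" by (rule someI)
    then obtain n where n: "n \<in> N" "(SOME y. y \<in> proj x) = n \<otimes>\<^bsub>free_Abelian_group S\<^esub> x"
      by (auto simp: proj_def r_coset_def)
    have "n \<in> carrier (free_Abelian_group S)" using n(1) subgroup_rels by (meson subgroup.mem_carrier)
    then have "F (n \<otimes>\<^bsub>free_Abelian_group S\<^esub> x) = F x"
      using x N[OF n(1)] by (subst F.hom_mult) simp_all
    then show ?thesis using x n by (simp add: h_def proj_surj)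
  qed
  show ?thesis
  proof (intro bexI[of _ h] conjI ballI)
    show "h \<in> hom P H"
    proof (rule homI)
      fix X Y assume "X \<in> carrier P" "Y \<in> carrier P"
      then obtain x y where xy: "x \<in> carrier (free_Abelian_group S)" "y \<in> carrier (free_Abelian_group S)" "X = proj x" "Y = proj y"
        by (auto simp: proj_surj)
      then show "h (X \<otimes>\<^bsub>P\<^esub> Y) = h X \<otimes>\<^bsub>H\<^esub> h Y"
        using h[of "x \<otimes>\<^bsub>free_Abelian_group S\<^esub> y"] xy group.is_monoid[OF group_free_Abelian_group[of S]]
          monoid.m_closed[of "free_Abelian_group S" x y]
        by (simp only: hom_mult[OF proj_hom, symmetric] h F.hom_mult)
    qed (auto simp: proj_surj h)
    show "h \<in> extensional (carrier P)" by (simp add: h_def)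
    show "h (gen x) = f x" if "x \<in> S" for x
      using that h[of "frag_of x"] F(2) by (simp add: proj_frag_of)
  qed
qed

lemma hom_unique_extensional:
  assumes f: "f \<in> hom P H" "f \<in> extensional (carrier P)"
    and g: "g \<in> hom P H" "g \<in> extensional (carrier P)"
    and H: "group H" and eq: "\<And>x. x \<in> S \<Longrightarrow> f (gen x) = g (gen x)"
  shows "f = g"
proof (rule extensionalityI)
  show "f \<in> extensional (carrier P)" "g \<in> extensional (carrier P)" using f g by auto
  show "f x = g x" if "x \<in> carrier P" for x
    using hom_eqI[OF f(1) g(1) H eq that] .
qed

end

section \<open>Calculus of block matrices\<close>

definition vcat :: "'a mat \<Rightarrow> 'a mat \<Rightarrow> 'a mat" where
  "vcat A B = mat (dim_row A + dim_row B) (dim_col A)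
     (\<lambda>(i, j). if i < dim_row A then A $$ (i, j) else B $$ (i - dim_row A, j))"

text \<open>
  Products and sums of block matrices are computed by simplification with \<open>block_simps\<close>.  Instead
  of \<open>carrier_mat\<close>, the lemmas of this section assume equations between dimensions, which the
  simplifier can decide.  Since \<open>hcat_vcat\<close> turns rows of blocks inside out, everything is
  normalised to columns of rows of blocks.
\<close>

lemma dim_hcat [simp]: "dim_row (hcat B A) = dim_row B" "dim_col (hcat B A) = dim_col B + dim_col A"
  by (simp_all add: hcat_def)

lemma dim_vcat [simp]: "dim_row (vcat A B) = dim_row A + dim_row B" "dim_col (vcat A B) = dim_col A"
  by (simp_all add: vcat_def)

lemma dim_block_diag [simp]:
  "dim_row (block_diag A B) = dim_row A + dim_row B" "dim_col (block_diag A B) = dim_col A + dim_col B"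
  by (simp_all add: block_diag_def)

lemma dim_col_block [simp]: "dim_row (col_block A i k) = dim_row A" "dim_col (col_block A i k) = k"
  by (simp_all add: col_block_def)

lemma index_hcat:
  "i < dim_row B \<Longrightarrow> j < dim_col B + dim_col A \<Longrightarrow>
   hcat B A $$ (i, j) = (if j < dim_col B then B $$ (i, j) else A $$ (i, j - dim_col B))"
  by (simp add: hcat_def)

lemma index_vcat:
  "i < dim_row A + dim_row B \<Longrightarrow> j < dim_col A \<Longrightarrow>
   vcat A B $$ (i, j) = (if i < dim_row A then A $$ (i, j) else B $$ (i - dim_row A, j))"
  by (simp add: vcat_def)

lemma index_col_block: "i < dim_row A \<Longrightarrow> j < k \<Longrightarrow> col_block A l k $$ (i, j) = A $$ (i, l + j)"
  by (simp add: col_block_def)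

lemma row_hcat:
  "dim_row A = dim_row B \<Longrightarrow> i < dim_row B \<Longrightarrow> row (hcat B A) i = row B i @\<^sub>v row A i"
  by (rule eq_vecI) (auto simp: index_hcat)

lemma col_vcat:
  "dim_col A = dim_col B \<Longrightarrow> j < dim_col B \<Longrightarrow> col (vcat A B) j = col A j @\<^sub>v col B j"
  by (rule eq_vecI) (auto simp: index_vcat)

lemma col_hcat:
  "dim_row A = dim_row B \<Longrightarrow> j < dim_col B + dim_col A \<Longrightarrow>
   col (hcat B A) j = (if j < dim_col B then col B j else col A (j - dim_col B))"
  by (rule eq_vecI) (auto simp: index_hcat)

lemma row_vcat:
  "dim_col A = dim_col B \<Longrightarrow> i < dim_row A + dim_row B \<Longrightarrow>
   row (vcat A B) i = (if i < dim_row A then row A i else row B (i - dim_row A))"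
  by (rule eq_vecI) (auto simp: index_vcat)

lemma hcat_mult_vcat:
  fixes A B P Q :: "'a::semiring_0 mat"
  assumes "dim_row A = dim_row B" "dim_col B = dim_row P" "dim_col A = dim_row Q" "dim_col P = dim_col Q"
  shows "hcat B A * vcat P Q = B * P + A * Q"
proof (rule eq_matI)
  fix i j assume ij: "i < dim_row (B * P + A * Q)" "j < dim_col (B * P + A * Q)"
  have "(row B i @\<^sub>v row A i) \<bullet> (col P j @\<^sub>v col Q j) = row B i \<bullet> col P j + row A i \<bullet> col Q j"
    by (rule scalar_prod_append[of _ "dim_col B" _ "dim_col A"]) (simp_all add: carrier_dim_vec assms(2,3)[symmetric])
  then show "(hcat B A * vcat P Q) $$ (i, j) = (B * P + A * Q) $$ (i, j)"
    using ij assms by (simp add: row_hcat col_vcat)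
qed (use assms in auto)

lemma mult_hcat:
  fixes A B U :: "'a::semiring_0 mat"
  assumes "dim_row A = dim_row B"
  shows "U * hcat B A = hcat (U * B) (U * A)"
  by (rule eq_matI) (use assms in \<open>auto simp: index_hcat col_hcat\<close>)

lemma vcat_mult:
  fixes A B U :: "'a::semiring_0 mat"
  assumes "dim_col A = dim_col B"
  shows "vcat A B * U = vcat (A * U) (B * U)"
  by (rule eq_matI) (use assms in \<open>auto simp: index_vcat row_vcat\<close>)

lemma hcat_add:
  assumes "dim_row A = dim_row B" "dim_row A' = dim_row A" "dim_row B' = dim_row A"
    "dim_col B = dim_col B'" "dim_col A = dim_col A'"
  shows "hcat B A + hcat B' A' = hcat (B + B') (A + A')"
  by (rule eq_matI) (use assms in \<open>auto simp: index_hcat\<close>)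

lemma vcat_add:
  assumes "dim_col A = dim_col B" "dim_col A' = dim_col A" "dim_col B' = dim_col A"
    "dim_row B = dim_row B'" "dim_row A = dim_row A'"
  shows "vcat A B + vcat A' B' = vcat (A + A') (B + B')"
  by (rule eq_matI) (use assms in \<open>auto simp: index_vcat\<close>)

lemma hcat_vcat:
  "dim_row A = dim_row B \<Longrightarrow> dim_row C = dim_row D \<Longrightarrow> dim_col A = dim_col C \<Longrightarrow> dim_col B = dim_col D \<Longrightarrow>
   hcat (vcat A C) (vcat B D) = vcat (hcat A B) (hcat C D)"
  by (rule eq_matI) (auto simp: index_hcat index_vcat)

lemma hcat_assoc:
  "dim_row B = dim_row A \<Longrightarrow> dim_row C = dim_row A \<Longrightarrow> hcat (hcat A B) C = hcat A (hcat B C)"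
  by (rule eq_matI) (auto simp: index_hcat)

lemma hcat_zero: "hcat (0\<^sub>m m k) (0\<^sub>m m l) = 0\<^sub>m m (k + l)"
  by (rule eq_matI) (auto simp: index_hcat)

lemma vcat_zero: "vcat (0\<^sub>m k n) (0\<^sub>m l n) = 0\<^sub>m (k + l) n"
  by (rule eq_matI) (auto simp: index_vcat)

lemma hcat_no_col [simp]:
  "dim_row A = dim_row B \<Longrightarrow> dim_col A = 0 \<Longrightarrow> hcat B A = B"
  "dim_row A = dim_row B \<Longrightarrow> dim_col A = 0 \<Longrightarrow> hcat A B = B"
  by (rule eq_matI; auto simp: index_hcat)+

lemma one_mat_blocks: "1\<^sub>m (k + l) = vcat (hcat (1\<^sub>m k) (0\<^sub>m k l)) (hcat (0\<^sub>m l k) (1\<^sub>m l))"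
  by (rule eq_matI) (auto simp: index_hcat index_vcat)

lemma block_diag_vcat:
  "block_diag A B = vcat (hcat A (0\<^sub>m (dim_row A) (dim_col B))) (hcat (0\<^sub>m (dim_row B) (dim_col A)) B)"
  by (rule eq_matI) (auto simp: index_hcat index_vcat block_diag_def)

lemma block_diag_hcat:
  "block_diag A B = hcat (vcat A (0\<^sub>m (dim_row B) (dim_col A))) (vcat (0\<^sub>m (dim_row A) (dim_col B)) B)"
  by (rule eq_matI) (auto simp: index_hcat index_vcat block_diag_def)

lemma col_block_mult:
  fixes A U :: "'a::semiring_0 mat"
  assumes "dim_col U = dim_row A" "i + k \<le> dim_col A"
  shows "col_block (U * A) i k = U * col_block A i k"
proof (rule eq_matI)
  fix r c assume rc: "r < dim_row (U * col_block A i k)" "c < dim_col (U * col_block A i k)"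
  then have "col (col_block A i k) c = col A (i + c)"
    using assms by (intro eq_vecI) (auto simp: index_col_block)
  then show "col_block (U * A) i k $$ (r, c) = (U * col_block A i k) $$ (r, c)"
    using rc assms by (simp add: index_col_block)
qed auto

lemma col_block_vcat:
  "dim_col A = dim_col B \<Longrightarrow> i + k \<le> dim_col A \<Longrightarrow>
   col_block (vcat A B) i k = vcat (col_block A i k) (col_block B i k)"
  by (rule eq_matI) (auto simp: index_vcat index_col_block)

lemma col_block_hcat_left:
  "i + k \<le> dim_col B \<Longrightarrow> col_block (hcat B A) i k = col_block B i k"
  by (rule eq_matI) (auto simp: index_hcat index_col_block)

lemma col_block_hcat_right:
  "dim_row A = dim_row B \<Longrightarrow> k \<le> dim_col A \<Longrightarrow>
   col_block (hcat B A) 0 (dim_col B + k) = hcat B (col_block A 0 k)"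
  by (rule eq_matI) (auto simp: index_hcat index_col_block)

lemma col_block_hcat_right_single:
  "dim_row A = dim_row B \<Longrightarrow> i + k \<le> dim_col A \<Longrightarrow>
   col_block (hcat B A) (dim_col B + i) k = col_block A i k"
  by (rule eq_matI) (auto simp: index_hcat index_col_block add.assoc)

lemma col_block_zero: "i + k \<le> n \<Longrightarrow> col_block (0\<^sub>m m n) i k = 0\<^sub>m m k"
  by (rule eq_matI) (auto simp: index_col_block)

lemma col_block_full: "col_block A 0 (dim_col A) = A"
  by (rule eq_matI) (auto simp: index_col_block)

lemma col_block_split:
  "hcat (col_block A 0 i) (col_block A i k) = col_block A 0 (i + k)"
  by (rule eq_matI) (auto simp: index_hcat index_col_block)

lemma mult_assoc_dim:
  fixes A B C :: "'a::semiring_0 mat"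
  shows "dim_col A = dim_row B \<Longrightarrow> dim_col B = dim_row C \<Longrightarrow> A * B * C = A * (B * C)"
  by (rule assoc_mult_mat[of _ "dim_row A" "dim_row B" _ "dim_row C" _ "dim_col C"]) auto

lemma mult_one_dim [simp]:
  fixes A :: "'a::{ring,monoid_mult} mat"
  shows "n = dim_row A \<Longrightarrow> 1\<^sub>m n * A = A" "n = dim_col A \<Longrightarrow> A * 1\<^sub>m n = A"
  using one_mult_mat[of A "dim_row A" "dim_col A"] mult_one_mat[of A "dim_row A" "dim_col A"] by auto

lemma mult_zero_dim [simp]:
  fixes A :: "'a::semiring_0 mat"
  shows "n = dim_row A \<Longrightarrow> 0\<^sub>m m n * A = 0\<^sub>m m (dim_col A)"
    "n = dim_col A \<Longrightarrow> A * 0\<^sub>m n m = 0\<^sub>m (dim_row A) m"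
  using left_mult_zero_mat[of A "dim_row A" "dim_col A" m]
    right_mult_zero_mat[of A "dim_row A" "dim_col A" m] by auto

lemma add_zero_dim [simp]:
  fixes A :: "'a::monoid_add mat"
  shows "m = dim_row A \<Longrightarrow> n = dim_col A \<Longrightarrow> 0\<^sub>m m n + A = A"
    "m = dim_row A \<Longrightarrow> n = dim_col A \<Longrightarrow> A + 0\<^sub>m m n = A"
  by (auto intro!: eq_matI)

lemma mult_uminus_dim [simp]:
  fixes A B :: "'a::ring mat"
  shows "dim_col A = dim_row B \<Longrightarrow> - A * B = - (A * B)" "dim_col A = dim_row B \<Longrightarrow> A * - B = - (A * B)"
  by (rule eq_matI; auto)+

lemma add_uminus_dim [simp]:
  fixes A :: "'a::group_add mat"
  shows "- A + A = 0\<^sub>m (dim_row A) (dim_col A)" "A + - A = 0\<^sub>m (dim_row A) (dim_col A)"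
  by (rule eq_matI; auto)+

lemma uminus_zero_mat [simp]: "- 0\<^sub>m m n = (0\<^sub>m m n :: 'a::group_add mat)"
  by (rule eq_matI) auto

lemma uminus_hcat: "dim_row A = dim_row B \<Longrightarrow> - hcat B A = hcat (- B) (- A)"
  by (rule eq_matI) (auto simp: index_hcat)

lemma uminus_vcat: "dim_col A = dim_col B \<Longrightarrow> - vcat A B = vcat (- A) (- B)"
  by (rule eq_matI) (auto simp: index_vcat)

lemmas block_simps = hcat_mult_vcat mult_hcat vcat_mult hcat_add vcat_add hcat_vcat hcat_zero
  vcat_zero uminus_hcat uminus_vcat

section \<open>Modules presented by matrices\<close>

lemma dim_row_mult_mat [simp]: "dim_vec (row_mult_mat v A) = dim_col A"
  by (simp add: row_mult_mat_def)

lemma row_mult_mat_carrier [simp]: "dim_col A = n \<Longrightarrow> row_mult_mat v A \<in> carrier_vec n"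
  by (simp add: carrier_dim_vec)

text \<open>
  This reduces row vectors to matrices with one row, so that associativity can be inherited from
  the product of matrices.
\<close>

lemma row_mult_mat_row: "i < dim_row U \<Longrightarrow> row_mult_mat (row U i) A = row (U * A) i"
  by (rule eq_vecI) (auto simp: row_mult_mat_def)

lemma vec_as_row: obtains U where "U \<in> carrier_mat 1 (dim_vec v)" "row U 0 = v"
proof
  show "mat 1 (dim_vec v) (\<lambda>(i, j). v $ j) \<in> carrier_mat 1 (dim_vec v)" by simp
  show "row (mat 1 (dim_vec v) (\<lambda>(i, j). v $ j)) 0 = v" by (rule eq_vecI) auto
qed

lemma row_mult_mat_assoc:
  fixes A B :: "'a::semiring_0 mat"
  assumes "dim_vec v = dim_row A" "dim_col A = dim_row B"
  shows "row_mult_mat (row_mult_mat v A) B = row_mult_mat v (A * B)"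
proof -
  obtain U where U: "U \<in> carrier_mat 1 (dim_vec v)" "row U 0 = v" by (rule vec_as_row)
  then have "dim_row U = 1" "dim_col U = dim_row A" using assms by auto
  then show ?thesis
    using assms by (simp add: U(2)[symmetric] row_mult_mat_row mult_assoc_dim)
qed

lemma row_mult_mat_unit:
  fixes A :: "'a::{ring,monoid_mult} mat"
  assumes "dim_row A = n" "i < n"
  shows "row_mult_mat (row (1\<^sub>m n) i) A = row A i"
  using row_mult_mat_row[of i "1\<^sub>m n" A] assms by simp

lemma row_mult_mat_one [simp]:
  fixes v :: "'a::{ring,monoid_mult} vec"
  assumes "dim_vec v = n"
  shows "row_mult_mat v (1\<^sub>m n) = v"
proof -
  obtain U where U: "U \<in> carrier_mat 1 (dim_vec v)" "row U 0 = v" by (rule vec_as_row)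
  then have "dim_row U = 1" "dim_col U = n" using assms by auto
  then show ?thesis using row_mult_mat_row[of 0 U "1\<^sub>m n"] by (simp add: U(2)[symmetric])
qed

lemma row_mult_mat_add_right:
  fixes A B :: "'a::semiring_0 mat"
  assumes "dim_row A = dim_vec v" "dim_row B = dim_vec v" "dim_col A = dim_col B"
  shows "row_mult_mat v (A + B) = row_mult_mat v A + row_mult_mat v B"
  by (rule eq_vecI) (use assms in \<open>auto simp: row_mult_mat_def scalar_prod_def distrib_left sum.distrib\<close>)

lemma row_mult_mat_diff:
  fixes A :: "'a::{ring,monoid_mult} mat"
  assumes "dim_vec v = dim_row A" "dim_vec w = dim_row A"
  shows "row_mult_mat (v - w) A = row_mult_mat v A - row_mult_mat w A"
  by (rule eq_vecI) (use assms in \<open>auto simp: row_mult_mat_def scalar_prod_def left_diff_distrib sum_subtractf\<close>)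

lemma row_mult_mat_smult:
  fixes A :: "'a::{ring,monoid_mult} mat"
  assumes "dim_vec v = dim_row A"
  shows "row_mult_mat (r \<cdot>\<^sub>v v) A = r \<cdot>\<^sub>v row_mult_mat v A"
  by (rule eq_vecI) (use assms in \<open>auto simp: row_mult_mat_def scalar_prod_def sum_distrib_left mult.assoc\<close>)

lemma row_mult_mat_zero [simp]:
  fixes v :: "'a::{ring,monoid_mult} vec"
  shows "row_mult_mat v (0\<^sub>m m n) = 0\<^sub>v n"
  by (rule eq_vecI) (auto simp: row_mult_mat_def scalar_prod_def)

lemma free_lmod_simps [simp]:
  "carrier (free_lmod n) = carrier_vec n" "\<zero>\<^bsub>free_lmod n\<^esub> = 0\<^sub>v n"
  "x \<oplus>\<^bsub>free_lmod n\<^esub> y = x + y" "r \<odot>\<^bsub>free_lmod n\<^esub> x = r \<cdot>\<^sub>v x"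
  by (simp_all add: free_lmod_def)

lemma lmod_hom_compose: "f \<in> lmod_hom M N \<Longrightarrow> g \<in> lmod_hom N L \<Longrightarrow> (\<lambda>x. g (f x)) \<in> lmod_hom M L"
  by (auto simp: lmod_hom_def Pi_iff)

lemma lmod_homD:
  assumes "f \<in> lmod_hom M N" "x \<in> carrier M"
  shows "f x \<in> carrier N" "y \<in> carrier M \<Longrightarrow> f (x \<oplus>\<^bsub>M\<^esub> y) = f x \<oplus>\<^bsub>N\<^esub> f y" "f (r \<odot>\<^bsub>M\<^esub> x) = r \<odot>\<^bsub>N\<^esub> f x"
  using assms unfolding lmod_hom_def by blast+

lemma lmod_hom_freeD:
  assumes "f \<in> lmod_hom (free_lmod n) N" "x \<in> carrier_vec n"
  shows "f x \<in> carrier N" "y \<in> carrier_vec n \<Longrightarrow> f (x + y) = f x \<oplus>\<^bsub>N\<^esub> f y" "f (r \<cdot>\<^sub>v x) = r \<odot>\<^bsub>N\<^esub> f x"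
  using lmod_homD[OF assms(1), of x] assms(2) by simp_all

lemma lmod_hom_free_zero:
  assumes f: "f \<in> lmod_hom (free_lmod n) N" and N: "left_module N"
  shows "f (0\<^sub>v n) = \<zero>\<^bsub>N\<^esub>"
proof -
  interpret left_module N by (rule N)
  note z = zero_carrier_vec[of n]
  have "f (0\<^sub>v n) \<oplus>\<^bsub>N\<^esub> f (0\<^sub>v n) = f (0\<^sub>v n)"
    using lmod_hom_freeD(2)[OF f z z] by simp
  then show ?thesis using lmod_hom_freeD(1)[OF f z] by simp
qed

lemma lmod_hom_free_eq_iff:
  assumes f: "f \<in> lmod_hom (free_lmod n) N" and N: "left_module N" and x: "x \<in> carrier_vec n" and y: "y \<in> carrier_vec n"
  shows "f x = f y \<longleftrightarrow> f (x - y) = \<zero>\<^bsub>N\<^esub>"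
proof -
  interpret left_module N by (rule N)
  note d = minus_carrier_vec[OF x y]
  have "(x - y) + y = x" using x y by auto
  then have "f x = f (x - y) \<oplus>\<^bsub>N\<^esub> f y" using lmod_hom_freeD(2)[OF f d y] by simp
  then show ?thesis using lmod_hom_freeD(1)[OF f] x y d by simp
qed

text \<open>
  The standard basis of the free module is taken as the rows of the identity matrix, since this
  also makes sense if \<open>0 = 1\<close> in the ring.
\<close>

lemma lmod_hom_free_eqI:
  fixes f g :: "'a::{ring,monoid_mult} vec \<Rightarrow> 'b"
  assumes f: "f \<in> lmod_hom (free_lmod n) N" and g: "g \<in> lmod_hom (free_lmod n) N" and N: "left_module N"
    and eq: "\<And>i. i < n \<Longrightarrow> f (row (1\<^sub>m n) i) = g (row (1\<^sub>m n) i)" and x: "x \<in> carrier_vec n"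
  shows "f x = g x"
proof -
  have "f x = g x" if "k \<le> n" "x \<in> carrier_vec n" "\<And>i. k \<le> i \<Longrightarrow> i < n \<Longrightarrow> x $ i = 0" for k x
    using that
  \<comment> \<open>Induction on the number \<open>k\<close> of leading entries that may be nonzero.\<close>
  proof (induction k arbitrary: x)
    case 0
    then have "x = 0\<^sub>v n" by (intro eq_vecI) auto
    then show ?case using lmod_hom_free_zero[OF f N] lmod_hom_free_zero[OF g N] by simp
  next
    case (Suc k)
    let ?y = "vec n (\<lambda>i. if i = k then 0 else x $ i)" and ?e = "row (1\<^sub>m n) k :: 'a vec"
    have y: "f ?y = g ?y" using Suc.prems by (intro Suc.IH) auto
    have x: "x = ?y + x $ k \<cdot>\<^sub>v ?e"
      using Suc.prems by (intro eq_vecI) (auto simp: le_less_Suc_eq)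
    have c: "?y \<in> carrier_vec n" "?e \<in> carrier_vec n" "x $ k \<cdot>\<^sub>v ?e \<in> carrier_vec n"
      using row_carrier[of "1\<^sub>m n :: 'a mat" k] by simp_all
    have F: "F x = F ?y \<oplus>\<^bsub>N\<^esub> x $ k \<odot>\<^bsub>N\<^esub> F ?e" if F: "F \<in> lmod_hom (free_lmod n) N" for F
      using lmod_hom_freeD(2)[OF F c(1,3)] lmod_hom_freeD(3)[OF F c(2)] x by metis
    show ?case using F[OF f] F[OF g] y eq[of k] Suc.prems(1) by simp
  qed
  then show ?thesis using x by (metis le_refl not_le)
qed

text \<open>
  Two quotients of \<open>F\<close> by the same congruence are isomorphic: choose any preimage in \<open>F\<close> and
  apply the other projection.
\<close>

lemma lmod_isomorphic_if_same_fibres: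
  assumes p: "p \<in> lmod_hom F M" "p ` carrier F = carrier M"
    and q: "q \<in> lmod_hom F N" "q ` carrier F = carrier N"
    and eq: "\<And>x y. x \<in> carrier F \<Longrightarrow> y \<in> carrier F \<Longrightarrow> p x = p y \<longleftrightarrow> q x = q y"
    and closed: "\<And>x y. x \<in> carrier F \<Longrightarrow> y \<in> carrier F \<Longrightarrow> x \<oplus>\<^bsub>F\<^esub> y \<in> carrier F"
      "\<And>r x. x \<in> carrier F \<Longrightarrow> r \<odot>\<^bsub>F\<^esub> x \<in> carrier F"
  shows "lmod_isomorphic M N"
proof -
  define h where "h m = q (SOME x. x \<in> carrier F \<and> p x = m)" for m
  have h: "h (p x) = q x" if "x \<in> carrier F" for x
  proof -
    have "(SOME y. y \<in> carrier F \<and> p y = p x) \<in> carrier F \<and> p (SOME y. y \<in> carrier F \<and> p y = p x) = p x"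
      by (rule someI[where x = x]) (use that in simp)
    then show ?thesis unfolding h_def using eq[of "SOME y. y \<in> carrier F \<and> p y = p x" x] that by blast
  qed
  have add: "p (x \<oplus>\<^bsub>F\<^esub> y) = p x \<oplus>\<^bsub>M\<^esub> p y" "q (x \<oplus>\<^bsub>F\<^esub> y) = q x \<oplus>\<^bsub>N\<^esub> q y"
    if "x \<in> carrier F" "y \<in> carrier F" for x y
    using p(1) q(1) that by (simp_all add: lmod_hom_def)
  have sm: "p (r \<odot>\<^bsub>F\<^esub> x) = r \<odot>\<^bsub>M\<^esub> p x" "q (r \<odot>\<^bsub>F\<^esub> x) = r \<odot>\<^bsub>N\<^esub> q x" if "x \<in> carrier F" for r x
    using p(1) q(1) that by (simp_all add: lmod_hom_def)
  have "h \<in> lmod_hom M N"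
    unfolding lmod_hom_def
  proof (intro CollectI conjI ballI allI funcsetI)
    fix m assume "m \<in> carrier M"
    then obtain x where "x \<in> carrier F" "m = p x" using p(2) by blast
    then show "h m \<in> carrier N" using h q(2) by auto
  next
    fix m m' assume "m \<in> carrier M" "m' \<in> carrier M"
    then obtain x x' where "x \<in> carrier F" "m = p x" "x' \<in> carrier F" "m' = p x'" using p(2) by blast
    then show "h (m \<oplus>\<^bsub>M\<^esub> m') = h m \<oplus>\<^bsub>N\<^esub> h m'" by (simp add: h closed add flip: add(1))
  next
    fix r m assume "m \<in> carrier M"
    then obtain x where "x \<in> carrier F" "m = p x" using p(2) by blast
    then show "h (r \<odot>\<^bsub>M\<^esub> m) = r \<odot>\<^bsub>N\<^esub> h m" by (simp add: h closed sm flip: sm(1))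
  qed
  moreover have "bij_betw h (carrier M) (carrier N)"
    unfolding bij_betw_def
  proof
    show "inj_on h (carrier M)"
      unfolding p(2)[symmetric] by (auto simp: inj_on_def h eq)
    show "h ` carrier M = carrier N"
      unfolding p(2)[symmetric] q(2)[symmetric] by (auto simp: h image_image)
  qed
  ultimately show ?thesis by (auto simp: lmod_isomorphic_def)
qed

lemma lmod_isomorphic_refl: "lmod_isomorphic M M"
  unfolding lmod_isomorphic_def by (rule bexI[of _ "\<lambda>x. x"]) (auto simp: lmod_hom_def bij_betw_def)

lemma lmod_isomorphic_sym:
  assumes "lmod_isomorphic M N" "left_module M"
  shows "lmod_isomorphic N M"
proof -
  interpret left_module M by fact
  obtain f where f: "f \<in> lmod_hom M N" "bij_betw f (carrier M) (carrier N)"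
    using assms(1) by (auto simp: lmod_isomorphic_def)
  show ?thesis
    by (rule lmod_isomorphic_if_same_fibres[where p = f and F = M and q = "\<lambda>x. x"])
      (use f in \<open>auto simp: bij_betw_def lmod_hom_def smult_closed inj_on_eq_iff\<close>)
qed

lemma lmod_isomorphic_trans:
  assumes "lmod_isomorphic M N" "lmod_isomorphic N L"
  shows "lmod_isomorphic M L"
proof -
  obtain f g where f: "f \<in> lmod_hom M N" "bij_betw f (carrier M) (carrier N)"
    and g: "g \<in> lmod_hom N L" "bij_betw g (carrier N) (carrier L)"
    using assms by (auto simp: lmod_isomorphic_def)
  have "bij_betw (\<lambda>x. g (f x)) (carrier M) (carrier L)"
    using bij_betw_trans[OF f(2) g(2)] by (simp add: comp_def)
  then show ?thesis
    unfolding lmod_isomorphic_def using lmod_hom_compose[OF f(1) g(1)] by blast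
qed

text \<open>
  The members of a class are modules over one fixed type, while \<open>M\<close> and \<open>N\<close> may live over other
  types and need not be members of their own classes.
\<close>

lemma lmod_class_eqI:
  assumes "lmod_isomorphic M N" "left_module M"
  shows "lmod_class M = lmod_class N"
  using lmod_isomorphic_trans[OF _ assms(1)] lmod_isomorphic_trans[OF _ lmod_isomorphic_sym[OF assms]]
  by (auto simp: lmod_class_def)

lemma lmod_class_eqD:
  fixes M :: "('a::{ring,monoid_mult}, 'a vec set) module"
  assumes "lmod_class M = lmod_class N" "finitely_presented M"
  shows "lmod_isomorphic M N"
proof -
  have "M \<in> lmod_class M" using assms(2) by (simp add: lmod_class_def lmod_isomorphic_refl)
  then have "M \<in> lmod_class N" using assms(1) by blast
  then show ?thesis by (simp add: lmod_class_def)
qed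

text \<open>
  Exactness of \<open>R\<^sup>m \<rightarrow> R\<^sup>n \<rightarrow> M \<rightarrow> 0\<close>, where the first map is right multiplication by \<open>A\<close> and
  the second one is \<open>g\<close>.
\<close>

definition presents :: "'a::{ring,monoid_mult} mat \<Rightarrow> ('a vec \<Rightarrow> 'b) \<Rightarrow> ('a, 'b) module \<Rightarrow> bool" where
  "presents A g M \<longleftrightarrow> left_module M \<and> g \<in> lmod_hom (free_lmod (dim_col A)) M \<and>
     g ` carrier_vec (dim_col A) = carrier M \<and>
     (\<forall>x\<in>carrier_vec (dim_col A). g x = \<zero>\<^bsub>M\<^esub> \<longleftrightarrow> (\<exists>u\<in>carrier_vec (dim_row A). x = row_mult_mat u A))"

lemma presents_coker_mod: "\<exists>g. presents A g (coker_mod A)"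
  for A :: "'a::{ring,monoid_mult} mat"
proof -
  let ?F = "free_lmod (dim_row A) :: ('a, 'a vec) module"
  let ?E = "free_lmod (dim_col A) :: ('a, 'a vec) module"
  let ?f = "\<lambda>v. row_mult_mat v A" and ?K = "(\<lambda>v. row_mult_mat v A) ` carrier ?F"
  interpret F: left_module ?F by (rule left_module_free_lmod)
  interpret E: left_module ?E by (rule left_module_free_lmod)
  note f = row_mult_mat_hom[of A]
  have "group_hom (add_monoid ?F) (add_monoid ?E) ?f"
    using f by (intro group_hom.intro group_hom_axioms.intro F.a_group E.a_group)
      (auto simp: hom_def lmod_hom_def)
  then have sub: "subgroup ?K (add_monoid ?E)"
    using group_hom.img_is_subgroup[of "add_monoid ?F" "add_monoid ?E" ?f] by simp
  have sm: "r \<odot>\<^bsub>?E\<^esub> x \<in> ?K" if "x \<in> ?K" for r x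
  proof -
    from that obtain v where v: "x = ?f v" "v \<in> carrier ?F" by (rule imageE)
    then have "r \<odot>\<^bsub>?E\<^esub> x = ?f (r \<odot>\<^bsub>?F\<^esub> v)" by (simp add: row_mult_mat_smult)
    then show ?thesis using F.smult_closed[OF v(2)] by (auto intro: imageI)
  qed
  note q = E.quotient_module[OF sub sm]
  have "presents A (\<lambda>x. ?K +>\<^bsub>?E\<^esub> x) (coker_mod A)"
    unfolding presents_def coker_mod_def
    using q(1,2,3) q(4)[unfolded set_eq_iff] by (auto simp: image_iff)
  then show ?thesis by blast
qed

lemma presents_eq_iff:
  assumes "presents A g M" "x \<in> carrier_vec (dim_col A)" "y \<in> carrier_vec (dim_col A)"
  shows "g x = g y \<longleftrightarrow> (\<exists>u\<in>carrier_vec (dim_row A). x = y + row_mult_mat u A)"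
proof -
  have "g x = g y \<longleftrightarrow> g (x - y) = \<zero>\<^bsub>M\<^esub>"
    using assms by (intro lmod_hom_free_eq_iff) (auto simp: presents_def)
  also have "\<dots> \<longleftrightarrow> (\<exists>u\<in>carrier_vec (dim_row A). x - y = row_mult_mat u A)"
    using assms by (simp add: presents_def)
  finally have "g x = g y \<longleftrightarrow> (\<exists>u\<in>carrier_vec (dim_row A). x - y = row_mult_mat u A)" .
  moreover have "x - y = row_mult_mat u A \<longleftrightarrow> x = y + row_mult_mat u A" for u
    using assms(2,3) by (auto simp: vec_eq_iff algebra_simps)
  ultimately show ?thesis by simp
qed

text \<open>
  Free modules are projective: a homomorphism into \<open>M\<close> lifts along \<open>g\<close>, and the lift is given by
  a matrix.
\<close>

lemma lmod_hom_free_matrix: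
  assumes A: "presents A g M" and f: "f \<in> lmod_hom (free_lmod n) M"
  shows "\<exists>P\<in>carrier_mat n (dim_col A). \<forall>x\<in>carrier_vec n. g (row_mult_mat x P) = f x"
proof -
  have M: "left_module M" and g: "g \<in> lmod_hom (free_lmod (dim_col A)) M"
    "g ` carrier_vec (dim_col A) = carrier M"
    using A by (auto simp: presents_def)
  have "\<exists>p. p \<in> carrier_vec (dim_col A) \<and> g p = f (row (1\<^sub>m n) i)" for i
  proof -
    have "f (row (1\<^sub>m n) i) \<in> carrier M"
      by (rule lmod_hom_freeD(1)[OF f]) (metis row_carrier index_one_mat(3))
    then show ?thesis using g(2) by (metis imageE)
  qed
  then obtain p where p: "\<And>i. p i \<in> carrier_vec (dim_col A)" "\<And>i. g (p i) = f (row (1\<^sub>m n) i)" by metis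
  let ?P = "mat n (dim_col A) (\<lambda>(i, j). p i $ j)"
  have row: "row ?P i = p i" if "i < n" for i using that p(1)[of i] by (intro eq_vecI) auto
  have h: "(\<lambda>x. g (row_mult_mat x ?P)) \<in> lmod_hom (free_lmod n) M"
    using lmod_hom_compose[OF row_mult_mat_hom[of ?P]] g(1) by simp
  have "g (row_mult_mat x ?P) = f x" if "x \<in> carrier_vec n" for x
    by (rule lmod_hom_free_eqI[OF h f M _ that]) (use p row row_mult_mat_unit[of ?P n] in simp)
  then show ?thesis by (intro bexI[of _ ?P]) auto
qed

lemma presents_free_lmod: "presents (0\<^sub>m 0 n) (\<lambda>x. x) (free_lmod n)"
  unfolding presents_def using left_module_free_lmod
  by (auto simp: lmod_hom_def intro!: exI[of _ "0\<^sub>v 0"])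

lemma finitely_presented_obtains_matrix:
  assumes "finitely_presented M"
  obtains A g where "presents A g M"
proof -
  obtain m n f g where M: "left_module M" and f: "f \<in> lmod_hom (free_lmod m) (free_lmod n)"
    and g: "g \<in> lmod_hom (free_lmod n) M" "g ` carrier_vec n = carrier M"
    "{x \<in> carrier_vec n. g x = \<zero>\<^bsub>M\<^esub>} = f ` carrier_vec m"
    using assms by (auto simp: finitely_presented_def)
  obtain A where A: "A \<in> carrier_mat m n" "\<forall>x\<in>carrier_vec m. row_mult_mat x A = f x"
    using lmod_hom_free_matrix[OF presents_free_lmod f] by auto
  have "presents A g M"
    unfolding presents_def using A M g(1,2) g(3)[unfolded set_eq_iff] by (force simp: image_iff)
  then show ?thesis ..
qed


text \<open>
  The matrix form of an isomorphism between cokernels.  \<open>P\<close> and \<open>Q\<close> are lifts to the free modules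
  of the isomorphism and of its inverse, \<open>S\<close> and \<open>T\<close> express that they carry relations to relations,
  and \<open>W\<close> and \<open>Z\<close> that they are inverse to each other modulo relations.
\<close>

definition coker_equiv :: "'a::{ring,monoid_mult} mat \<Rightarrow> 'a mat \<Rightarrow> bool" where
  "coker_equiv A B \<longleftrightarrow> (\<exists>P Q S T W Z.
     P \<in> carrier_mat (dim_col A) (dim_col B) \<and> Q \<in> carrier_mat (dim_col B) (dim_col A) \<and>
     S \<in> carrier_mat (dim_row A) (dim_row B) \<and> T \<in> carrier_mat (dim_row B) (dim_row A) \<and>
     W \<in> carrier_mat (dim_col A) (dim_row A) \<and> Z \<in> carrier_mat (dim_col B) (dim_row B) \<and>
     A * P = S * B \<and> B * Q = T * A \<and>
     P * Q = 1\<^sub>m (dim_col A) + W * A \<and> Q * P = 1\<^sub>m (dim_col B) + Z * B)"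

lemma coker_equiv_imp_isomorphic:
  assumes A: "presents A g M" and B: "presents B h N" and eq: "coker_equiv A B"
  shows "lmod_isomorphic M N"
proof -
  obtain P Q S T W Z where c: "P \<in> carrier_mat (dim_col A) (dim_col B)" "Q \<in> carrier_mat (dim_col B) (dim_col A)"
     "S \<in> carrier_mat (dim_row A) (dim_row B)" "T \<in> carrier_mat (dim_row B) (dim_row A)"
     "W \<in> carrier_mat (dim_col A) (dim_row A)" "Z \<in> carrier_mat (dim_col B) (dim_row B)"
    and e: "A * P = S * B" "B * Q = T * A" "P * Q = 1\<^sub>m (dim_col A) + W * A" "Q * P = 1\<^sub>m (dim_col B) + Z * B"
    using eq unfolding coker_equiv_def by metis
  have g: "g \<in> lmod_hom (free_lmod (dim_col A)) M" "g ` carrier_vec (dim_col A) = carrier M"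
    using A by (auto simp: presents_def)
  have h: "h \<in> lmod_hom (free_lmod (dim_col B)) N" "h ` carrier_vec (dim_col B) = carrier N"
    using B by (auto simp: presents_def)
  let ?q = "\<lambda>x. h (row_mult_mat x P)"
  have q: "?q \<in> lmod_hom (free_lmod (dim_col A)) N"
    using lmod_hom_compose[OF row_mult_mat_hom[of P]] h(1) c(1) by simp
  have surj: "?q ` carrier_vec (dim_col A) = carrier N"
  proof
    show "?q ` carrier_vec (dim_col A) \<subseteq> carrier N" using q by (auto simp: lmod_hom_def)
    show "carrier N \<subseteq> ?q ` carrier_vec (dim_col A)"
    proof
      fix n assume "n \<in> carrier N"
      then obtain y where y: "y \<in> carrier_vec (dim_col B)" "n = h y" using h(2) by blast
      have "row_mult_mat (row_mult_mat y Q) P = row_mult_mat y (1\<^sub>m (dim_col B) + Z * B)"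
        using c y e by (simp add: row_mult_mat_assoc)
      also have "\<dots> = y + row_mult_mat (row_mult_mat y Z) B"
        using c y by (simp add: row_mult_mat_add_right row_mult_mat_assoc)
      finally have "?q (row_mult_mat y Q) = n"
        using presents_eq_iff[OF B, of "row_mult_mat (row_mult_mat y Q) P" y] c y by auto
      then show "n \<in> ?q ` carrier_vec (dim_col A)" using c by auto
    qed
  qed
  have ker: "g x = \<zero>\<^bsub>M\<^esub> \<longleftrightarrow> ?q x = \<zero>\<^bsub>N\<^esub>" if x: "x \<in> carrier_vec (dim_col A)" for x
  proof
    assume "g x = \<zero>\<^bsub>M\<^esub>"
    then obtain u where u: "u \<in> carrier_vec (dim_row A)" "x = row_mult_mat u A"
      using A x by (auto simp: presents_def)
    then have "row_mult_mat x P = row_mult_mat (row_mult_mat u S) B"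
      using c e by (simp add: row_mult_mat_assoc)
    then show "?q x = \<zero>\<^bsub>N\<^esub>" using B c by (simp add: presents_def) (metis row_mult_mat_carrier carrier_matD(2))
  next
    assume "?q x = \<zero>\<^bsub>N\<^esub>"
    then obtain u where u: "u \<in> carrier_vec (dim_row B)" "row_mult_mat x P = row_mult_mat u B"
      using B x c by (auto simp: presents_def)
    have "x + row_mult_mat (row_mult_mat x W) A = row_mult_mat x (1\<^sub>m (dim_col A) + W * A)"
      using c x by (simp add: row_mult_mat_add_right row_mult_mat_assoc)
    also have "\<dots> = row_mult_mat (row_mult_mat x P) Q"
      using c x e by (simp add: row_mult_mat_assoc)
    also have "\<dots> = row_mult_mat (row_mult_mat u T) A"
      using c u e by (simp add: row_mult_mat_assoc)
    finally have "x = row_mult_mat (row_mult_mat u T) A - row_mult_mat (row_mult_mat x W) A"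
      using x by (auto simp: vec_eq_iff algebra_simps)
    also have "\<dots> = row_mult_mat (row_mult_mat u T - row_mult_mat x W) A"
      using c by (simp add: row_mult_mat_diff)
    finally show "g x = \<zero>\<^bsub>M\<^esub>"
      using A x c by (auto simp: presents_def intro!: bexI[of _ "row_mult_mat u T - row_mult_mat x W"])
  qed
  show ?thesis
  proof (rule lmod_isomorphic_if_same_fibres)
    show "g \<in> lmod_hom (free_lmod (dim_col A)) M" "?q \<in> lmod_hom (free_lmod (dim_col A)) N"
      by (fact g(1), fact q)
    show "g x = g y \<longleftrightarrow> ?q x = ?q y"
      if "x \<in> carrier (free_lmod (dim_col A))" "y \<in> carrier (free_lmod (dim_col A))" for x y
      using that A B lmod_hom_free_eq_iff[OF g(1), of x y] lmod_hom_free_eq_iff[OF q, of x y] ker[of "x - y"]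
      by (simp add: presents_def)
  qed (use g surj in auto)
qed

text \<open>
  A congruence modulo the row space of \<open>B\<close> that holds on all vectors is solved by one matrix \<open>W\<close>:
  it suffices to solve it on the standard basis.
\<close>

lemma matrix_eq_add_mult:
  fixes X Y B :: "'a::{ring,monoid_mult} mat"
  assumes "X \<in> carrier_mat m n" "Y \<in> carrier_mat m n" "dim_col B = n"
    and ex: "\<And>x. x \<in> carrier_vec m \<Longrightarrow>
      \<exists>u\<in>carrier_vec (dim_row B). row_mult_mat x X = row_mult_mat x Y + row_mult_mat u B"
  shows "\<exists>W\<in>carrier_mat m (dim_row B). X = Y + W * B"
proof -
  obtain u where u: "\<And>i. u i \<in> carrier_vec (dim_row B)"
    "\<And>i. row_mult_mat (row (1\<^sub>m m) i) X = row_mult_mat (row (1\<^sub>m m) i) Y + row_mult_mat (u i) B"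
    using ex[of "row (1\<^sub>m m) _"] row_carrier[of "1\<^sub>m m"] by (metis index_one_mat(3))
  let ?W = "mat m (dim_row B) (\<lambda>(i, j). u i $ j)"
  have row: "row ?W i = u i" if "i < m" for i using that u(1)[of i] by (intro eq_vecI) auto
  have "X = Y + ?W * B"
  proof (rule eq_rowI)
    fix i assume "i < dim_row (Y + ?W * B)"
    then have i: "i < m" by simp
    have "row X i = row Y i + row_mult_mat (u i) B"
      using u(2)[of i] i assms row_mult_mat_unit[of X m i] row_mult_mat_unit[of Y m i] by auto
    also have "row_mult_mat (u i) B = row (?W * B) i"
      using i row row_mult_mat_row[of i ?W B] by simp
    also have "row Y i + row (?W * B) i = row (Y + ?W * B) i" using i assms by simp
    finally show "row X i = row (Y + ?W * B) i" .
  qed (use assms in auto)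
  then show ?thesis by (intro bexI[of _ ?W]) auto
qed

lemma isomorphic_imp_coker_equiv:
  assumes A: "presents A g M" and B: "presents B h N" and iso: "lmod_isomorphic M N"
  shows "coker_equiv A B"
proof -
  let ?m = "dim_row A" and ?n = "dim_col A" and ?k = "dim_row B" and ?l = "dim_col B"
  obtain f where f: "f \<in> lmod_hom M N" "bij_betw f (carrier M) (carrier N)"
    using iso by (auto simp: lmod_isomorphic_def)
  have mods: "left_module M" "left_module N" using A B by (auto simp: presents_def)
  interpret M: left_module M by (rule mods)
  define f' where "f' = inv_into (carrier M) f"
  have f'f: "f' (f x) = x" if "x \<in> carrier M" for x
    using f(2) that by (auto simp: f'_def bij_betw_def)
  have f'c: "f' y \<in> carrier M" "f (f' y) = y" if "y \<in> carrier N" for y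
    using f(2) that unfolding f'_def bij_betw_def by (auto simp: inv_into_into f_inv_into_f)
  have f': "f' \<in> lmod_hom N M"
    unfolding lmod_hom_def
  proof (intro CollectI conjI ballI allI funcsetI)
    fix y y' assume y: "y \<in> carrier N" "y' \<in> carrier N"
    then have "f (f' y \<oplus>\<^bsub>M\<^esub> f' y') = y \<oplus>\<^bsub>N\<^esub> y'"
      using f(1) f'c by (simp add: lmod_hom_def)
    then show "f' (y \<oplus>\<^bsub>N\<^esub> y') = f' y \<oplus>\<^bsub>M\<^esub> f' y'" using f'f[of "f' y \<oplus>\<^bsub>M\<^esub> f' y'"] f'c y by simp
  next
    fix r y assume y: "y \<in> carrier N"
    then have "f (r \<odot>\<^bsub>M\<^esub> f' y) = r \<odot>\<^bsub>N\<^esub> y" using f(1) f'c by (simp add: lmod_hom_def)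
    then show "f' (r \<odot>\<^bsub>N\<^esub> y) = r \<odot>\<^bsub>M\<^esub> f' y"
      using f'f[of "r \<odot>\<^bsub>M\<^esub> f' y"] f'c y M.smult_closed by simp
  qed (rule f'c)
  have g: "g \<in> lmod_hom (free_lmod ?n) M" and h: "h \<in> lmod_hom (free_lmod ?l) N"
    using A B by (auto simp: presents_def)
  obtain P where P: "P \<in> carrier_mat ?n ?l" "\<And>x. x \<in> carrier_vec ?n \<Longrightarrow> h (row_mult_mat x P) = f (g x)"
    using lmod_hom_free_matrix[OF B lmod_hom_compose[OF g f(1)]] by auto
  obtain Q where Q: "Q \<in> carrier_mat ?l ?n" "\<And>y. y \<in> carrier_vec ?l \<Longrightarrow> g (row_mult_mat y Q) = f' (h y)"
    using lmod_hom_free_matrix[OF A lmod_hom_compose[OF h f']] by auto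
  have gM: "g x \<in> carrier M" if "x \<in> carrier_vec ?n" for x using g that by (auto simp: lmod_hom_def)
  have hN: "h y \<in> carrier N" if "y \<in> carrier_vec ?l" for y using h that by (auto simp: lmod_hom_def)
  have g0: "g (row_mult_mat x A) = \<zero>\<^bsub>M\<^esub>" if "x \<in> carrier_vec ?m" for x
    using A that by (auto simp: presents_def)
  have h0: "h (row_mult_mat x B) = \<zero>\<^bsub>N\<^esub>" if "x \<in> carrier_vec ?k" for x
    using B that by (auto simp: presents_def)
  have f0: "f \<zero>\<^bsub>M\<^esub> = \<zero>\<^bsub>N\<^esub>"
    using lmod_hom_free_zero[OF lmod_hom_compose[OF g f(1)] mods(2)] lmod_hom_free_zero[OF g mods(1)] by simp
  have f'0: "f' \<zero>\<^bsub>N\<^esub> = \<zero>\<^bsub>M\<^esub>" using f'f[of "\<zero>\<^bsub>M\<^esub>"] f0 by simp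
  have "\<exists>S\<in>carrier_mat ?m ?k. A * P = 0\<^sub>m ?m ?l + S * B"
  proof (rule matrix_eq_add_mult)
    fix x :: "'a vec" assume x: "x \<in> carrier_vec ?m"
    then have "h (row_mult_mat x (A * P)) = f (g (row_mult_mat x A))"
      using P by (simp flip: row_mult_mat_assoc)
    then have "h (row_mult_mat x (A * P)) = \<zero>\<^bsub>N\<^esub>" using g0[OF x] f0 by simp
    then obtain u where "u \<in> carrier_vec ?k" "row_mult_mat x (A * P) = row_mult_mat u B"
      using B P(1) by (auto simp: presents_def)
    then show "\<exists>u\<in>carrier_vec ?k. row_mult_mat x (A * P) = row_mult_mat x (0\<^sub>m ?m ?l) + row_mult_mat u B"
      by (intro bexI[of _ u]) auto
  qed (use P in auto)
  then obtain S where S: "S \<in> carrier_mat ?m ?k" "A * P = S * B" by auto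
  have "\<exists>T\<in>carrier_mat ?k ?m. B * Q = 0\<^sub>m ?k ?n + T * A"
  proof (rule matrix_eq_add_mult)
    fix x :: "'a vec" assume x: "x \<in> carrier_vec ?k"
    then have "g (row_mult_mat x (B * Q)) = f' (h (row_mult_mat x B))"
      using Q by (simp flip: row_mult_mat_assoc)
    then have "g (row_mult_mat x (B * Q)) = \<zero>\<^bsub>M\<^esub>" using h0[OF x] f'0 by simp
    then obtain u where "u \<in> carrier_vec ?m" "row_mult_mat x (B * Q) = row_mult_mat u A"
      using A Q(1) by (auto simp: presents_def)
    then show "\<exists>u\<in>carrier_vec ?m. row_mult_mat x (B * Q) = row_mult_mat x (0\<^sub>m ?k ?n) + row_mult_mat u A"
      by (intro bexI[of _ u]) auto
  qed (use Q in auto)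
  then obtain T where T: "T \<in> carrier_mat ?k ?m" "B * Q = T * A" by auto
  have "\<exists>W\<in>carrier_mat ?n ?m. P * Q = 1\<^sub>m ?n + W * A"
  proof (rule matrix_eq_add_mult)
    fix x :: "'a vec" assume x: "x \<in> carrier_vec ?n"
    then have "g (row_mult_mat x (P * Q)) = g x"
      using P Q gM f'f by (simp flip: row_mult_mat_assoc)
    then show "\<exists>u\<in>carrier_vec ?m. row_mult_mat x (P * Q) = row_mult_mat x (1\<^sub>m ?n) + row_mult_mat u A"
      using presents_eq_iff[OF A, of "row_mult_mat x (P * Q)" x] P Q x by simp
  qed (use P Q in auto)
  then obtain W where W: "W \<in> carrier_mat ?n ?m" "P * Q = 1\<^sub>m ?n + W * A" by auto
  have "\<exists>Z\<in>carrier_mat ?l ?k. Q * P = 1\<^sub>m ?l + Z * B"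
  proof (rule matrix_eq_add_mult)
    fix x :: "'a vec" assume x: "x \<in> carrier_vec ?l"
    then have "h (row_mult_mat x (Q * P)) = h x"
      using P Q hN f'c by (simp flip: row_mult_mat_assoc)
    then show "\<exists>u\<in>carrier_vec ?k. row_mult_mat x (Q * P) = row_mult_mat x (1\<^sub>m ?l) + row_mult_mat u B"
      using presents_eq_iff[OF B, of "row_mult_mat x (Q * P)" x] P Q x by simp
  qed (use P Q in auto)
  then obtain Z where Z: "Z \<in> carrier_mat ?l ?k" "Q * P = 1\<^sub>m ?l + Z * B" by auto
  show ?thesis unfolding coker_equiv_def using P(1) Q(1) S T W Z by blast
qed

lemma coker_equiv_refl: "coker_equiv A A" for A :: "'a::{ring,monoid_mult} mat"
proof -
  obtain g where "presents A g (coker_mod A)" using presents_coker_mod by blast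
  then show ?thesis using isomorphic_imp_coker_equiv lmod_isomorphic_refl by blast
qed

lemma coker_equiv_sym: "coker_equiv A B \<Longrightarrow> coker_equiv B A"
  unfolding coker_equiv_def by metis

lemma vec_first_append: "x \<in> carrier_vec n \<Longrightarrow> vec_first (x @\<^sub>v y) n = x"
  by (rule eq_vecI) (auto simp: vec_first_def)

lemma vec_last_append: "y \<in> carrier_vec n \<Longrightarrow> vec_last (x @\<^sub>v y) n = y"
  by (rule eq_vecI) (auto simp: vec_last_def)

lemma presents_lmod_sum:
  assumes A: "presents A g M" and B: "presents B h N"
  shows "presents (block_diag A B) (\<lambda>x. (g (vec_first x (dim_col A)), h (vec_last x (dim_col B)))) (lmod_sum M N)"
proof -
  let ?n = "dim_col A" and ?l = "dim_col B"
  interpret M: left_module M using A by (simp add: presents_def)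
  interpret N: left_module N using B by (simp add: presents_def)
  have g: "g \<in> lmod_hom (free_lmod ?n) M" "g ` carrier_vec ?n = carrier M"
    and h: "h \<in> lmod_hom (free_lmod ?l) N" "h ` carrier_vec ?l = carrier N"
    using A B by (auto simp: presents_def)
  have simps: "carrier (lmod_sum M N) = carrier M \<times> carrier N" "\<zero>\<^bsub>lmod_sum M N\<^esub> = (\<zero>\<^bsub>M\<^esub>, \<zero>\<^bsub>N\<^esub>)"
    "\<And>x y x' y'. (x, y) \<oplus>\<^bsub>lmod_sum M N\<^esub> (x', y') = (x \<oplus>\<^bsub>M\<^esub> x', y \<oplus>\<^bsub>N\<^esub> y')"
    "\<And>r x y. r \<odot>\<^bsub>lmod_sum M N\<^esub> (x, y) = (r \<odot>\<^bsub>M\<^esub> x, r \<odot>\<^bsub>N\<^esub> y)"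
    by (simp_all add: lmod_sum_def)
  have "abelian_group (lmod_sum M N)"
  proof (rule abelian_groupI)
    fix x assume "x \<in> carrier (lmod_sum M N)"
    then obtain a b where x: "x = (a, b)" "a \<in> carrier M" "b \<in> carrier N" by (auto simp: simps)
    then show "\<exists>y\<in>carrier (lmod_sum M N). y \<oplus>\<^bsub>lmod_sum M N\<^esub> x = \<zero>\<^bsub>lmod_sum M N\<^esub>"
      by (intro bexI[of _ "(\<ominus>\<^bsub>M\<^esub> a, \<ominus>\<^bsub>N\<^esub> b)"]) (auto simp: simps M.l_neg N.l_neg)
  qed (auto simp: simps M.a_ac N.a_ac)
  moreover have "left_module_axioms (lmod_sum M N)"
    by unfold_locales
      (auto simp: simps M.smult_closed M.smult_l_distr M.smult_r_distr M.smult_assoc M.smult_one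
        N.smult_closed N.smult_l_distr N.smult_r_distr N.smult_assoc N.smult_one)
  ultimately have mod: "left_module (lmod_sum M N)" by (rule left_module.intro)
  let ?k = "\<lambda>x. (g (vec_first x ?n), h (vec_last x ?l))"
  have first: "vec_first (x + y) ?n = vec_first x ?n + vec_first y ?n"
    "vec_last (x + y) ?l = vec_last x ?l + vec_last y ?l"
    "vec_first (r \<cdot>\<^sub>v x) ?n = r \<cdot>\<^sub>v vec_first x ?n" "vec_last (r \<cdot>\<^sub>v x) ?l = r \<cdot>\<^sub>v vec_last x ?l"
    if "x \<in> carrier_vec (?n + ?l)" "y \<in> carrier_vec (?n + ?l)" for r and x y :: "'a vec"
    using that by (auto simp: vec_first_def vec_last_def intro!: eq_vecI)
  have hom: "?k \<in> lmod_hom (free_lmod (?n + ?l)) (lmod_sum M N)"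
    using g(1) h(1) by (auto simp: lmod_hom_def simps first)
  have "?k ` carrier_vec (?n + ?l) = carrier M \<times> carrier N"
  proof
    show "?k ` carrier_vec (?n + ?l) \<subseteq> carrier M \<times> carrier N" using g h by auto
    show "carrier M \<times> carrier N \<subseteq> ?k ` carrier_vec (?n + ?l)"
    proof
      fix z assume "z \<in> carrier M \<times> carrier N"
      then obtain x y where "x \<in> carrier_vec ?n" "y \<in> carrier_vec ?l" "z = (g x, h y)"
        using g(2) h(2) by blast
      then have "z = ?k (x @\<^sub>v y)" "x @\<^sub>v y \<in> carrier_vec (?n + ?l)"
        by (auto simp: vec_first_append vec_last_append)
      then show "z \<in> ?k ` carrier_vec (?n + ?l)" by blast
    qed
  qed
  moreover have "?k x = (\<zero>\<^bsub>M\<^esub>, \<zero>\<^bsub>N\<^esub>) \<longleftrightarrow>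
      (\<exists>u\<in>carrier_vec (dim_row A + dim_row B). x = row_mult_mat u (block_diag A B))"
    if x: "x \<in> carrier_vec (?n + ?l)" for x
  proof -
    have mult: "row_mult_mat (u @\<^sub>v v) (block_diag A B) = row_mult_mat u A @\<^sub>v row_mult_mat v B"
      if "u \<in> carrier_vec (dim_row A)" "v \<in> carrier_vec (dim_row B)" for u v
    proof (rule eq_vecI)
      fix j assume "j < dim_vec (row_mult_mat u A @\<^sub>v row_mult_mat v B)"
      then have j: "j < ?n + ?l" by simp
      have "col (block_diag A B) j = (if j < ?n then col A j @\<^sub>v 0\<^sub>v (dim_row B)
        else 0\<^sub>v (dim_row A) @\<^sub>v col B (j - ?n))"
        using j by (intro eq_vecI) (auto simp: block_diag_def)
      then show "row_mult_mat (u @\<^sub>v v) (block_diag A B) $ j = (row_mult_mat u A @\<^sub>v row_mult_mat v B) $ j"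
        using j that by (auto simp: row_mult_mat_def scalar_prod_append)
    qed simp
    have "?k x = (\<zero>\<^bsub>M\<^esub>, \<zero>\<^bsub>N\<^esub>) \<longleftrightarrow> (\<exists>u\<in>carrier_vec (dim_row A). vec_first x ?n = row_mult_mat u A) \<and>
       (\<exists>v\<in>carrier_vec (dim_row B). vec_last x ?l = row_mult_mat v B)"
      using A B by (simp add: presents_def)
    also have "\<dots> \<longleftrightarrow> (\<exists>u\<in>carrier_vec (dim_row A). \<exists>v\<in>carrier_vec (dim_row B).
        x = row_mult_mat (u @\<^sub>v v) (block_diag A B))"
    proof -
      have "vec_first x ?n = a \<and> vec_last x ?l = b \<longleftrightarrow> x = a @\<^sub>v b"
        if "a \<in> carrier_vec ?n" "b \<in> carrier_vec ?l" for a b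
        using that vec_first_last_append[OF x] by (auto simp: vec_first_append vec_last_append)
      then show ?thesis by (simp add: mult bex_simps flip: bex_simps) blast
    qed
    also have "\<dots> \<longleftrightarrow> (\<exists>u\<in>carrier_vec (dim_row A + dim_row B). x = row_mult_mat u (block_diag A B))"
      by (metis append_carrier_vec vec_first_last_append vec_first_carrier vec_last_carrier)
    finally show ?thesis .
  qed
  ultimately show ?thesis
    unfolding presents_def using mod hom by (simp add: simps)
qed

section \<open>Moves between presentations\<close>

lemma coker_equiv_trans:
  fixes A B C :: "'a::{ring,monoid_mult} mat"
  assumes "coker_equiv A B" "coker_equiv B C"
  shows "coker_equiv A C"
proof -
  obtain f g h where f: "presents A f (coker_mod A)" and g: "presents B g (coker_mod B)"
    and h: "presents C h (coker_mod C)"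
    using presents_coker_mod by metis
  show ?thesis
    by (rule isomorphic_imp_coker_equiv[OF f h])
      (rule lmod_isomorphic_trans[OF coker_equiv_imp_isomorphic[OF f g assms(1)]
        coker_equiv_imp_isomorphic[OF g h assms(2)]])
qed

lemma coker_equiv_invertible:
  fixes A B :: "'a::{ring,monoid_mult} mat"
  assumes "P \<in> carrier_mat (dim_col A) (dim_col B)" "Q \<in> carrier_mat (dim_col B) (dim_col A)"
    "S \<in> carrier_mat (dim_row A) (dim_row B)" "T \<in> carrier_mat (dim_row B) (dim_row A)"
    and "A * P = S * B" "B * Q = T * A" "P * Q = 1\<^sub>m (dim_col A)" "Q * P = 1\<^sub>m (dim_col B)"
  shows "coker_equiv A B"
  unfolding coker_equiv_def
  by (rule exI[of _ P], rule exI[of _ Q], rule exI[of _ S], rule exI[of _ T],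
      rule exI[of _ "0\<^sub>m (dim_col A) (dim_row A)"], rule exI[of _ "0\<^sub>m (dim_col B) (dim_row B)"])
    (simp add: assms)

lemma coker_equiv_row_ops:
  fixes A B :: "'a::{ring,monoid_mult} mat"
  assumes "S \<in> carrier_mat (dim_row A) (dim_row B)" "T \<in> carrier_mat (dim_row B) (dim_row A)"
    and "A = S * B" "B = T * A"
  shows "coker_equiv A B"
proof -
  have col: "dim_col B = dim_col A" using arg_cong[OF assms(3), of dim_col] by simp
  show ?thesis
  proof (rule coker_equiv_invertible[of "1\<^sub>m (dim_col A)" A B "1\<^sub>m (dim_col A)" S T])
    show "A * 1\<^sub>m (dim_col A) = S * B" by (simp add: assms(3)[symmetric])
    show "B * 1\<^sub>m (dim_col A) = T * A" by (simp add: assms(4)[symmetric] col)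
  qed (simp_all add: assms(1,2) col)
qed

text \<open>
  The changes of generators are the permutation matrix of \<open>\<pi>\<close> and its transpose.
\<close>

lemma coker_equiv_permute_columns:
  fixes A B :: "'a::{ring,monoid_mult} mat"
  assumes dims: "dim_row B = dim_row A" "dim_col B = dim_col A"
    and \<pi>: "bij_betw \<pi> {..<dim_col A} {..<dim_col A}"
    and B: "\<And>i j. i < dim_row A \<Longrightarrow> j < dim_col A \<Longrightarrow> B $$ (i, j) = A $$ (i, \<pi> j)"
  shows "coker_equiv A B"
proof -
  let ?m = "dim_row A" and ?n = "dim_col A"
  define P :: "'a mat" where "P = mat ?n ?n (\<lambda>(k, j). if k = \<pi> j then 1 else 0)"
  define Q :: "'a mat" where "Q = mat ?n ?n (\<lambda>(j, k). if k = \<pi> j then 1 else 0)"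
  define \<rho> where "\<rho> = inv_into {..<?n} \<pi>"
  have \<pi>n: "\<pi> j < ?n" if "j < ?n" for j using \<pi> that by (auto simp: bij_betw_def)
  have inj: "\<pi> i = \<pi> j \<longleftrightarrow> i = j" if "i < ?n" "j < ?n" for i j
    using \<pi> that by (auto simp: bij_betw_def inj_on_def)
  have \<rho>: "\<rho> k < ?n" "\<pi> (\<rho> k) = k" if "k < ?n" for k
  proof -
    have "k \<in> \<pi> ` {..<?n}" using \<pi> that by (simp add: bij_betw_def)
    then show "\<rho> k < ?n" "\<pi> (\<rho> k) = k"
      unfolding \<rho>_def using inv_into_into[of k \<pi> "{..<?n}"] f_inv_into_f[of k \<pi> "{..<?n}"] by auto
  qed
  have \<rho>_iff: "k = \<pi> j \<longleftrightarrow> j = \<rho> k" if "j < ?n" "k < ?n" for j k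
    using inj[OF that(1) \<rho>(1)[OF that(2)]] \<rho>(2)[OF that(2)] by auto
  have \<rho>_inj: "\<rho> k = \<rho> l \<longleftrightarrow> k = l" if "k < ?n" "l < ?n" for k l
    using \<rho>(2)[OF that(1)] \<rho>(2)[OF that(2)] by metis
  have AP: "A * P = 1\<^sub>m ?m * B"
  proof (rule eq_matI)
    fix i j assume "i < dim_row (1\<^sub>m ?m * B)" "j < dim_col (1\<^sub>m ?m * B)"
    then have ij: "i < ?m" "j < ?n" using dims by auto
    have "(A * P) $$ (i, j) = (\<Sum>k = 0..<?n. A $$ (i, k) * (if k = \<pi> j then 1 else 0))"
      using ij by (simp add: P_def scalar_prod_def)
    also have "\<dots> = (\<Sum>k = 0..<?n. if k = \<pi> j then A $$ (i, k) else 0)" by (rule sum.cong) auto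
    also have "\<dots> = A $$ (i, \<pi> j)" using \<pi>n[OF ij(2)] by simp
    finally show "(A * P) $$ (i, j) = (1\<^sub>m ?m * B) $$ (i, j)" using ij B dims by simp
  qed (use dims in \<open>auto simp: P_def\<close>)
  have BQ: "B * Q = 1\<^sub>m ?m * A"
  proof (rule eq_matI)
    fix i k assume "i < dim_row (1\<^sub>m ?m * A)" "k < dim_col (1\<^sub>m ?m * A)"
    then have ik: "i < ?m" "k < ?n" by auto
    have "(B * Q) $$ (i, k) = (\<Sum>j = 0..<?n. B $$ (i, j) * (if k = \<pi> j then 1 else 0))"
      using ik dims by (simp add: Q_def scalar_prod_def)
    also have "\<dots> = (\<Sum>j = 0..<?n. if j = \<rho> k then A $$ (i, k) else 0)"
      using ik \<rho>_iff \<rho>(2) by (intro sum.cong) (auto simp: B)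
    also have "\<dots> = A $$ (i, k)" using \<rho>(1)[OF ik(2)] by simp
    finally show "(B * Q) $$ (i, k) = (1\<^sub>m ?m * A) $$ (i, k)" using ik by simp
  qed (use dims in \<open>auto simp: Q_def\<close>)
  have PQ: "P * Q = 1\<^sub>m ?n"
  proof (rule eq_matI)
    fix k l assume "k < dim_row (1\<^sub>m ?n :: 'a mat)" "l < dim_col (1\<^sub>m ?n :: 'a mat)"
    then have kl: "k < ?n" "l < ?n" by auto
    have "(P * Q) $$ (k, l) = (\<Sum>j = 0..<?n. (if k = \<pi> j then 1 else 0) * (if l = \<pi> j then 1 else 0))"
      using kl by (simp add: P_def Q_def scalar_prod_def)
    also have "\<dots> = (\<Sum>j = 0..<?n. if j = \<rho> k then (if k = l then 1 else 0) else 0)"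
      using kl by (intro sum.cong) (auto simp: \<rho>_iff \<rho>_inj)
    also have "\<dots> = (if k = l then 1 else 0)" using \<rho>(1)[OF kl(1)] by simp
    finally show "(P * Q) $$ (k, l) = 1\<^sub>m ?n $$ (k, l)" using kl by simp
  qed (auto simp: P_def Q_def)
  have QP: "Q * P = 1\<^sub>m ?n"
  proof (rule eq_matI)
    fix i j assume "i < dim_row (1\<^sub>m ?n :: 'a mat)" "j < dim_col (1\<^sub>m ?n :: 'a mat)"
    then have ij: "i < ?n" "j < ?n" by auto
    have "(Q * P) $$ (i, j) = (\<Sum>k = 0..<?n. (if k = \<pi> i then 1 else 0) * (if k = \<pi> j then 1 else 0))"
      using ij by (simp add: P_def Q_def scalar_prod_def)
    also have "\<dots> = (\<Sum>k = 0..<?n. if k = \<pi> i then (if i = j then 1 else 0) else 0)"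
      using ij inj by (intro sum.cong) auto
    also have "\<dots> = (if i = j then 1 else 0)" using \<pi>n[OF ij(1)] by simp
    finally show "(Q * P) $$ (i, j) = 1\<^sub>m ?n $$ (i, j)" using ij by simp
  qed (auto simp: P_def Q_def)
  show ?thesis
    by (rule coker_equiv_invertible[of P _ _ Q "1\<^sub>m ?m" "1\<^sub>m ?m"])
      (use dims AP BQ PQ QP in \<open>auto simp: P_def Q_def\<close>)
qed

lemma coker_equiv_swap_blocks:
  fixes B X Y Z :: "'a::{ring,monoid_mult} mat"
  assumes "dim_row X = dim_row B" "dim_row Y = dim_row B" "dim_row Z = dim_row B"
  shows "coker_equiv (hcat (hcat (hcat B X) Y) Z) (hcat (hcat (hcat B Y) X) Z)"
proof (rule coker_equiv_permute_columns)
  let ?b = "dim_col B" and ?x = "dim_col X" and ?y = "dim_col Y" and ?z = "dim_col Z"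
  let ?\<pi> = "\<lambda>j. if j < ?b then j else if j < ?b + ?y then j + ?x else if j < ?b + ?y + ?x then j - ?y else j"
  \<comment> \<open>\<open>\<pi>\<close> exchanges the column intervals of \<open>X\<close> and \<open>Y\<close>; \<open>\<rho>\<close> is its inverse.\<close>
  let ?\<rho> = "\<lambda>j. if j < ?b then j else if j < ?b + ?x then j + ?y else if j < ?b + ?x + ?y then j - ?x else j"
  show "bij_betw ?\<pi> {..<dim_col (hcat (hcat (hcat B X) Y) Z)} {..<dim_col (hcat (hcat (hcat B X) Y) Z)}"
    by (rule bij_betwI[where g = ?\<rho>]) auto
  show "hcat (hcat (hcat B Y) X) Z $$ (i, j) = hcat (hcat (hcat B X) Y) Z $$ (i, ?\<pi> j)"
    if "i < dim_row (hcat (hcat (hcat B X) Y) Z)" "j < dim_col (hcat (hcat (hcat B X) Y) Z)" for i j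
  proof -
    consider "j < ?b" | "?b \<le> j" "j < ?b + ?y" | "?b + ?y \<le> j" "j < ?b + ?y + ?x" | "?b + ?y + ?x \<le> j"
      by linarith
    then show ?thesis
    proof cases
      case 1 then show ?thesis using that(1) by (simp add: index_hcat)
    next
      case 2 then show ?thesis using that(1) assms by (simp add: index_hcat)
    next
      case 3
      then have "\<not> j - ?y < ?b" "j - ?y < ?b + ?x" "j - ?y - ?b = j - (?b + ?y)" by linarith+
      then show ?thesis using 3 that(1) assms by (simp add: index_hcat)
    next
      case 4 then show ?thesis using that assms by (simp add: index_hcat add.commute add.left_commute)
    qed
  qed
qed (use assms in auto)


text \<open>
  The block \<open>X = U M - C H\<close> below \<open>M\<close> is cleared by subtracting \<open>U\<close> times the upper rows and adding
  the right columns times \<open>H\<close>.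
\<close>

lemma coker_equiv_clear_block:
  fixes M X C U H :: "'a::{ring,monoid_mult} mat"
  assumes dims: "dim_col X = dim_col M" "dim_row X = dim_row C" "dim_row U = dim_row C"
    "dim_col U = dim_row M" "dim_row H = dim_col C" "dim_col H = dim_col M"
    and eq: "U * M = X + C * H"
  shows "coker_equiv (block_diag M C) (vcat (hcat M (0\<^sub>m (dim_row M) (dim_col C))) (hcat X C))"
proof -
  let ?P = "\<lambda>H. vcat (hcat (1\<^sub>m (dim_col M)) (0\<^sub>m (dim_col M) (dim_col C))) (hcat H (1\<^sub>m (dim_col C)))"
  let ?S = "\<lambda>U. vcat (hcat (1\<^sub>m (dim_row M)) (0\<^sub>m (dim_row M) (dim_row C))) (hcat U (1\<^sub>m (dim_row C)))"
  have neg: "- (U * M) + X = - (C * H)"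
    unfolding eq using dims by (intro eq_matI) auto
  note [simp] = block_simps block_diag_vcat
  show ?thesis
  proof (rule coker_equiv_invertible[of "?P (- H)" _ _ "?P H" "?S (- U)" "?S U"])
    show "block_diag M C * ?P (- H) = ?S (- U) * vcat (hcat M (0\<^sub>m (dim_row M) (dim_col C))) (hcat X C)"
      using dims neg by simp
    show "vcat (hcat M (0\<^sub>m (dim_row M) (dim_col C))) (hcat X C) * ?P H = ?S U * block_diag M C"
      using dims eq by simp
  qed (use dims in \<open>auto simp: one_mat_blocks\<close>)
qed

lemma coker_equiv_no_cols:
  fixes A B :: "'a::{ring,monoid_mult} mat"
  assumes "dim_col A = 0" "dim_col B = 0"
  shows "coker_equiv A B"
  by (rule coker_equiv_invertible[of "0\<^sub>m 0 0" _ _ "0\<^sub>m 0 0"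
        "0\<^sub>m (dim_row A) (dim_row B)" "0\<^sub>m (dim_row B) (dim_row A)"])
    (use assms in \<open>auto intro!: eq_matI\<close>)

lemma coker_equiv_one_mat: "coker_equiv (1\<^sub>m n) (0\<^sub>m 0 0 :: 'a::{ring,monoid_mult} mat)"
  unfolding coker_equiv_def
  by (rule exI[of _ "0\<^sub>m n 0"], rule exI[of _ "0\<^sub>m 0 n"], rule exI[of _ "0\<^sub>m n 0"], rule exI[of _ "0\<^sub>m 0 n"],
      rule exI[of _ "- 1\<^sub>m n"], rule exI[of _ "0\<^sub>m 0 0"])
    (auto intro!: eq_matI)

section \<open>The Grothendieck group\<close>

lemma lmod_class_coker_mod_in_K0_gens: "lmod_class (coker_mod A) \<in> K0_gens R"
  for A :: "'a::{ring,monoid_mult} mat" and R :: "'a itself"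
  unfolding K0_gens_def using finitely_presented_coker_mod by blast

text \<open>
  In terms of matrices, the generators of \<open>K0\<close> are the matrices up to \<open>coker_equiv\<close>, and its
  relations say that \<open>block_diag\<close> is addition.  The lemmas from here to \<open>K0_rels_cases\<close> carry out
  this translation.
\<close>

lemma K0_gensE:
  fixes R :: "'a::{ring,monoid_mult} itself"
  assumes "c \<in> K0_gens R"
  obtains A :: "'a mat" where "c = lmod_class (coker_mod A)"
proof -
  obtain M :: "('a, 'a vec set) module" where M: "c = lmod_class M" "finitely_presented M"
    using assms by (auto simp: K0_gens_def)
  obtain A g where A: "presents A g M" using finitely_presented_obtains_matrix[OF M(2)] .
  obtain h where h: "presents A h (coker_mod A)" using presents_coker_mod by blast
  have "left_module M" using A by (simp add: presents_def)
  then have "c = lmod_class (coker_mod A)"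
    unfolding M(1) using lmod_class_eqI[OF coker_equiv_imp_isomorphic[OF A h coker_equiv_refl]] by blast
  then show ?thesis ..
qed

lemma lmod_class_coker_mod_eq_iff:
  fixes A B :: "'a::{ring,monoid_mult} mat"
  shows "lmod_class (coker_mod A) = lmod_class (coker_mod B) \<longleftrightarrow> coker_equiv A B"
proof -
  obtain g h where g: "presents A g (coker_mod A)" and h: "presents B h (coker_mod B)"
    using presents_coker_mod by metis
  have m: "left_module (coker_mod A)" using g by (simp add: presents_def)
  show ?thesis
    using lmod_class_eqD[OF _ finitely_presented_coker_mod] isomorphic_imp_coker_equiv[OF g h]
      lmod_class_eqI[OF coker_equiv_imp_isomorphic[OF g h] m] by blast
qed

lemma lmod_class_sum:
  fixes M N :: "('a::{ring,monoid_mult}, 'a vec set) module"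
  assumes M: "finitely_presented M" and A: "lmod_class M = lmod_class (coker_mod A)"
    and N: "finitely_presented N" and B: "lmod_class N = lmod_class (coker_mod B)"
  shows "lmod_class (lmod_sum M N) = lmod_class (coker_mod (block_diag A B))"
proof -
  obtain f where f: "presents (block_diag A B) f (coker_mod (block_diag A B))"
    using presents_coker_mod by blast
  obtain A' g where g: "presents A' g M" using finitely_presented_obtains_matrix[OF M] .
  obtain B' h where h: "presents B' h N" using finitely_presented_obtains_matrix[OF N] .
  obtain a where a: "presents A a (coker_mod A)" using presents_coker_mod by blast
  obtain b where b: "presents B b (coker_mod B)" using presents_coker_mod by blast
  obtain i where i: "i \<in> lmod_hom M (coker_mod A)" "bij_betw i (carrier M) (carrier (coker_mod A))"
    using lmod_class_eqD[OF A M] by (auto simp: lmod_isomorphic_def)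
  obtain j where j: "j \<in> lmod_hom N (coker_mod B)" "bij_betw j (carrier N) (carrier (coker_mod B))"
    using lmod_class_eqD[OF B N] by (auto simp: lmod_isomorphic_def)
  have "lmod_isomorphic (lmod_sum M N) (lmod_sum (coker_mod A) (coker_mod B))"
    unfolding lmod_isomorphic_def
  proof
    show "map_prod i j \<in> lmod_hom (lmod_sum M N) (lmod_sum (coker_mod A) (coker_mod B))"
      using i(1) j(1) by (auto simp: lmod_hom_def lmod_sum_def)
    show "bij_betw (map_prod i j) (carrier (lmod_sum M N)) (carrier (lmod_sum (coker_mod A) (coker_mod B)))"
      using bij_betw_map_prod[OF i(2) j(2)] by (simp add: lmod_sum_def)
  qed
  moreover have "lmod_isomorphic (lmod_sum (coker_mod A) (coker_mod B)) (coker_mod (block_diag A B))"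
    by (rule coker_equiv_imp_isomorphic[OF presents_lmod_sum[OF a b] f coker_equiv_refl])
  ultimately have "lmod_isomorphic (lmod_sum M N) (coker_mod (block_diag A B))"
    by (rule lmod_isomorphic_trans)
  moreover have "left_module (lmod_sum M N)"
    using presents_lmod_sum[OF g h] by (simp add: presents_def)
  ultimately show ?thesis by (rule lmod_class_eqI)
qed

lemma K0_rels_cases:
  fixes R :: "'a::{ring,monoid_mult} itself"
  assumes "r \<in> K0_rels R"
  obtains A B :: "'a mat" where "r = frag_of (lmod_class (coker_mod (block_diag A B))) -
    (frag_of (lmod_class (coker_mod A)) + frag_of (lmod_class (coker_mod B)))"
proof -
  obtain M N :: "('a, 'a vec set) module" where fp: "finitely_presented M" "finitely_presented N"
    and r: "r = frag_of (lmod_class (lmod_sum M N)) - (frag_of (lmod_class M) + frag_of (lmod_class N))"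
    using assms unfolding K0_rels_def by blast
  obtain A where A: "lmod_class M = lmod_class (coker_mod A)"
    using K0_gensE[of "lmod_class M" R] fp(1) unfolding K0_gens_def by blast
  obtain B where B: "lmod_class N = lmod_class (coker_mod B)"
    using K0_gensE[of "lmod_class N" R] fp(2) unfolding K0_gens_def by blast
  show ?thesis
    by (rule that[of A B]) (simp add: r lmod_class_sum[OF fp(1) A fp(2) B] A B)
qed

interpretation K0: presentation "K0_gens R" "K0_rels R" for R :: "'a::{ring,monoid_mult} itself"
proof
  show "K0_rels R \<subseteq> carrier (free_Abelian_group (K0_gens R))"
  proof
    fix r assume "r \<in> K0_rels R"
    then obtain A B :: "'a mat" where "r = frag_of (lmod_class (coker_mod (block_diag A B))) -
        (frag_of (lmod_class (coker_mod A)) + frag_of (lmod_class (coker_mod B)))"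
      by (rule K0_rels_cases)
    then show "r \<in> carrier (free_Abelian_group (K0_gens R))"
      using keys_diff[of "frag_of (lmod_class (coker_mod (block_diag A B)))"
          "frag_of (lmod_class (coker_mod A)) + frag_of (lmod_class (coker_mod B))"]
        keys_add[of "frag_of (lmod_class (coker_mod A))" "frag_of (lmod_class (coker_mod B))"]
        lmod_class_coker_mod_in_K0_gens[where R = R] by (auto dest!: subsetD)
  qed
qed

lemma comm_group_K0: "comm_group (K0 R)"
  unfolding K0_def by (rule K0.comm_group_presented)

lemma K0_mat_closed: "K0_mat R A \<in> carrier (K0 R)"
  unfolding K0_def K0_mat_def by (rule K0.gen_closed[OF lmod_class_coker_mod_in_K0_gens])

lemma K0_mat_cong: "coker_equiv A B \<Longrightarrow> K0_mat R A = K0_mat R B"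
  by (simp add: K0_mat_def flip: lmod_class_coker_mod_eq_iff)

lemma K0_mat_block_diag: "K0_mat R (block_diag A B) = K0_mat R A \<otimes>\<^bsub>K0 R\<^esub> K0_mat R B"
proof -
  have "frag_of (lmod_class (lmod_sum (coker_mod A) (coker_mod B))) -
      (frag_of (lmod_class (coker_mod A)) + frag_of (lmod_class (coker_mod B))) \<in> K0_rels R"
    unfolding K0_rels_def using finitely_presented_coker_mod by blast
  then show ?thesis
    unfolding K0_def K0_mat_def
      lmod_class_sum[OF finitely_presented_coker_mod refl finitely_presented_coker_mod refl]
    by (intro K0.gen_relation(1) lmod_class_coker_mod_in_K0_gens)
qed

text \<open>
  The cokernel is zero, so it is isomorphic to its own double, and its class is idempotent.
\<close>

lemma K0_mat_no_cols:
  fixes A :: "'a::{ring,monoid_mult} mat"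
  assumes "dim_col A = 0"
  shows "K0_mat R A = \<one>\<^bsub>K0 R\<^esub>"
proof -
  interpret comm_group "K0 R" by (rule comm_group_K0)
  have "K0_mat R (block_diag A A) = K0_mat R A"
    using assms by (intro K0_mat_cong coker_equiv_no_cols) auto
  then show ?thesis using K0_mat_closed[of R A] by (simp add: K0_mat_block_diag)
qed

lemma K0_mat_one_mat:
  fixes R :: "'a::{ring,monoid_mult} itself"
  shows "K0_mat R (1\<^sub>m n) = \<one>\<^bsub>K0 R\<^esub>"
  using K0_mat_cong[OF coker_equiv_one_mat[of n], of R] K0_mat_no_cols[of "0\<^sub>m 0 0" R] by simp

section \<open>Equalities between classes of pairs\<close>

lemma L_leI:
  assumes "dim_row U = dim_row A'" "dim_col U = dim_row A" "dim_row V = dim_col B'" "dim_col V = dim_col B"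
    "dim_row G = dim_col B'" "dim_col G = n" "U * B = B' * V" "U * A = A' + B' * G"
  shows "L_le n (B, A) (B', A')"
  using assms unfolding L_le_def by (auto intro: carrier_matI)

lemma L_class_eqI:
  fixes B A B' A' :: "'a::{ring,monoid_mult} mat"
  assumes "dim_row B = dim_row A" "dim_row B' = dim_row A'" "dim_col A = n" "dim_col A' = n"
    and "L_le n (B, A) (B', A')" "L_le n (B', A') (B, A)"
  shows "L_class B A = L_class B' A'"
proof -
  have "((B, A), (B', A')) \<in> L_rel n" using assms by (simp add: L_rel_def L_pairs_def)
  then show ?thesis
    unfolding L_class_def using assms(3,4) equiv_class_eq[OF equiv_L_rel] by simp
qed


text \<open>
  Row operations that can be undone do not change the class.  \<open>T\<close> has to undo \<open>U\<close> on the
  columns of \<open>B\<close> and \<open>A\<close> only, so that rows depending on the other ones can be added.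
\<close>

lemma L_class_row_equiv:
  fixes B A U T :: "'a::{ring,monoid_mult} mat"
  assumes dims: "dim_row B = dim_row A" "dim_col U = dim_row A" "dim_row T = dim_row A" "dim_col T = dim_row U"
    and "T * (U * B) = B" "T * (U * A) = A"
  shows "L_class (U * B) (U * A) = L_class B A"
proof (rule L_class_eqI)
  show "L_le (dim_col A) (U * B, U * A) (B, A)"
    by (rule L_leI[of T _ _ "1\<^sub>m (dim_col B)" _ _ "0\<^sub>m (dim_col B) (dim_col A)"])
      (use dims in \<open>simp_all add: assms(5,6)\<close>)
  show "L_le (dim_col A) (B, A) (U * B, U * A)"
    by (rule L_leI[of U _ _ "1\<^sub>m (dim_col B)" _ _ "0\<^sub>m (dim_col B) (dim_col A)"])
      (use dims in simp_all)
qed (use dims in simp_all)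

text \<open>
  Always \<open>(0 | I) \<le> (B | A)\<close>, with \<open>U = A\<close>; the hypotheses on \<open>U\<close> are the converse inequality.
\<close>

lemma L_class_eq_L_zeroI:
  fixes B A U :: "'a::{ring,monoid_mult} mat"
  assumes dims: "dim_row B = dim_row A" "dim_col U = dim_row A"
    and "U * B = 0\<^sub>m (dim_col A) (dim_col B)" "U * A = 1\<^sub>m (dim_col A)"
  shows "L_class B A = L_zero (dim_col A)"
proof -
  let ?n = "dim_col A" and ?k = "dim_col B"
  have U: "dim_row U = ?n" using arg_cong[OF assms(4), of dim_row] by simp
  show ?thesis
    unfolding L_zero_def
  proof (rule L_class_eqI)
    show "L_le ?n (B, A) (0\<^sub>m ?n 0, 1\<^sub>m ?n)"
      by (rule L_leI[of U _ _ "0\<^sub>m 0 ?k" _ _ "0\<^sub>m 0 ?n"]) (use dims U assms(3,4) in simp_all)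
    show "L_le ?n (0\<^sub>m ?n 0, 1\<^sub>m ?n) (B, A)"
      by (rule L_leI[of A _ _ "0\<^sub>m ?k 0" _ _ "0\<^sub>m ?k ?n"]) (use dims in simp_all)
  qed (use dims in simp_all)
qed


text \<open>
  The matrix \<open>V\<close> of the preorder selects, for every column of \<open>B\<close>, an equal column of \<open>B'\<close>.
\<close>

lemma L_le_permute_left:
  fixes B B' A :: "'a::{ring,monoid_mult} mat"
  assumes dims: "dim_row B = dim_row A" "dim_row B' = dim_row A"
    and cols: "\<And>j. j < dim_col B \<Longrightarrow> \<exists>k<dim_col B'. col B j = col B' k"
  shows "L_le (dim_col A) (B, A) (B', A)"
proof -
  obtain k where k: "\<And>j. j < dim_col B \<Longrightarrow> k j < dim_col B' \<and> col B j = col B' (k j)"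
    using cols by metis
  define V :: "'a mat" where "V = mat (dim_col B') (dim_col B) (\<lambda>(l, j). if l = k j then 1 else 0)"
  have "B' * V = B"
  proof (rule eq_matI)
    fix i j assume ij: "i < dim_row B" "j < dim_col B"
    have "(B' * V) $$ (i, j) = (\<Sum>l = 0..<dim_col B'. B' $$ (i, l) * (if l = k j then 1 else 0))"
      using ij dims by (simp add: V_def scalar_prod_def)
    also have "\<dots> = (\<Sum>l = 0..<dim_col B'. if l = k j then B' $$ (i, l) else 0)"
      by (rule sum.cong) auto
    also have "\<dots> = col B' (k j) $ i" using k[OF ij(2)] ij dims by simp
    also have "\<dots> = B $$ (i, j)" using k[OF ij(2)] ij by (metis index_col)
    finally show "(B' * V) $$ (i, j) = B $$ (i, j)" .
  qed (use dims in \<open>simp_all add: V_def\<close>)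
  then show ?thesis
    by (intro L_leI[of "1\<^sub>m (dim_row A)" _ _ V _ _ "0\<^sub>m (dim_col B') (dim_col A)"])
      (use dims in \<open>simp_all add: V_def\<close>)
qed

lemma L_class_permute_left:
  fixes B B' A :: "'a::{ring,monoid_mult} mat"
  assumes "dim_row B = dim_row A" "dim_row B' = dim_row A" and "set (cols B) = set (cols B')"
  shows "L_class B A = L_class B' A"
proof -
  have "\<exists>k<dim_col D'. col D j = col D' k" if "set (cols D) = set (cols D')" "j < dim_col D" for D D' :: "'a mat" and j
    using that unfolding cols_def by force
  then have "L_le (dim_col A) (B, A) (B', A)" "L_le (dim_col A) (B', A) (B, A)"
    using assms by (intro L_le_permute_left; simp)+
  then show ?thesis using assms by (intro L_class_eqI[where n = "dim_col A"]) simp_all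
qed

lemma L_class_pad_rows:
  fixes B A :: "'a::{ring,monoid_mult} mat"
  assumes "dim_row B = dim_row A"
  shows "L_class (vcat B (0\<^sub>m k (dim_col B))) (vcat A (0\<^sub>m k (dim_col A))) = L_class B A"
proof -
  let ?m = "dim_row A"
  let ?U = "vcat (1\<^sub>m ?m) (0\<^sub>m k ?m)" and ?T = "hcat (1\<^sub>m ?m) (0\<^sub>m ?m k)"
  have U: "?U * X = vcat X (0\<^sub>m k (dim_col X))" if "dim_row X = ?m" for X :: "'a mat"
    using that by (simp add: block_simps)
  have T: "?T * (?U * X) = X" if "dim_row X = ?m" for X :: "'a mat"
    using that by (simp add: block_simps)
  have "L_class (?U * B) (?U * A) = L_class B A"
    by (rule L_class_row_equiv[where T = ?T]) (use assms T in simp_all)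
  then show ?thesis using assms by (simp add: U)
qed


text \<open>
  The columns of \<open>C\<close> live in rows in which \<open>B\<close> and \<open>A\<close> vanish, so that both these rows and these
  columns can be dropped.
\<close>

lemma L_class_summand:
  fixes B A C :: "'a::{ring,monoid_mult} mat"
  assumes "dim_row B = dim_row A"
  shows "L_class (hcat (vcat C (0\<^sub>m (dim_row A) (dim_col C))) (vcat (0\<^sub>m (dim_row C) (dim_col B)) B))
      (vcat (0\<^sub>m (dim_row C) (dim_col A)) A) = L_class B A"
    (is "L_class ?D ?E = _")
proof (rule L_class_eqI)
  let ?m = "dim_row A" and ?n = "dim_col A" and ?k = "dim_col B" and ?r = "dim_row C" and ?c = "dim_col C"
  note [simp] = block_simps
  show "L_le ?n (?D, ?E) (B, A)"
    by (rule L_leI[of "hcat (0\<^sub>m ?m ?r) (1\<^sub>m ?m)" _ _ "hcat (0\<^sub>m ?k ?c) (1\<^sub>m ?k)" _ _ "0\<^sub>m ?k ?n"])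
      (use assms in \<open>simp_all del: hcat_vcat\<close>)
  show "L_le ?n (B, A) (?D, ?E)"
    by (rule L_leI[of "vcat (0\<^sub>m ?r ?m) (1\<^sub>m ?m)" _ _ "vcat (0\<^sub>m ?c ?k) (1\<^sub>m ?k)" _ _ "0\<^sub>m (?c + ?k) ?n"])
      (use assms in \<open>simp_all del: hcat_vcat\<close>)
qed (use assms in simp_all)


text \<open>
  The last rows express additional unknowns through the other ones, by \<open>Q\<close> and \<open>q\<close>; such unknowns
  and rows can be eliminated.  This is the step in the invariance of \<open>kappa_value\<close> in which
  redundant generators are added to a presentation.
\<close>

lemma L_class_eliminate:
  fixes B A Q q :: "'a::{ring,monoid_mult} mat"
  assumes "dim_row B = dim_row A" "dim_col Q = dim_col B" "dim_col q = dim_col A" "dim_row q = dim_row Q"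
  shows "L_class (hcat (vcat (0\<^sub>m (dim_row A) (dim_row Q)) (1\<^sub>m (dim_row Q))) (vcat B (- Q))) (vcat A (- q)) =
      L_class B A" (is "L_class ?D ?E = _")
proof (rule L_class_eqI)
  let ?m = "dim_row A" and ?n = "dim_col A" and ?k = "dim_col B" and ?r = "dim_row Q"
  note [simp] = block_simps
  show "L_le ?n (?D, ?E) (B, A)"
    by (rule L_leI[of "hcat (1\<^sub>m ?m) (0\<^sub>m ?m ?r)" _ _ "hcat (0\<^sub>m ?k ?r) (1\<^sub>m ?k)" _ _ "0\<^sub>m ?k ?n"])
      (use assms in \<open>simp_all del: hcat_vcat\<close>)
  show "L_le ?n (B, A) (?D, ?E)"
    by (rule L_leI[of "vcat (1\<^sub>m ?m) (0\<^sub>m ?r ?m)" _ _ "vcat Q (1\<^sub>m ?k)" _ _ "vcat q (0\<^sub>m ?k ?n)"])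
      (use assms in \<open>simp_all del: hcat_vcat\<close>)
qed (use assms in simp_all)

section \<open>The Goursat groups\<close>

lemma L_class_in_L_set:
  fixes B A :: "'a::{ring,monoid_mult} mat"
  shows "dim_row B = dim_row A \<Longrightarrow> dim_col A = n \<Longrightarrow> L_class B A \<in> L_set n"
  by (auto simp: L_class_def L_set_def L_pairs_def intro: quotientI)

lemma L_zero_in_L_set: "L_zero n \<in> L_set n"
  unfolding L_zero_def by (rule L_class_in_L_set) simp_all

lemma L_setE:
  fixes c :: "('a::{ring,monoid_mult} mat \<times> 'a mat) set"
  assumes "c \<in> L_set n"
  obtains B A where "dim_row B = dim_row A" "dim_col A = n" "c = L_class B A"
proof -
  obtain p where p: "p \<in> L_pairs n" "c = L_rel n `` {p}"
    using assms unfolding L_set_def by (rule quotientE)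
  obtain B A where "p = (B, A)" by (cases p)
  then show ?thesis using p that[of B A] by (auto simp: L_pairs_def L_class_def)
qed

lemma L_class_in_G_gens:
  fixes B A :: "'a::{ring,monoid_mult} mat"
  shows "dim_row B = dim_row A \<Longrightarrow> 1 \<le> dim_col A \<Longrightarrow> L_class B A \<in> G_gens R"
  unfolding G_gens_def using L_class_in_L_set[OF _ refl] by blast

lemma L_zero_in_G_gens: "1 \<le> n \<Longrightarrow> L_zero n \<in> G_gens R"
  unfolding G_gens_def using L_zero_in_L_set by auto

lemma relation_in_free_Abelian_group:
  assumes "a \<in> S" "b \<in> S" "c \<in> S"
  shows "frag_of a - (frag_of b + frag_of c) \<in> carrier (free_Abelian_group S)"
    and "d \<in> S \<Longrightarrow> (frag_of a - frag_of b) - (frag_of c - frag_of d) \<in> carrier (free_Abelian_group S)"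
proof -
  have "Poly_Mapping.keys (frag_of a - (frag_of b + frag_of c)) \<subseteq> {a} \<union> ({b} \<union> {c})"
    using keys_diff[of "frag_of a" "frag_of b + frag_of c"] keys_add[of "frag_of b" "frag_of c"] by auto
  then show "frag_of a - (frag_of b + frag_of c) \<in> carrier (free_Abelian_group S)" using assms by auto
next
  assume "d \<in> S"
  moreover have "Poly_Mapping.keys ((frag_of a - frag_of b) - (frag_of c - frag_of d)) \<subseteq> ({a} \<union> {b}) \<union> ({c} \<union> {d})"
    using keys_diff[of "frag_of a - frag_of b" "frag_of c - frag_of d"] keys_diff[of "frag_of a" "frag_of b"]
      keys_diff[of "frag_of c" "frag_of d"] by auto
  ultimately show "(frag_of a - frag_of b) - (frag_of c - frag_of d) \<in> carrier (free_Abelian_group S)"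
    using assms by auto
qed

lemma G_rels_cases [consumes 1, case_names exchange sum zero]:
  fixes R :: "'a::{ring,monoid_mult} itself"
  assumes "r \<in> G_rels R"
  obtains (exchange) B A A' :: "'a mat" where
      "r = (frag_of (L_class (hcat B A) A') - frag_of (L_class B A')) -
        (frag_of (L_class (hcat B A') A) - frag_of (L_class B A))"
      "dim_row A = dim_row B" "dim_row A' = dim_row B" "dim_col A \<ge> 1" "dim_col A' \<ge> 1"
    | (sum) B A B' A' :: "'a mat" where
      "r = frag_of (L_class (block_diag B B') (block_diag A A')) -
        (frag_of (L_class B A) + frag_of (L_class B' A'))"
      "dim_row B = dim_row A" "dim_row B' = dim_row A'" "dim_col A \<ge> 1" "dim_col A' \<ge> 1"
    | (zero) n where "r = frag_of (L_zero n)" "n \<ge> 1"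
  using assms unfolding G_rels_def L_pairs_def by blast

lemma G0_rels_cases [consumes 1, case_names exchange zero]:
  fixes R :: "'a::{ring,monoid_mult} itself"
  assumes "r \<in> G0_rels R"
  obtains (exchange) B A A' :: "'a mat" where
      "r = (frag_of (L_class (hcat B A) A') - frag_of (L_class B A')) -
        (frag_of (L_class (hcat B A') A) - frag_of (L_class B A))"
      "dim_row A = dim_row B" "dim_row A' = dim_row B" "dim_col A = 1" "dim_col A' = 1"
    | (zero) "r = frag_of (L_zero 1)"
  using assms unfolding G0_rels_def by blast

interpretation G: presentation "G_gens R" "G_rels R" for R :: "'a::{ring,monoid_mult} itself"
proof
  show "G_rels R \<subseteq> carrier (free_Abelian_group (G_gens R))"
  proof
    fix r assume "r \<in> G_rels R"
    then show "r \<in> carrier (free_Abelian_group (G_gens R))"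
    proof (cases rule: G_rels_cases)
      case (exchange B A A')
      then show ?thesis
        by (simp only: exchange(1)) (intro relation_in_free_Abelian_group L_class_in_G_gens; simp)
    next
      case (sum B A B' A')
      then show ?thesis
        by (simp only: sum(1)) (intro relation_in_free_Abelian_group L_class_in_G_gens; simp)
    next
      case (zero n) then show ?thesis using L_zero_in_G_gens[of n R] by simp
    qed
  qed
qed

interpretation G0: presentation "L_set 1" "G0_rels R" for R :: "'a::{ring,monoid_mult} itself"
proof
  show "G0_rels R \<subseteq> carrier (free_Abelian_group (L_set 1))"
  proof
    fix r assume "r \<in> G0_rels R"
    then show "r \<in> carrier (free_Abelian_group (L_set 1))"
    proof (cases rule: G0_rels_cases)
      case (exchange B A A')
      then show ?thesis
        by (simp only: exchange(1)) (intro relation_in_free_Abelian_group L_class_in_L_set; simp)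
    next
      case zero then show ?thesis using L_zero_in_L_set[of 1] by simp
    qed
  qed
qed

lemma comm_group_goursat_group: "comm_group (goursat_group R)"
  unfolding goursat_group_def by (rule G.comm_group_presented)

lemma comm_group_goursat_group0: "comm_group (goursat_group0 R)"
  unfolding goursat_group0_def by (rule G0.comm_group_presented)

lemma G_gen_closed:
  "dim_row B = dim_row A \<Longrightarrow> 1 \<le> dim_col A \<Longrightarrow> G_gen R B A \<in> carrier (goursat_group R)"
  unfolding G_gen_def goursat_group_def by (intro G.gen_closed L_class_in_G_gens)

lemma G0_gen_closed:
  "dim_row B = dim_row A \<Longrightarrow> dim_col A = 1 \<Longrightarrow> G0_gen R B A \<in> carrier (goursat_group0 R)"
  unfolding G0_gen_def goursat_group0_def by (intro G0.gen_closed L_class_in_L_set)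

lemma G_gen_exchange:
  fixes R :: "'a::{ring,monoid_mult} itself"
  assumes "dim_row A = dim_row B" "dim_row A' = dim_row B" "dim_col A \<ge> 1" "dim_col A' \<ge> 1"
  shows "G_gen R (hcat B A) A' \<otimes>\<^bsub>goursat_group R\<^esub> G_gen R B A =
    G_gen R (hcat B A') A \<otimes>\<^bsub>goursat_group R\<^esub> G_gen R B A'"
  unfolding G_gen_def goursat_group_def
proof (rule G.gen_relation(2))
  show "(frag_of (L_class (hcat B A) A') - frag_of (L_class B A')) -
    (frag_of (L_class (hcat B A') A) - frag_of (L_class B A)) \<in> G_rels R"
    unfolding G_rels_def using assms by blast
qed (use assms in \<open>auto intro!: L_class_in_G_gens\<close>)

lemma G0_gen_exchange:
  fixes R :: "'a::{ring,monoid_mult} itself"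
  assumes "dim_row A = dim_row B" "dim_row A' = dim_row B" "dim_col A = 1" "dim_col A' = 1"
  shows "G0_gen R (hcat B A) A' \<otimes>\<^bsub>goursat_group0 R\<^esub> G0_gen R B A =
    G0_gen R (hcat B A') A \<otimes>\<^bsub>goursat_group0 R\<^esub> G0_gen R B A'"
  unfolding G0_gen_def goursat_group0_def
proof (rule G0.gen_relation(2))
  show "(frag_of (L_class (hcat B A) A') - frag_of (L_class B A')) -
    (frag_of (L_class (hcat B A') A) - frag_of (L_class B A)) \<in> G0_rels R"
    unfolding G0_rels_def using assms by blast
qed (use assms in \<open>auto intro!: L_class_in_L_set\<close>)

lemma G_gen_block_diag:
  fixes R :: "'a::{ring,monoid_mult} itself"
  assumes "dim_row B = dim_row A" "dim_row B' = dim_row A'" "dim_col A \<ge> 1" "dim_col A' \<ge> 1"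
  shows "G_gen R (block_diag B B') (block_diag A A') = G_gen R B A \<otimes>\<^bsub>goursat_group R\<^esub> G_gen R B' A'"
  unfolding G_gen_def goursat_group_def
proof (rule G.gen_relation(1))
  show "frag_of (L_class (block_diag B B') (block_diag A A')) -
      (frag_of (L_class B A) + frag_of (L_class B' A')) \<in> G_rels R"
    unfolding G_rels_def L_pairs_def using assms by blast
qed (use assms in \<open>auto intro!: L_class_in_G_gens\<close>)

lemma G_gen_eq_oneI:
  assumes "L_class B A = L_zero n" "1 \<le> n"
  shows "G_gen R B A = \<one>\<^bsub>goursat_group R\<^esub>"
  unfolding G_gen_def goursat_group_def assms(1)
  by (rule G.gen_relation(3)) (use assms L_zero_in_G_gens in \<open>auto simp: G_rels_def\<close>)

lemma G0_gen_eq_oneI: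
  assumes "L_class B A = L_zero 1"
  shows "G0_gen R B A = \<one>\<^bsub>goursat_group0 R\<^esub>"
  unfolding G0_gen_def goursat_group0_def assms(1)
  by (rule G0.gen_relation(3)) (use L_zero_in_L_set in \<open>auto simp: G0_rels_def\<close>)

section \<open>The sum over the columns of a matrix\<close>

definition kappa_value :: "'a::{ring,monoid_mult} itself \<Rightarrow> 'a mat \<Rightarrow> (('a mat \<times> 'a mat) set \<Rightarrow>\<^sub>0 int) set" where
  "kappa_value R A = finprod (goursat_group0 R) (\<lambda>i. G0_gen R (col_block A 0 i) (col_block A i 1)) {..<dim_col A}"

lemma (in comm_monoid) finprod_lessThan_add:
  fixes m n :: nat
  assumes "\<And>i. i < m + n \<Longrightarrow> f i \<in> carrier G"
  shows "finprod G f {..<m + n} = finprod G f {..<m} \<otimes> finprod G (\<lambda>j. f (m + j)) {..<n}"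
  using assms
proof (induction n)
  case 0
  then have "finprod G f {..<m} \<in> carrier G" by (intro finprod_closed) auto
  then show ?case by simp
next
  case (Suc n)
  have c: "finprod G f {..<m} \<in> carrier G" "finprod G (\<lambda>j. f (m + j)) {..<n} \<in> carrier G"
    using Suc.prems by (auto intro!: finprod_closed)
  have "finprod G f {..<m + Suc n} = f (m + n) \<otimes> finprod G f {..<m + n}"
    using Suc.prems by (simp add: lessThan_Suc finprod_insert Pi_iff)
  also have "\<dots> = finprod G f {..<m} \<otimes> (f (m + n) \<otimes> finprod G (\<lambda>j. f (m + j)) {..<n})"
    using Suc c by (simp add: m_lcomm)
  also have "f (m + n) \<otimes> finprod G (\<lambda>j. f (m + j)) {..<n} = finprod G (\<lambda>j. f (m + j)) {..<Suc n}"
    using Suc.prems by (simp add: lessThan_Suc finprod_insert Pi_iff)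
  finally show ?case .
qed

lemma kappa_value_closed: "kappa_value R A \<in> carrier (goursat_group0 R)"
proof -
  interpret comm_group "goursat_group0 R" by (rule comm_group_goursat_group0)
  show ?thesis unfolding kappa_value_def by (intro finprod_closed) (auto intro: G0_gen_closed)
qed

text \<open>
  The sum over the columns of \<open>X\<close> on the right is a version of \<open>kappa_value\<close> for \<open>X\<close> relative to the
  columns \<open>C\<close>.
\<close>

lemma kappa_value_hcat:
  assumes "dim_row X = dim_row C"
  shows "kappa_value R (hcat C X) = kappa_value R C \<otimes>\<^bsub>goursat_group0 R\<^esub>
    finprod (goursat_group0 R) (\<lambda>j. G0_gen R (hcat C (col_block X 0 j)) (col_block X j 1)) {..<dim_col X}"
proof -
  interpret comm_group "goursat_group0 R" by (rule comm_group_goursat_group0)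
  let ?f = "\<lambda>i. G0_gen R (col_block (hcat C X) 0 i) (col_block (hcat C X) i 1)"
  have f: "?f i \<in> carrier (goursat_group0 R)" for i by (rule G0_gen_closed) simp_all
  have "kappa_value R (hcat C X) = finprod (goursat_group0 R) ?f {..<dim_col C} \<otimes>\<^bsub>goursat_group0 R\<^esub>
      finprod (goursat_group0 R) (\<lambda>j. ?f (dim_col C + j)) {..<dim_col X}"
    unfolding kappa_value_def dim_hcat by (rule finprod_lessThan_add) (rule f)
  also have "finprod (goursat_group0 R) ?f {..<dim_col C} = kappa_value R C"
    unfolding kappa_value_def
    by (rule finprod_cong') (auto simp: col_block_hcat_left intro: G0_gen_closed)
  also have "finprod (goursat_group0 R) (\<lambda>j. ?f (dim_col C + j)) {..<dim_col X} =
      finprod (goursat_group0 R) (\<lambda>j. G0_gen R (hcat C (col_block X 0 j)) (col_block X j 1)) {..<dim_col X}"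
    by (rule finprod_cong')
      (use assms in \<open>auto simp: col_block_hcat_right col_block_hcat_right_single intro: G0_gen_closed\<close>)
  finally show ?thesis .
qed

lemma G0_gen_cong: "L_class B A = L_class B' A' \<Longrightarrow> G0_gen R B A = G0_gen R B' A'"
  by (simp add: G0_gen_def)

lemma kappa_value_row_ops:
  fixes A B :: "'a::{ring,monoid_mult} mat"
  assumes "dim_row S = dim_row A" "dim_col S = dim_row B" "dim_row T = dim_row B" "dim_col T = dim_row A"
    and A: "A = S * B" and B: "B = T * A"
  shows "kappa_value R A = kappa_value R B"
proof -
  interpret comm_group "goursat_group0 R" by (rule comm_group_goursat_group0)
  have col: "dim_col A = dim_col B" using arg_cong[OF A, of dim_col] by simp
  have S: "col_block A i k = S * col_block B i k" if "i + k \<le> dim_col B" for i k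
    unfolding A using assms(2) that by (intro col_block_mult) simp_all
  have T: "col_block B i k = T * col_block A i k" if "i + k \<le> dim_col B" for i k
    using arg_cong[OF B, of "\<lambda>X. col_block X i k"] col_block_mult[of T A i k] assms(4) that col by simp
  have "L_class (col_block A 0 i) (col_block A i 1) = L_class (col_block B 0 i) (col_block B i 1)"
    if "i < dim_col B" for i
  proof -
    have "T * (S * col_block B k l) = col_block B k l" if "k + l \<le> dim_col B" for k l
      unfolding S[OF that, symmetric] T[OF that, symmetric] ..
    then have "T * (S * col_block B 0 i) = col_block B 0 i" "T * (S * col_block B i 1) = col_block B i 1"
      using that by simp_all
    then have "L_class (S * col_block B 0 i) (S * col_block B i 1) = L_class (col_block B 0 i) (col_block B i 1)"
      by (intro L_class_row_equiv[where T = T]) (use assms(1-4) in simp_all)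
    then show ?thesis using S that by simp
  qed
  then show ?thesis
    unfolding kappa_value_def col by (intro finprod_cong' G0_gen_cong) (auto intro: G0_gen_closed)
qed

subsection \<open>Independence of the order of the columns\<close>

text \<open>
  The same sum for lists of columns, relative to a list \<open>C\<close> of columns that come before.  Carrying
  \<open>C\<close> along makes it possible to permute columns by induction on the list.
\<close>

primrec kappa_list :: "'a::{ring,monoid_mult} itself \<Rightarrow> nat \<Rightarrow> 'a vec list \<Rightarrow> 'a vec list \<Rightarrow>
    (('a mat \<times> 'a mat) set \<Rightarrow>\<^sub>0 int) set" where
  "kappa_list R m C [] = \<one>\<^bsub>goursat_group0 R\<^esub>"
| "kappa_list R m C (x # xs) =
    G0_gen R (mat_of_cols m C) (mat_of_cols m [x]) \<otimes>\<^bsub>goursat_group0 R\<^esub> kappa_list R m (C @ [x]) xs"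

lemma kappa_list_closed: "kappa_list R m C xs \<in> carrier (goursat_group0 R)"
proof -
  interpret comm_group "goursat_group0 R" by (rule comm_group_goursat_group0)
  show ?thesis by (induction xs arbitrary: C) (auto intro!: G0_gen_closed)
qed

lemma kappa_list_finprod:
  "kappa_list R m C xs = finprod (goursat_group0 R)
    (\<lambda>i. G0_gen R (mat_of_cols m (C @ take i xs)) (mat_of_cols m [xs ! i])) {..<length xs}"
proof -
  interpret comm_group "goursat_group0 R" by (rule comm_group_goursat_group0)
  have c: "G0_gen R (mat_of_cols m C) (mat_of_cols m [x]) \<in> carrier (goursat_group0 R)" for C x
    by (rule G0_gen_closed) simp_all
  show ?thesis
  proof (induction xs arbitrary: C)
    case (Cons x xs)
    show ?case
      using finprod_lessThan_add[of 1 "length xs"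
        "\<lambda>i. G0_gen R (mat_of_cols m (C @ take i (x # xs))) (mat_of_cols m [(x # xs) ! i])"] c
      by (simp add: Cons finprod_singleton lessThan_Suc)
  qed simp
qed

lemma kappa_value_eq_list: "kappa_value R A = kappa_list R (dim_row A) [] (cols A)"
proof -
  interpret comm_group "goursat_group0 R" by (rule comm_group_goursat_group0)
  have "mat_of_cols (dim_row A) (take i (cols A)) = col_block A 0 i"
    "mat_of_cols (dim_row A) [cols A ! i] = col_block A i 1" if "i < dim_col A" for i
    using that by (auto intro!: eq_matI simp: mat_of_cols_def index_col_block)
  then show ?thesis
    unfolding kappa_list_finprod kappa_value_def
    by (intro finprod_cong') (auto intro: G0_gen_closed)
qed

lemma kappa_list_cong_set:
  assumes "set C = set C'" "set C \<subseteq> carrier_vec m"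
  shows "set xs \<subseteq> carrier_vec m \<Longrightarrow> kappa_list R m C xs = kappa_list R m C' xs"
  using assms
proof (induction xs arbitrary: C C')
  case (Cons x xs)
  have "L_class (mat_of_cols m C) (mat_of_cols m [x]) = L_class (mat_of_cols m C') (mat_of_cols m [x])"
    using Cons.prems by (intro L_class_permute_left) (simp_all add: cols_mat_of_cols)
  then have "G0_gen R (mat_of_cols m C) (mat_of_cols m [x]) = G0_gen R (mat_of_cols m C') (mat_of_cols m [x])"
    by (rule G0_gen_cong)
  moreover have "kappa_list R m (C @ [x]) xs = kappa_list R m (C' @ [x]) xs"
    using Cons.prems by (intro Cons.IH) auto
  ultimately show ?case by simp
qed simp

text \<open>
  The exchange relation of \<open>G\<^sub>0(R)\<close> is exactly the invariance of the first two terms under the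
  exchange of \<open>x\<close> and \<open>y\<close>.  In the later terms \<open>x\<close> and \<open>y\<close> occur in the left blocks only, where
  their order is irrelevant.
\<close>

lemma kappa_list_swap:
  assumes "set C \<union> {x, y} \<union> set zs \<subseteq> carrier_vec m"
  shows "kappa_list R m C (x # y # zs) = kappa_list R m C (y # x # zs)"
proof -
  interpret comm_group "goursat_group0 R" by (rule comm_group_goursat_group0)
  let ?g = "\<lambda>C x. G0_gen R (mat_of_cols m C) (mat_of_cols m [x])"
  have c: "?g C x \<in> carrier (goursat_group0 R)" for C x by (rule G0_gen_closed) simp_all
  have app: "hcat (mat_of_cols m C) (mat_of_cols m [x]) = mat_of_cols m (C @ [x])" for C x
    by (rule eq_matI) (auto simp: index_hcat mat_of_cols_def nth_append)
  have ex: "?g (C @ [x]) y \<otimes>\<^bsub>goursat_group0 R\<^esub> ?g C x = ?g (C @ [y]) x \<otimes>\<^bsub>goursat_group0 R\<^esub> ?g C y"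
    unfolding app[symmetric] by (rule G0_gen_exchange) simp_all
  have tail: "kappa_list R m (C @ [x, y]) zs = kappa_list R m (C @ [y, x]) zs"
    using assms by (intro kappa_list_cong_set) auto
  have "kappa_list R m C (x # y # zs) = (?g (C @ [x]) y \<otimes>\<^bsub>goursat_group0 R\<^esub> ?g C x) \<otimes>\<^bsub>goursat_group0 R\<^esub> kappa_list R m (C @ [x, y]) zs"
    using c kappa_list_closed[of R m "C @ [x, y]" zs] by (simp add: m_ac)
  also have "\<dots> = kappa_list R m C (y # x # zs)"
    unfolding ex tail using c kappa_list_closed[of R m "C @ [y, x]" zs] by (simp add: m_ac)
  finally show ?thesis .
qed

lemma kappa_list_move:
  assumes "set C \<union> set ys \<union> {x} \<union> set zs \<subseteq> carrier_vec m"
  shows "kappa_list R m C (ys @ x # zs) = kappa_list R m C (x # ys @ zs)"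
  using assms
proof (induction ys arbitrary: C)
  case (Cons y ys)
  have "kappa_list R m C (y # ys @ x # zs) = kappa_list R m C (y # x # ys @ zs)"
    using Cons.IH[of "C @ [y]"] Cons.prems by simp
  also have "\<dots> = kappa_list R m C (x # y # ys @ zs)"
    using Cons.prems by (intro kappa_list_swap) auto
  finally show ?case by simp
qed simp

lemma kappa_list_append_commute:
  assumes "set C \<union> set xs \<union> set ys \<subseteq> carrier_vec m"
  shows "kappa_list R m C (xs @ ys) = kappa_list R m C (ys @ xs)"
  using assms
proof (induction xs arbitrary: C)
  case (Cons x xs)
  have "kappa_list R m C (x # xs @ ys) = kappa_list R m C (x # ys @ xs)"
    using Cons.IH[of "C @ [x]"] Cons.prems by simp
  also have "\<dots> = kappa_list R m C (ys @ x # xs)"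
    using Cons.prems by (intro kappa_list_move[symmetric]) auto
  finally show ?case by simp
qed simp

lemma kappa_value_hcat_commute:
  assumes "dim_row X = dim_row Y"
  shows "kappa_value R (hcat X Y) = kappa_value R (hcat Y X)"
proof -
  have cols: "cols (hcat X Y) = cols X @ cols Y" if "dim_row X = dim_row Y" for X Y :: "'a mat"
    using that by (intro nth_equalityI) (auto simp: nth_append col_hcat)
  have "set (cols X) \<union> set (cols Y) \<subseteq> carrier_vec (dim_row Y)"
    using assms cols_dim[of X] cols_dim[of Y] by auto
  then show ?thesis
    using assms kappa_list_append_commute[of "[]" "cols X" "cols Y" "dim_row Y" R]
    by (simp add: kappa_value_eq_list cols)
qed

subsection \<open>Dependence on the cokernel only\<close>

lemma kappa_value_pad_rows:
  "kappa_value R (vcat A (0\<^sub>m k (dim_col A))) = kappa_value R A"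
proof -
  interpret comm_group "goursat_group0 R" by (rule comm_group_goursat_group0)
  have "G0_gen R (col_block (vcat A (0\<^sub>m k (dim_col A))) 0 i) (col_block (vcat A (0\<^sub>m k (dim_col A))) i 1) =
     G0_gen R (col_block A 0 i) (col_block A i 1)" if "i < dim_col A" for i
    using that L_class_pad_rows[of "col_block A 0 i" "col_block A i 1" k]
    by (intro G0_gen_cong) (simp add: col_block_vcat col_block_zero)
  then show ?thesis
    unfolding kappa_value_def by (intro finprod_cong') (auto intro: G0_gen_closed)
qed

lemma kappa_value_block_diag:
  "kappa_value R (block_diag A B) = kappa_value R A \<otimes>\<^bsub>goursat_group0 R\<^esub> kappa_value R B"
proof -
  interpret comm_group "goursat_group0 R" by (rule comm_group_goursat_group0)
  let ?A = "vcat A (0\<^sub>m (dim_row B) (dim_col A))" and ?B = "vcat (0\<^sub>m (dim_row A) (dim_col B)) B"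
  have "G0_gen R (hcat ?A (col_block ?B 0 j)) (col_block ?B j 1) = G0_gen R (col_block B 0 j) (col_block B j 1)"
    if "j < dim_col B" for j
    using that L_class_summand[of "col_block B 0 j" "col_block B j 1" A]
    by (intro G0_gen_cong) (simp add: col_block_vcat col_block_zero)
  then have "finprod (goursat_group0 R) (\<lambda>j. G0_gen R (hcat ?A (col_block ?B 0 j)) (col_block ?B j 1)) {..<dim_col ?B}
      = kappa_value R B"
    unfolding kappa_value_def by (intro finprod_cong') (auto intro: G0_gen_closed)
  then show ?thesis
    unfolding block_diag_hcat by (simp add: kappa_value_hcat kappa_value_pad_rows)
qed

text \<open>
  The new generators, listed first, are the standard basis vectors in the new rows, so that each of
  them contributes \<open>0\<^sub>1\<close>.  The terms of the old generators do not change, since the new ones can be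
  eliminated again.
\<close>

lemma kappa_value_add_generators:
  fixes A Q :: "'a::{ring,monoid_mult} mat"
  assumes "dim_col Q = dim_col A"
  shows "kappa_value R (hcat (vcat (0\<^sub>m (dim_row A) (dim_row Q)) (1\<^sub>m (dim_row Q))) (vcat A (- Q))) = kappa_value R A"
proof -
  interpret comm_group "goursat_group0 R" by (rule comm_group_goursat_group0)
  let ?E = "vcat (0\<^sub>m (dim_row A) (dim_row Q)) (1\<^sub>m (dim_row Q)) :: 'a mat" and ?X = "vcat A (- Q)"
  have "G0_gen R (col_block ?E 0 i) (col_block ?E i 1) = \<one>\<^bsub>goursat_group0 R\<^esub>" if "i < dim_row Q" for i
  proof (rule G0_gen_eq_oneI)
    \<comment> \<open>Selecting row \<open>i\<close> of the new rows annihilates the previous columns and maps the \<open>i\<close>-th one to 1.\<close>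
    define U where "U = (mat 1 (dim_row A + dim_row Q) (\<lambda>(r, c). if c = dim_row A + i then 1 else 0) :: 'a mat)"
    have dim_U: "dim_row U = 1" "dim_col U = dim_row A + dim_row Q" by (simp_all add: U_def)
    have U: "(U * X) $$ (0, c) = X $$ (dim_row A + i, c)"
      if "dim_row X = dim_row A + dim_row Q" "c < dim_col X" for X c
    proof -
      have "(U * X) $$ (0, c) = (\<Sum>r = 0..<dim_row A + dim_row Q. (if r = dim_row A + i then 1 else 0) * X $$ (r, c))"
        using that by (simp add: U_def scalar_prod_def)
      also have "\<dots> = (\<Sum>r = 0..<dim_row A + dim_row Q. if r = dim_row A + i then X $$ (r, c) else 0)"
        by (rule sum.cong) auto
      finally show ?thesis using \<open>i < dim_row Q\<close> by simp
    qed
    have "L_class (col_block ?E 0 i) (col_block ?E i 1) = L_zero (dim_col (col_block ?E i 1))"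
    proof (rule L_class_eq_L_zeroI[where U = U])
      show "U * col_block ?E 0 i = 0\<^sub>m (dim_col (col_block ?E i 1)) (dim_col (col_block ?E 0 i))"
        by (rule eq_matI) (use \<open>i < dim_row Q\<close> in \<open>auto simp del: index_mult_mat(1) simp: dim_U U index_col_block index_vcat\<close>)
      show "U * col_block ?E i 1 = 1\<^sub>m (dim_col (col_block ?E i 1))"
        by (rule eq_matI) (use \<open>i < dim_row Q\<close> in \<open>auto simp del: index_mult_mat(1) simp: dim_U U index_col_block index_vcat\<close>)
    qed (simp_all add: dim_U)
    then show "L_class (col_block ?E 0 i) (col_block ?E i 1) = L_zero 1" by simp
  qed
  then have E: "kappa_value R ?E = \<one>\<^bsub>goursat_group0 R\<^esub>"
    unfolding kappa_value_def by (subst finprod_one_eqI) auto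
  have "G0_gen R (hcat ?E (col_block ?X 0 j)) (col_block ?X j 1) = G0_gen R (col_block A 0 j) (col_block A j 1)"
    if "j < dim_col A" for j
  proof -
    have "col_block (- Q) l k = - col_block Q l k" if "l + k \<le> dim_col Q" for l k
      using that by (intro eq_matI) (auto simp: index_col_block)
    then show ?thesis
      using that assms L_class_eliminate[of "col_block A 0 j" "col_block A j 1" "col_block Q 0 j" "col_block Q j 1"]
      by (intro G0_gen_cong) (simp add: col_block_vcat)
  qed
  then have "finprod (goursat_group0 R) (\<lambda>j. G0_gen R (hcat ?E (col_block ?X 0 j)) (col_block ?X j 1)) {..<dim_col ?X}
      = kappa_value R A"
    unfolding kappa_value_def by (intro finprod_cong') (auto intro: G0_gen_closed)
  then show ?thesis
    using kappa_value_closed[of R A] by (simp add: kappa_value_hcat E)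
qed

text \<open>
  Both matrices present the same module.  On the union of the two sets of generators it has two
  presentations: the relations \<open>A\<close> together with equations expressing the generators of \<open>B\<close> through
  those of \<open>A\<close>, and vice versa.  These two matrices have the same row space, and they only differ
  from \<open>A\<close> and \<open>B\<close> by redundant generators.
\<close>

lemma kappa_value_cong:
  fixes A B :: "'a::{ring,monoid_mult} mat"
  assumes "coker_equiv A B"
  shows "kappa_value R A = kappa_value R B"
proof -
  obtain P Q S T W Z where c: "P \<in> carrier_mat (dim_col A) (dim_col B)" "Q \<in> carrier_mat (dim_col B) (dim_col A)"
     "S \<in> carrier_mat (dim_row A) (dim_row B)" "T \<in> carrier_mat (dim_row B) (dim_row A)"
     "W \<in> carrier_mat (dim_col A) (dim_row A)" "Z \<in> carrier_mat (dim_col B) (dim_row B)"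
    and e: "A * P = S * B" "B * Q = T * A" "P * Q = 1\<^sub>m (dim_col A) + W * A" "Q * P = 1\<^sub>m (dim_col B) + Z * B"
    using assms unfolding coker_equiv_def by metis
  let ?E = "hcat (vcat (0\<^sub>m (dim_row A) (dim_col B)) (1\<^sub>m (dim_col B))) (vcat A (- Q))"
  let ?F = "hcat (vcat B (- P)) (vcat (0\<^sub>m (dim_row B) (dim_col A)) (1\<^sub>m (dim_col A)))"
  have dims: "dim_row P = dim_col A" "dim_col P = dim_col B" "dim_row Q = dim_col B" "dim_col Q = dim_col A"
     "dim_row S = dim_row A" "dim_col S = dim_row B" "dim_row T = dim_row B" "dim_col T = dim_row A"
     "dim_row W = dim_col A" "dim_col W = dim_row A" "dim_row Z = dim_col B" "dim_col Z = dim_row B"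
    using c by auto
  note [simp] = block_simps
  have cancel: "- X + (Y + X) = Y" "X + - X = 0\<^sub>m (dim_row X) (dim_col X)"
    if "dim_row X = dim_row Y" "dim_col X = dim_col Y" for X Y :: "'a mat"
    using that by (auto intro!: eq_matI)
  have "kappa_value R A = kappa_value R ?E"
    using kappa_value_add_generators[of Q A R] dims by simp
  also have "\<dots> = kappa_value R ?F"
  proof (rule kappa_value_row_ops)
    show "?E = vcat (hcat S A) (hcat (- Z) (- Q)) * ?F"
      using dims e cancel by simp
    show "?F = vcat (hcat T B) (hcat (- W) (- P)) * ?E"
      using dims e cancel by simp
  qed (use dims in simp_all)
  also have "\<dots> = kappa_value R (hcat (vcat (0\<^sub>m (dim_row B) (dim_col A)) (1\<^sub>m (dim_col A))) (vcat B (- P)))"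
    by (rule kappa_value_hcat_commute) (use dims in simp)
  also have "\<dots> = kappa_value R B"
    using kappa_value_add_generators[of P B R] dims by simp
  finally show ?thesis .
qed

section \<open>The morphism from the Goursat group to the Grothendieck group\<close>

text \<open>
  The pair \<open>(B | A)\<close> stands for the cokernel \<open>M\<close> of \<open>(B, A)\<close> with the tuple \<open>x\<close> of its last \<open>n\<close>
  generators, and \<open>B\<close> presents \<open>M/x\<close>.  So \<open>gamma_value\<close> is \<open>{M} - {M/x}\<close>.
\<close>

definition gamma_value :: "'a::{ring,monoid_mult} itself \<Rightarrow> 'a mat \<Rightarrow> 'a mat \<Rightarrow>
    (('a, 'a vec set) module set \<Rightarrow>\<^sub>0 int) set" where
  "gamma_value R B A = K0_mat R (hcat B A) \<otimes>\<^bsub>K0 R\<^esub> inv\<^bsub>K0 R\<^esub> (K0_mat R B)"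

lemma coker_equiv_hcat_commute:
  fixes X Y :: "'a::{ring,monoid_mult} mat"
  assumes "dim_row X = dim_row Y"
  shows "coker_equiv (hcat X Y) (hcat Y X)"
  using coker_equiv_swap_blocks[of X "0\<^sub>m (dim_row Y) 0" Y "0\<^sub>m (dim_row Y) 0"] assms by simp

lemma coker_equiv_hcat_swap:
  fixes B X Y :: "'a::{ring,monoid_mult} mat"
  assumes "dim_row X = dim_row B" "dim_row Y = dim_row B"
  shows "coker_equiv (hcat (hcat B X) Y) (hcat (hcat B Y) X)"
  using coker_equiv_swap_blocks[of X B Y "0\<^sub>m (dim_row B) 0"] assms by simp

text \<open>
  The sum of the modules \<open>M\<close> and \<open>M'\<close> of \<open>(B, A)\<close> and \<open>(B', A')\<close> with their distinguished tuples
  identified: the columns of \<open>A\<close> and \<open>A'\<close> stand above each other.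
\<close>

definition amalgam :: "'a::zero mat \<Rightarrow> 'a mat \<Rightarrow> 'a mat \<Rightarrow> 'a mat \<Rightarrow> 'a mat" where
  "amalgam B A B' A' = vcat (hcat (hcat B A) (0\<^sub>m (dim_row A) (dim_col B')))
     (hcat (hcat (0\<^sub>m (dim_row A') (dim_col B)) A') B')"

text \<open>
  A homomorphism \<open>M' \<rightarrow> M\<close> with \<open>x' \<mapsto> x\<close> extends to a retraction of the amalgam onto \<open>M\<close>; what
  remains is the quotient of the amalgam by \<open>M\<close>, which is \<open>M'/x'\<close>.
\<close>

lemma coker_equiv_amalgam:
  fixes B A B' A' :: "'a::{ring,monoid_mult} mat"
  assumes dims: "dim_row B = dim_row A" "dim_row B' = dim_row A'" "dim_col A = n" "dim_col A' = n"
    and le: "L_le n (B, A) (B', A')"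
  shows "coker_equiv (block_diag (hcat B A) B') (amalgam B A B' A')"
proof -
  obtain U V G where c: "U \<in> carrier_mat (dim_row A') (dim_row A)" "V \<in> carrier_mat (dim_col B') (dim_col B)"
    "G \<in> carrier_mat (dim_col B') n" and e: "U * B = B' * V" "U * A = A' + B' * G"
    using le by (auto simp: L_le_def)
  have dc: "dim_row U = dim_row A'" "dim_col U = dim_row A" "dim_row V = dim_col B'" "dim_col V = dim_col B"
    "dim_row G = dim_col B'" "dim_col G = n" using c by auto
  have "coker_equiv (block_diag (hcat B A) B') (vcat (hcat (hcat B A) (0\<^sub>m (dim_row (hcat B A)) (dim_col B')))
     (hcat (hcat (0\<^sub>m (dim_row A') (dim_col B)) A') B'))"
    by (rule coker_equiv_clear_block[where U = U and H = "hcat V G"])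
      (use dims dc e in \<open>simp_all add: block_simps\<close>)
  then show ?thesis using dims by (simp add: amalgam_def)
qed

lemma coker_equiv_amalgam_commute:
  fixes B A B' A' :: "'a::{ring,monoid_mult} mat"
  assumes dims: "dim_row B = dim_row A" "dim_row B' = dim_row A'" "dim_col A = n" "dim_col A' = n"
  shows "coker_equiv (amalgam B A B' A') (amalgam B' A' B A)"
proof -
  let ?y = "vcat (0\<^sub>m (dim_row A') (dim_col B)) B" and ?x = "vcat A' A" and ?z = "vcat B' (0\<^sub>m (dim_row A) (dim_col B'))"
  let ?S = "\<lambda>k l. vcat (hcat (0\<^sub>m k l) (1\<^sub>m k)) (hcat (1\<^sub>m l) (0\<^sub>m l k)) :: 'a mat"
  have "coker_equiv (amalgam B A B' A') (hcat (hcat ?y ?x) ?z)"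
    by (rule coker_equiv_row_ops[of "?S (dim_row A) (dim_row A')" _ _ "?S (dim_row A') (dim_row A)"])
      (use dims in \<open>auto simp: amalgam_def block_simps\<close>)
  moreover have "coker_equiv (hcat (hcat ?y ?x) ?z) (hcat ?z (hcat ?y ?x))"
    by (rule coker_equiv_hcat_commute) (use dims in simp)
  moreover have "hcat ?z (hcat ?y ?x) = hcat (hcat ?z ?y) ?x"
    by (rule hcat_assoc[symmetric]) (use dims in simp_all)
  moreover have "coker_equiv (hcat (hcat ?z ?y) ?x) (hcat (hcat ?z ?x) ?y)"
    by (rule coker_equiv_hcat_swap) (use dims in simp_all)
  moreover have "hcat (hcat ?z ?x) ?y = amalgam B' A' B A"
    using dims by (simp add: amalgam_def block_simps)
  ultimately show ?thesis using coker_equiv_trans by metis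
qed

lemma gamma_value_closed: "gamma_value R B A \<in> carrier (K0 R)"
proof -
  interpret comm_group "K0 R" by (rule comm_group_K0)
  show ?thesis by (simp add: gamma_value_def K0_mat_closed)
qed

lemma (in comm_group) div_eq_divI:
  assumes "a \<in> carrier G" "b \<in> carrier G" "c \<in> carrier G" "d \<in> carrier G"
    and eq: "a \<otimes> d = c \<otimes> b"
  shows "a \<otimes> inv b = c \<otimes> inv d"
proof -
  have "c \<otimes> inv d \<otimes> b = (a \<otimes> d) \<otimes> inv d" unfolding eq using assms(1-4) by (simp add: m_ac)
  also have "\<dots> = a" using assms(1-4) by (simp add: m_assoc)
  finally have "a \<otimes> inv b = (c \<otimes> inv d \<otimes> b) \<otimes> inv b" by simp
  then show "a \<otimes> inv b = c \<otimes> inv d" using assms(1-4) by (simp add: m_assoc)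
qed

lemma (in comm_group) div_mult_div_cancel:
  assumes "a \<in> carrier G" "b \<in> carrier G" "c \<in> carrier G"
  shows "(a \<otimes> inv b) \<otimes> (b \<otimes> inv c) = a \<otimes> inv c"
proof -
  have "inv b \<otimes> (b \<otimes> inv c) = inv c" using assms m_assoc[of "inv b" b "inv c", symmetric] by simp
  then show ?thesis using assms by (simp add: m_assoc)
qed

lemma (in comm_group) mult_div_mult:
  assumes "a \<in> carrier G" "b \<in> carrier G" "c \<in> carrier G" "d \<in> carrier G"
  shows "(a \<otimes> b) \<otimes> inv (c \<otimes> d) = (a \<otimes> inv c) \<otimes> (b \<otimes> inv d)"
  using assms by (simp add: inv_mult m_ac)

text \<open>
  Pairs with the same class have homomorphisms \<open>M' \<rightarrow> M\<close> and \<open>M \<rightarrow> M'\<close> that respect the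
  tuples, so the amalgam is isomorphic both to \<open>M \<oplus> M'/x'\<close> and to \<open>M' \<oplus> M/x\<close>.
\<close>

lemma gamma_value_cong:
  fixes R :: "'a::{ring,monoid_mult} itself"
  assumes dims: "dim_row B = dim_row A" "dim_row B' = dim_row A'" and eq: "L_class B A = L_class B' A'"
  shows "gamma_value R B A = gamma_value R B' A'"
proof -
  interpret comm_group "K0 R" by (rule comm_group_K0)
  let ?n = "dim_col A"
  have "(B', A') \<in> L_class B' A'"
    unfolding L_class_def using dims equiv_class_self[OF equiv_L_rel, of "(B', A')" "dim_col A'"] by (simp add: L_pairs_def)
  then have "((B, A), (B', A')) \<in> L_rel ?n" using eq by (auto simp: L_class_def)
  then have n: "dim_col A' = ?n" and le: "L_le ?n (B, A) (B', A')" "L_le ?n (B', A') (B, A)"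
    by (auto simp: L_rel_def L_pairs_def)
  have "coker_equiv (block_diag (hcat B A) B') (block_diag (hcat B' A') B)"
    using coker_equiv_amalgam[OF dims refl n le(1)] coker_equiv_amalgam_commute[OF dims refl n]
      coker_equiv_amalgam[OF dims(2,1) n refl le(2)] by (meson coker_equiv_sym coker_equiv_trans)
  then have "K0_mat R (hcat B A) \<otimes>\<^bsub>K0 R\<^esub> K0_mat R B' = K0_mat R (hcat B' A') \<otimes>\<^bsub>K0 R\<^esub> K0_mat R B"
    unfolding K0_mat_block_diag[symmetric] by (rule K0_mat_cong)
  then show ?thesis unfolding gamma_value_def by (intro div_eq_divI K0_mat_closed)
qed

text \<open>
  Both sides are \<open>{(B, A, A')} - {B}\<close>.
\<close>

lemma gamma_value_exchange:
  assumes "dim_row A = dim_row B" "dim_row A' = dim_row B"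
  shows "gamma_value R (hcat B A) A' \<otimes>\<^bsub>K0 R\<^esub> gamma_value R B A =
    gamma_value R (hcat B A') A \<otimes>\<^bsub>K0 R\<^esub> gamma_value R B A'"
proof -
  interpret comm_group "K0 R" by (rule comm_group_K0)
  have "K0_mat R (hcat (hcat B A) A') = K0_mat R (hcat (hcat B A') A)"
    by (intro K0_mat_cong coker_equiv_hcat_swap assms)
  then show ?thesis unfolding gamma_value_def by (simp add: div_mult_div_cancel K0_mat_closed)
qed

lemma gamma_value_block_diag:
  fixes R :: "'a::{ring,monoid_mult} itself"
  assumes dims: "dim_row B = dim_row A" "dim_row B' = dim_row A'"
  shows "gamma_value R (block_diag B B') (block_diag A A') = gamma_value R B A \<otimes>\<^bsub>K0 R\<^esub> gamma_value R B' A'"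
proof -
  interpret comm_group "K0 R" by (rule comm_group_K0)
  let ?m = "dim_row A" and ?m' = "dim_row A'"
  let ?b = "vcat B (0\<^sub>m ?m' (dim_col B))" and ?a = "vcat A (0\<^sub>m ?m' (dim_col A))"
  let ?b' = "vcat (0\<^sub>m ?m (dim_col B')) B'" and ?a' = "vcat (0\<^sub>m ?m (dim_col A')) A'"
  have "hcat (block_diag B B') (block_diag A A') = hcat (hcat (hcat ?b ?b') ?a) ?a'"
    using dims by (simp add: block_diag_hcat hcat_assoc)
  moreover have "block_diag (hcat B A) (hcat B' A') = hcat (hcat (hcat ?b ?a) ?b') ?a'"
    using dims by (intro eq_matI) (auto simp: block_diag_def index_hcat index_vcat)
  moreover have "coker_equiv (hcat (hcat (hcat ?b ?b') ?a) ?a') (hcat (hcat (hcat ?b ?a) ?b') ?a')"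
    by (rule coker_equiv_swap_blocks) (use dims in simp_all)
  ultimately have "K0_mat R (hcat (block_diag B B') (block_diag A A')) =
      K0_mat R (hcat B A) \<otimes>\<^bsub>K0 R\<^esub> K0_mat R (hcat B' A')"
    using K0_mat_cong K0_mat_block_diag by metis
  then show ?thesis
    unfolding gamma_value_def by (simp add: K0_mat_block_diag mult_div_mult K0_mat_closed)
qed

lemma gamma_value_L_zero: "gamma_value R (0\<^sub>m n 0) (1\<^sub>m n) = \<one>\<^bsub>K0 R\<^esub>"
proof -
  interpret comm_group "K0 R" by (rule comm_group_K0)
  show ?thesis by (simp add: gamma_value_def K0_mat_one_mat K0_mat_no_cols)
qed

lemma G_gensE:
  fixes R :: "'a::{ring,monoid_mult} itself"
  assumes "c \<in> G_gens R"
  obtains B A where "dim_row B = dim_row A" "1 \<le> dim_col A" "c = L_class B A"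
  using assms unfolding G_gens_def by (auto elim!: L_setE)

lemma ex1_is_gamma:
  fixes R :: "'a::{ring,monoid_mult} itself"
  shows "\<exists>!f. is_gamma R f"
proof (rule ex_ex1I)
  \<comment> \<open>A value for every class; by \<open>gamma_value_cong\<close> the choice of the representative does not matter.\<close>
  define v where "v c = (let p = SOME p. dim_row (fst p) = dim_row (snd p) \<and> c = L_class (fst p) (snd p)
     in gamma_value R (fst p) (snd p))" for c
  have v: "v (L_class B A) = gamma_value R B A" if "dim_row B = dim_row A" for B A
  proof -
    let ?Q = "\<lambda>p. dim_row (fst p) = dim_row (snd p) \<and> L_class B A = L_class (fst p) (snd p)"
    have "?Q (SOME p. ?Q p)" by (rule someI[of ?Q "(B, A)"]) (use that in simp)
    then show ?thesis unfolding v_def Let_def using that by (intro gamma_value_cong) auto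
  qed
  have v_zero: "v (L_zero n) = \<one>\<^bsub>K0 R\<^esub>" for n
    unfolding L_zero_def by (simp add: v gamma_value_L_zero)
  have "\<exists>h\<in>hom (presented_group (G_gens R) (G_rels R)) (K0 R). h \<in> extensional (carrier (presented_group (G_gens R) (G_rels R))) \<and> (\<forall>x\<in>G_gens R. h (presented_gen (G_gens R) (G_rels R) x) = v x)"
  proof (rule G.hom_exists[where R = R and H = "K0 R" and f = v])
    show "comm_group (K0 R)" by (rule comm_group_K0)
    show "v x \<in> carrier (K0 R)" if "x \<in> G_gens R" for x
      using that by (auto elim!: G_gensE simp: v gamma_value_closed)
    fix F r assume F: "F \<in> hom (free_Abelian_group (G_gens R)) (K0 R)" "\<And>x. x \<in> G_gens R \<Longrightarrow> F (frag_of x) = v x"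
      and "r \<in> G_rels R"
    note rel = hom_frag_relation[OF F(1) comm_group_K0]
    from \<open>r \<in> G_rels R\<close> show "F r = \<one>\<^bsub>K0 R\<^esub>"
    proof (cases rule: G_rels_cases)
      case (exchange B A A')
      then have "L_class (hcat B A) A' \<in> G_gens R" "L_class B A' \<in> G_gens R"
        "L_class (hcat B A') A \<in> G_gens R" "L_class B A \<in> G_gens R"
        by (auto intro!: L_class_in_G_gens)
      then show ?thesis
        using exchange gamma_value_exchange[of A B A' R] by (simp add: rel(2) F(2) v)
    next
      case (sum B A B' A')
      then have "L_class (block_diag B B') (block_diag A A') \<in> G_gens R" "L_class B A \<in> G_gens R"
        "L_class B' A' \<in> G_gens R"
        by (auto intro!: L_class_in_G_gens)
      then show ?thesis
        using sum gamma_value_block_diag[of B A B' A' R] by (simp add: rel(1) F(2) v)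
    next
      case (zero n)
      then show ?thesis using L_zero_in_G_gens[of n R] by (simp add: F(2) v_zero)
    qed
  qed
  then obtain h where h: "h \<in> hom (presented_group (G_gens R) (G_rels R)) (K0 R)"
    "h \<in> extensional (carrier (presented_group (G_gens R) (G_rels R)))"
    "\<And>x. x \<in> G_gens R \<Longrightarrow> h (presented_gen (G_gens R) (G_rels R) x) = v x" by blast
  have "is_gamma R h"
    unfolding is_gamma_def goursat_group_def
    using h by (auto simp: G_gen_def L_pairs_def v gamma_value_def[symmetric] L_class_in_G_gens)
  then show "\<exists>f. is_gamma R f" by blast
next
  fix f g assume f: "is_gamma R f" and g: "is_gamma R g"
  interpret comm_group "K0 R" by (rule comm_group_K0)
  show "f = g"
  proof (rule G.hom_unique_extensional)
    show "f \<in> hom (presented_group (G_gens R) (G_rels R)) (K0 R)" "f \<in> extensional (carrier (presented_group (G_gens R) (G_rels R)))"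
      "g \<in> hom (presented_group (G_gens R) (G_rels R)) (K0 R)" "g \<in> extensional (carrier (presented_group (G_gens R) (G_rels R)))"
      using f g by (auto simp: is_gamma_def goursat_group_def)
    fix x assume "x \<in> G_gens R"
    then obtain B A where x: "dim_row B = dim_row A" "1 \<le> dim_col A" "x = L_class B A" by (rule G_gensE)
    then have "f (G_gen R B A) = g (G_gen R B A)"
      using f g by (auto simp: is_gamma_def L_pairs_def)
    then show "f (presented_gen (G_gens R) (G_rels R) x) = g (presented_gen (G_gens R) (G_rels R) x)"
      by (simp add: G_gen_def x)
  qed (rule is_group)
qed

lemma ex1_is_iota:
  fixes R :: "'a::{ring,monoid_mult} itself"
  shows "\<exists>!f. is_iota R f"
proof (rule ex_ex1I)
  let ?v = "presented_gen (G_gens R) (G_rels R)"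
  have sub: "L_set 1 \<subseteq> G_gens R" by (auto simp: G_gens_def)
  have "\<exists>h\<in>hom (presented_group (L_set 1) (G0_rels R)) (goursat_group R). h \<in> extensional (carrier (presented_group (L_set 1) (G0_rels R))) \<and> (\<forall>x\<in>L_set 1. h (presented_gen (L_set 1) (G0_rels R) x) = ?v x)"
  proof (rule G0.hom_exists[where R = R and H = "goursat_group R" and f = ?v])
    show "comm_group (goursat_group R)" by (rule comm_group_goursat_group)
    show "?v x \<in> carrier (goursat_group R)" if "x \<in> L_set 1" for x
      unfolding goursat_group_def using that sub by (intro G.gen_closed) auto
    fix F r assume F: "F \<in> hom (free_Abelian_group (L_set 1)) (goursat_group R)" "\<And>x. x \<in> L_set 1 \<Longrightarrow> F (frag_of x) = ?v x"
      and "r \<in> G0_rels R"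
    note rel = hom_frag_relation[OF F(1) comm_group_goursat_group]
    from \<open>r \<in> G0_rels R\<close> show "F r = \<one>\<^bsub>goursat_group R\<^esub>"
    proof (cases rule: G0_rels_cases)
      case (exchange B A A')
      then have "L_class (hcat B A) A' \<in> L_set 1" "L_class B A' \<in> L_set 1"
        "L_class (hcat B A') A \<in> L_set 1" "L_class B A \<in> L_set 1"
        by (auto intro!: L_class_in_L_set)
      then show ?thesis
        using exchange G_gen_exchange[of A B A' R] by (simp add: rel(2) F(2) G_gen_def)
    next
      case zero
      have "G_gen R (0\<^sub>m 1 0) (1\<^sub>m 1) = \<one>\<^bsub>goursat_group R\<^esub>"
        by (rule G_gen_eq_oneI[of _ _ 1]) (simp_all add: L_zero_def)
      then have "?v (L_zero 1) = \<one>\<^bsub>goursat_group R\<^esub>"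
        by (simp only: G_gen_def L_zero_def)
      then show ?thesis by (simp only: zero F(2)[OF L_zero_in_L_set])
    qed
  qed
  then obtain h where h: "h \<in> hom (presented_group (L_set 1) (G0_rels R)) (goursat_group R)"
    "h \<in> extensional (carrier (presented_group (L_set 1) (G0_rels R)))"
    "\<And>x. x \<in> L_set 1 \<Longrightarrow> h (presented_gen (L_set 1) (G0_rels R) x) = ?v x" by blast
  have "is_iota R h"
    unfolding is_iota_def goursat_group0_def
    using h L_class_in_L_set by (auto simp: G_gen_def G0_gen_def L_pairs_def)
  then show "\<exists>f. is_iota R f" by blast
next
  fix f g assume f: "is_iota R f" and g: "is_iota R g"
  interpret comm_group "goursat_group R" by (rule comm_group_goursat_group)
  show "f = g"
  proof (rule G0.hom_unique_extensional)
    show "f \<in> hom (presented_group (L_set 1) (G0_rels R)) (goursat_group R)" "f \<in> extensional (carrier (presented_group (L_set 1) (G0_rels R)))"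
      "g \<in> hom (presented_group (L_set 1) (G0_rels R)) (goursat_group R)" "g \<in> extensional (carrier (presented_group (L_set 1) (G0_rels R)))"
      using f g by (auto simp: is_iota_def goursat_group0_def)
    fix x :: "('a mat \<times> 'a mat) set" assume "x \<in> L_set 1"
    then obtain B A where x: "dim_row B = dim_row A" "dim_col A = 1" "x = L_class B A" by (rule L_setE)
    then have "f (G0_gen R B A) = g (G0_gen R B A)"
      using f g by (auto simp: is_iota_def L_pairs_def)
    then show "f (presented_gen (L_set 1) (G0_rels R) x) = g (presented_gen (L_set 1) (G0_rels R) x)"
      by (simp add: G0_gen_def x)
  qed (rule is_group)
qed

lemma ex1_is_kappa:
  fixes R :: "'a::{ring,monoid_mult} itself"
  shows "\<exists>!f. is_kappa R f"
proof (rule ex_ex1I)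
  \<comment> \<open>A value for every class; by \<open>kappa_value_cong\<close> the choice of the matrix does not matter.\<close>
  define v where "v c = kappa_value R (SOME A. c = lmod_class (coker_mod A))" for c
  have v: "v (lmod_class (coker_mod A)) = kappa_value R A" for A
  proof -
    have "lmod_class (coker_mod A) = lmod_class (coker_mod (SOME A'. lmod_class (coker_mod A) = lmod_class (coker_mod A')))"
      by (rule someI[of "\<lambda>A'. lmod_class (coker_mod A) = lmod_class (coker_mod A')"]) (rule refl)
    then have "coker_equiv A (SOME A'. lmod_class (coker_mod A) = lmod_class (coker_mod A'))"
      by (rule lmod_class_coker_mod_eq_iff[THEN iffD1])
    then show ?thesis unfolding v_def by (rule kappa_value_cong[symmetric])
  qed
  have "\<exists>h\<in>hom (presented_group (K0_gens R) (K0_rels R)) (goursat_group0 R). h \<in> extensional (carrier (presented_group (K0_gens R) (K0_rels R))) \<and> (\<forall>x\<in>K0_gens R. h (presented_gen (K0_gens R) (K0_rels R) x) = v x)"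
  proof (rule K0.hom_exists[where R = R and H = "goursat_group0 R" and f = v])
    show "comm_group (goursat_group0 R)" by (rule comm_group_goursat_group0)
    show "v x \<in> carrier (goursat_group0 R)" if "x \<in> K0_gens R" for x
      using that by (auto elim!: K0_gensE simp: v kappa_value_closed)
    fix F r assume F: "F \<in> hom (free_Abelian_group (K0_gens R)) (goursat_group0 R)" "\<And>x. x \<in> K0_gens R \<Longrightarrow> F (frag_of x) = v x"
      and "r \<in> K0_rels R"
    note rel = hom_frag_relation[OF F(1) comm_group_goursat_group0]
    from \<open>r \<in> K0_rels R\<close> obtain A B where "r = frag_of (lmod_class (coker_mod (block_diag A B))) -
        (frag_of (lmod_class (coker_mod A)) + frag_of (lmod_class (coker_mod B)))"
      by (rule K0_rels_cases)
    then show "F r = \<one>\<^bsub>goursat_group0 R\<^esub>"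
      by (simp add: rel(1) F(2) v lmod_class_coker_mod_in_K0_gens kappa_value_block_diag)
  qed
  then obtain h where h: "h \<in> hom (presented_group (K0_gens R) (K0_rels R)) (goursat_group0 R)"
    "h \<in> extensional (carrier (presented_group (K0_gens R) (K0_rels R)))"
    "\<And>x. x \<in> K0_gens R \<Longrightarrow> h (presented_gen (K0_gens R) (K0_rels R) x) = v x" by blast
  have "is_kappa R h"
    unfolding is_kappa_def K0_def
    using h lmod_class_coker_mod_in_K0_gens[of _ R] by (auto simp: K0_mat_def v kappa_value_def)
  then show "\<exists>f. is_kappa R f" by blast
next
  fix f g assume f: "is_kappa R f" and g: "is_kappa R g"
  interpret comm_group "goursat_group0 R" by (rule comm_group_goursat_group0)
  show "f = g"
  proof (rule K0.hom_unique_extensional)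
    show "f \<in> hom (presented_group (K0_gens R) (K0_rels R)) (goursat_group0 R)" "f \<in> extensional (carrier (presented_group (K0_gens R) (K0_rels R)))"
      "g \<in> hom (presented_group (K0_gens R) (K0_rels R)) (goursat_group0 R)" "g \<in> extensional (carrier (presented_group (K0_gens R) (K0_rels R)))"
      using f g by (auto simp: is_kappa_def K0_def)
    fix x assume "x \<in> K0_gens R"
    then obtain A where x: "x = lmod_class (coker_mod A)" by (rule K0_gensE)
    then have "f (K0_mat R A) = g (K0_mat R A)"
      using f g by (simp add: is_kappa_def)
    then show "f (presented_gen (K0_gens R) (K0_rels R) x) = g (presented_gen (K0_gens R) (K0_rels R) x)"
      by (simp add: K0_mat_def x)
  qed (rule is_group)
qed

section \<open>Splitting off columns\<close>

lemma G_gen_cong: "L_class B A = L_class B' A' \<Longrightarrow> G_gen R B A = G_gen R B' A'"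
  by (simp add: G_gen_def)

text \<open>
  In terms of modules with tuples: \<open>[M; x, z] = [M; z] + [M/z; x]\<close>, where \<open>x\<close> and \<open>z\<close> belong to the
  columns \<open>A\<close> and \<open>a\<close>.  Adjoin a copy \<open>z'\<close> of \<open>z\<close> by the relation \<open>z' = z\<close>, and exchange the
  tuples \<open>z\<close> and \<open>(x, z')\<close>.  The exchange relation reads
  \<open>[M; x, z'] + [M/(x, z'); z] = [M; z] + [M/z; x, z']\<close>.  Modulo \<open>(x, z')\<close> the tuple \<open>z\<close> vanishes, so
  the second term is zero.  Modulo \<open>z\<close> the tuple \<open>z'\<close> vanishes, and since its column then involves
  a row of its own, the relation for block diagonal pairs removes it from the last term.
\<close>

lemma G_gen_split:
  fixes R :: "'a::{ring,monoid_mult} itself"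
  assumes dims: "dim_row B = dim_row A" "dim_row a = dim_row A" "1 \<le> dim_col A" "1 \<le> dim_col a"
  shows "G_gen R B (hcat A a) = G_gen R B A \<otimes>\<^bsub>goursat_group R\<^esub> G_gen R (hcat B A) a"
proof -
  interpret comm_group "goursat_group R" by (rule comm_group_goursat_group)
  let ?m = "dim_row A" and ?n = "dim_col A" and ?k = "dim_col B" and ?r = "dim_col a"
  \<comment> \<open>The last \<open>r\<close> rows are the relation \<open>z' = z\<close>; \<open>X\<close> holds the columns of \<open>z\<close>, and \<open>Y\<close> those of \<open>(x, z')\<close>.\<close>
  let ?C = "vcat B (0\<^sub>m ?r ?k)" and ?X = "vcat a (- 1\<^sub>m ?r)"
  let ?Y = "vcat (hcat A (0\<^sub>m ?m ?r)) (hcat (0\<^sub>m ?r ?n) (1\<^sub>m ?r))"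
  note [simp] = block_simps
  have diag: "?Y = block_diag A (1\<^sub>m ?r)" "?C = block_diag B (0\<^sub>m ?r 0)"
    using dims by (simp_all add: block_diag_vcat)
  have exchange: "G_gen R (hcat ?C ?X) ?Y \<otimes>\<^bsub>goursat_group R\<^esub> G_gen R ?C ?X =
      G_gen R (hcat ?C ?Y) ?X \<otimes>\<^bsub>goursat_group R\<^esub> G_gen R ?C ?Y"
    by (rule G_gen_exchange) (use dims in simp_all)
  have CX: "G_gen R ?C ?X = \<one>\<^bsub>goursat_group R\<^esub>"
  proof (rule G_gen_eq_oneI)
    have "L_class ?C ?X = L_zero (dim_col ?X)"
      by (rule L_class_eq_L_zeroI[where U = "hcat (0\<^sub>m ?r ?m) (- 1\<^sub>m ?r)"]) (use dims in simp_all)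
    then show "L_class ?C ?X = L_zero ?r" by simp
  qed (rule dims)
  have CY: "G_gen R ?C ?Y = G_gen R B A"
  proof -
    have "G_gen R (0\<^sub>m ?r 0) (1\<^sub>m ?r) = \<one>\<^bsub>goursat_group R\<^esub>"
      by (rule G_gen_eq_oneI[of _ _ ?r]) (use dims in \<open>simp_all add: L_zero_def\<close>)
    then show ?thesis
      unfolding diag using dims by (simp add: G_gen_block_diag G_gen_closed)
  qed
  have CXY: "L_class (hcat ?C ?X) ?Y = L_class B (hcat A a)"
  proof (rule L_class_eqI)
    show "L_le (?n + ?r) (hcat ?C ?X, ?Y) (B, hcat A a)"
      by (rule L_leI[of "hcat (1\<^sub>m ?m) a" _ _ "hcat (1\<^sub>m ?k) (0\<^sub>m ?k ?r)" _ _ "0\<^sub>m ?k (?n + ?r)"])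
        (use dims in \<open>simp_all del: hcat_vcat\<close>)
    show "L_le (?n + ?r) (B, hcat A a) (hcat ?C ?X, ?Y)"
      by (rule L_leI[of "vcat (1\<^sub>m ?m) (0\<^sub>m ?r ?m)" _ _ "vcat (1\<^sub>m ?k) (0\<^sub>m ?r ?k)" _ _
            "vcat (0\<^sub>m ?k (?n + ?r)) (hcat (0\<^sub>m ?r ?n) (1\<^sub>m ?r))"])
        (use dims in \<open>simp_all\<close>)
  qed (use dims in simp_all)
  have CYX: "L_class (hcat ?C ?Y) ?X = L_class (hcat B A) a"
  proof (rule L_class_eqI)
    let ?D = "vcat (hcat (hcat B A) (0\<^sub>m ?m ?r)) (hcat (0\<^sub>m ?r (?k + ?n)) (1\<^sub>m ?r))"
    have D: "hcat ?C ?Y = ?D"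
      unfolding hcat_zero[symmetric, of ?r ?k ?n] using dims by (simp add: hcat_assoc del: hcat_zero)
    show "L_le ?r (hcat ?C ?Y, ?X) (hcat B A, a)"
      unfolding D
      by (rule L_leI[of "hcat (1\<^sub>m ?m) (0\<^sub>m ?m ?r)" _ _ "hcat (1\<^sub>m (?k + ?n)) (0\<^sub>m (?k + ?n) ?r)" _ _ "0\<^sub>m (?k + ?n) ?r"])
        (use dims in simp_all)
    show "L_le ?r (hcat B A, a) (hcat ?C ?Y, ?X)"
      unfolding D
      by (rule L_leI[of "vcat (1\<^sub>m ?m) (0\<^sub>m ?r ?m)" _ _ "vcat (1\<^sub>m (?k + ?n)) (0\<^sub>m ?r (?k + ?n))" _ _
            "vcat (0\<^sub>m (?k + ?n) ?r) (1\<^sub>m ?r)"])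
        (use dims in simp_all)
  qed (use dims in simp_all)
  have closed: "G_gen R (hcat ?C ?X) ?Y \<in> carrier (goursat_group R)"
    by (rule G_gen_closed) (use dims in simp_all)
  have "G_gen R B (hcat A a) = G_gen R (hcat ?C ?X) ?Y" by (rule G_gen_cong[OF CXY[symmetric]])
  also have "\<dots> = G_gen R (hcat ?C ?X) ?Y \<otimes>\<^bsub>goursat_group R\<^esub> G_gen R ?C ?X"
    unfolding CX by (rule r_one[OF closed, symmetric])
  also have "\<dots> = G_gen R (hcat B A) a \<otimes>\<^bsub>goursat_group R\<^esub> G_gen R B A"
    unfolding exchange CY G_gen_cong[OF CYX] ..
  also have "\<dots> = G_gen R B A \<otimes>\<^bsub>goursat_group R\<^esub> G_gen R (hcat B A) a"
    using dims by (intro m_comm G_gen_closed) simp_all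
  finally show ?thesis .
qed

lemma G_gen_columns:
  fixes R :: "'a::{ring,monoid_mult} itself"
  assumes "dim_row B = dim_row A" "dim_col A = Suc n"
  shows "G_gen R B A =
    finprod (goursat_group R) (\<lambda>j. G_gen R (hcat B (col_block A 0 j)) (col_block A j 1)) {..<Suc n}"
  using assms
proof (induction n arbitrary: A)
  case 0
  interpret comm_group "goursat_group R" by (rule comm_group_goursat_group)
  have "hcat B (col_block A 0 0) = B" "col_block A 0 (Suc 0) = A"
    using 0 col_block_full[of A] by simp_all
  then show ?case using 0 by (simp add: lessThan_Suc finprod_singleton G_gen_closed)
next
  case (Suc n)
  interpret comm_group "goursat_group R" by (rule comm_group_goursat_group)
  let ?f = "\<lambda>A j. G_gen R (hcat B (col_block A 0 j)) (col_block A j 1)"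
  let ?A = "col_block A 0 (Suc n)"
  have f: "?f A j \<in> carrier (goursat_group R)" for j using Suc.prems by (intro G_gen_closed) simp_all
  have A: "hcat ?A (col_block A (Suc n) 1) = A"
    using Suc.prems col_block_split[of A "Suc n" 1] col_block_full[of A] by simp
  have "G_gen R B A = G_gen R B (hcat ?A (col_block A (Suc n) 1))" by (simp only: A)
  also have "\<dots> = G_gen R B ?A \<otimes>\<^bsub>goursat_group R\<^esub> ?f A (Suc n)"
    using Suc.prems by (intro G_gen_split) simp_all
  also have "G_gen R B ?A = finprod (goursat_group R) (?f ?A) {..<Suc n}"
    using Suc.prems by (intro Suc.IH) simp_all
  also have "\<dots> = finprod (goursat_group R) (?f A) {..<Suc n}"
  proof (rule finprod_cong')
    fix j assume "j \<in> {..<Suc n}"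
    then have "col_block ?A 0 j = col_block A 0 j" "col_block ?A j 1 = col_block A j 1"
      by (auto intro!: eq_matI simp: index_col_block)
    then show "?f ?A j = ?f A j" by simp
  qed (use f in auto)
  also have "\<dots> \<otimes>\<^bsub>goursat_group R\<^esub> ?f A (Suc n) = finprod (goursat_group R) (?f A) {..<Suc (Suc n)}"
    using f by (simp add: lessThan_Suc[of "Suc n"] finprod_insert m_comm)
  finally show ?case .
qed

lemma hom_finprod_lessThan:
  fixes n :: nat
  assumes "comm_group G" "comm_group H" "h \<in> hom G H" "\<And>i. i < n \<Longrightarrow> f i \<in> carrier G"
  shows "h (finprod G f {..<n}) = finprod H (\<lambda>i. h (f i)) {..<n}"
proof -
  interpret G: comm_group G by fact
  interpret H: comm_group H by fact
  have hc: "h x \<in> carrier H" if "x \<in> carrier G" for x using assms(3) that by (rule hom_in_carrier)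
  show ?thesis
    using assms(4)
  proof (induction n)
    case 0
    then show ?case using hom_one[OF assms(3) G.is_group H.is_group] by simp
  next
    case (Suc n)
    then have "h (f n \<otimes>\<^bsub>G\<^esub> finprod G f {..<n}) = h (f n) \<otimes>\<^bsub>H\<^esub> finprod H (\<lambda>i. h (f i)) {..<n}"
      using hom_mult[OF assms(3), of "f n" "finprod G f {..<n}"] by (simp add: Pi_iff)
    then show ?case using Suc.prems hc by (simp add: lessThan_Suc G.finprod_insert H.finprod_insert Pi_iff)
  qed
qed

text \<open>
  The columns before \<open>i\<close> occur with opposite signs in the terms \<open>i - 1\<close> and \<open>i\<close>; the empty matrix
  that is left over at the beginning has cokernel 0.
\<close>

lemma K0_mat_telescope:
  fixes R :: "'a::{ring,monoid_mult} itself"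
  shows "n \<le> dim_col A \<Longrightarrow>
    finprod (K0 R) (\<lambda>i. gamma_value R (col_block A 0 i) (col_block A i 1)) {..<n} = K0_mat R (col_block A 0 n)"
proof (induction n)
  case 0
  interpret comm_group "K0 R" by (rule comm_group_K0)
  show ?case by (simp add: K0_mat_no_cols)
next
  case (Suc n)
  interpret comm_group "K0 R" by (rule comm_group_K0)
  have "hcat (col_block A 0 n) (col_block A n (Suc 0)) = col_block A 0 (Suc n)"
    using col_block_split[of A n 1] by simp
  then have "gamma_value R (col_block A 0 n) (col_block A n (Suc 0)) =
      K0_mat R (col_block A 0 (Suc n)) \<otimes>\<^bsub>K0 R\<^esub> inv\<^bsub>K0 R\<^esub> K0_mat R (col_block A 0 n)"
    by (simp add: gamma_value_def)
  then show ?case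
    using Suc by (simp add: lessThan_Suc finprod_insert Pi_iff gamma_value_closed K0_mat_closed m_assoc)
qed

lemma bij_betw_triangle:
  assumes "f \<in> A \<rightarrow> B" "g \<in> B \<rightarrow> C" "h \<in> C \<rightarrow> A"
    and "\<forall>x\<in>A. h (g (f x)) = x" "\<forall>y\<in>B. f (h (g y)) = y"
  shows "bij_betw f A B"
  by (rule bij_betwI[where g = "\<lambda>y. h (g y)"]) (use assms in auto)

theorem theorem24:
  fixes R :: "'a::{ring,monoid_mult} itself"
  shows "(\<exists>!f. is_iota R f) \<and> (\<exists>!f. is_gamma R f) \<and> (\<exists>!f. is_kappa R f) \<and>
    iota R \<in> iso (goursat_group0 R) (goursat_group R) \<and>
    gamma R \<in> iso (goursat_group R) (K0 R) \<and>
    kappa R \<in> iso (K0 R) (goursat_group0 R) \<and>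
    (\<forall>x\<in>carrier (goursat_group0 R). kappa R (gamma R (iota R x)) = x) \<and>
    (\<forall>x\<in>carrier (goursat_group R). iota R (kappa R (gamma R x)) = x) \<and>
    (\<forall>x\<in>carrier (K0 R). gamma R (iota R (kappa R x)) = x)"
proof -
  interpret G: comm_group "goursat_group R" by (rule comm_group_goursat_group)
  interpret G0: comm_group "goursat_group0 R" by (rule comm_group_goursat_group0)
  interpret K: comm_group "K0 R" by (rule comm_group_K0)
  have i: "is_iota R (iota R)" unfolding iota_def by (rule theI'[OF ex1_is_iota])
  have g: "is_gamma R (gamma R)" unfolding gamma_def by (rule theI'[OF ex1_is_gamma])
  have k: "is_kappa R (kappa R)" unfolding kappa_def by (rule theI'[OF ex1_is_kappa])
  have ih: "iota R \<in> hom (goursat_group0 R) (goursat_group R)"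
    and gh: "gamma R \<in> hom (goursat_group R) (K0 R)"
    and kh: "kappa R \<in> hom (K0 R) (goursat_group0 R)"
    using i g k by (auto simp: is_iota_def is_gamma_def is_kappa_def)
  interpret ih: group_hom "goursat_group0 R" "goursat_group R" "iota R"
    by unfold_locales (rule ih)
  interpret kh: group_hom "K0 R" "goursat_group0 R" "kappa R"
    by unfold_locales (rule kh)
  have iv: "iota R (G0_gen R B A) = G_gen R B A" if "dim_row B = dim_row A" "dim_col A = 1" for B A
    using i that by (auto simp: is_iota_def L_pairs_def)
  have gv: "gamma R (G_gen R B A) = gamma_value R B A" if "dim_row B = dim_row A" "1 \<le> dim_col A" for B A
    using g that by (auto simp: is_gamma_def L_pairs_def gamma_value_def)
  have kv: "kappa R (K0_mat R A) = kappa_value R A" for A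
    using k by (simp add: is_kappa_def kappa_value_def)
  let ?t = "\<lambda>B A. finprod (goursat_group0 R) (\<lambda>j. G0_gen R (hcat B (col_block A 0 j)) (col_block A j 1)) {..<dim_col A}"
  have tc: "?t B A \<in> carrier (goursat_group0 R)" if "dim_row B = dim_row A" for B A
    using that by (intro G0.finprod_closed) (auto intro: G0_gen_closed)
  \<comment> \<open>The terms of \<open>kappa_value R (hcat B A)\<close> that belong to the columns of \<open>B\<close> cancel.\<close>
  have kg: "kappa R (gamma_value R B A) = ?t B A" if "dim_row B = dim_row A" for B A
  proof -
    have "kappa R (gamma_value R B A) = kappa_value R (hcat B A) \<otimes>\<^bsub>goursat_group0 R\<^esub> inv\<^bsub>goursat_group0 R\<^esub> kappa_value R B"
      by (simp add: gamma_value_def K0_mat_closed kv)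
    also have "\<dots> = (?t B A \<otimes>\<^bsub>goursat_group0 R\<^esub> kappa_value R B) \<otimes>\<^bsub>goursat_group0 R\<^esub> inv\<^bsub>goursat_group0 R\<^esub> kappa_value R B"
      using that tc[OF that] by (simp add: kappa_value_hcat kappa_value_closed G0.m_comm)
    also have "\<dots> = ?t B A" using tc[OF that] by (simp add: G0.m_assoc kappa_value_closed)
    finally show ?thesis .
  qed
  have around_G0: "\<forall>x\<in>carrier (goursat_group0 R). kappa R (gamma R (iota R x)) = x"
  proof
    fix x assume x: "x \<in> carrier (goursat_group0 R)"
    have "(kappa R \<circ> (gamma R \<circ> iota R)) x = id x"
    proof (rule G0.hom_eqI[of "kappa R \<circ> (gamma R \<circ> iota R)" R "goursat_group0 R" id x])
      show "kappa R \<circ> (gamma R \<circ> iota R) \<in> hom (presented_group (L_set 1) (G0_rels R)) (goursat_group0 R)"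
        unfolding goursat_group0_def[symmetric] by (rule Group.hom_compose[OF Group.hom_compose[OF ih gh] kh])
      show "id \<in> hom (presented_group (L_set 1) (G0_rels R)) (goursat_group0 R)"
        unfolding goursat_group0_def[symmetric] by (auto simp: hom_def)
      show "x \<in> carrier (presented_group (L_set 1) (G0_rels R))" using x by (simp add: goursat_group0_def)
      fix c :: "('a mat \<times> 'a mat) set" assume "c \<in> L_set 1"
      then obtain B A where c: "dim_row B = dim_row A" "dim_col A = 1" "c = L_class B A" by (rule L_setE)
      have "col_block A 0 (Suc 0) = A" "hcat B (col_block A 0 0) = B" using c col_block_full[of A] by simp_all
      then have "?t B A = G0_gen R B A"
        using c by (simp add: lessThan_Suc G0.finprod_singleton G0_gen_closed)
      then have "kappa R (gamma R (iota R (G0_gen R B A))) = G0_gen R B A"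
        using c by (simp add: iv gv kg)
      then show "(kappa R \<circ> (gamma R \<circ> iota R)) (presented_gen (L_set 1) (G0_rels R) c) = id (presented_gen (L_set 1) (G0_rels R) c)"
        by (simp add: c G0_gen_def)
    qed (rule G0.is_group)
    then show "kappa R (gamma R (iota R x)) = x" by simp
  qed
  have around_G: "\<forall>x\<in>carrier (goursat_group R). iota R (kappa R (gamma R x)) = x"
  proof
    fix x assume x: "x \<in> carrier (goursat_group R)"
    have "(iota R \<circ> (kappa R \<circ> gamma R)) x = id x"
    proof (rule G.hom_eqI[of "iota R \<circ> (kappa R \<circ> gamma R)" R "goursat_group R" id x])
      show "iota R \<circ> (kappa R \<circ> gamma R) \<in> hom (presented_group (G_gens R) (G_rels R)) (goursat_group R)"
        unfolding goursat_group_def[symmetric] by (rule Group.hom_compose[OF Group.hom_compose[OF gh kh] ih])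
      show "id \<in> hom (presented_group (G_gens R) (G_rels R)) (goursat_group R)"
        unfolding goursat_group_def[symmetric] by (auto simp: hom_def)
      show "x \<in> carrier (presented_group (G_gens R) (G_rels R))" using x by (simp add: goursat_group_def)
      fix c assume "c \<in> G_gens R"
      then obtain B A where c: "dim_row B = dim_row A" "1 \<le> dim_col A" "c = L_class B A" by (rule G_gensE)
      then obtain n where n: "dim_col A = Suc n" by (cases "dim_col A") auto
      have "iota R (?t B A) = finprod (goursat_group R) (\<lambda>j. iota R (G0_gen R (hcat B (col_block A 0 j)) (col_block A j 1))) {..<dim_col A}"
        by (rule hom_finprod_lessThan[OF G0.comm_group_axioms G.comm_group_axioms ih])
          (use c in \<open>auto intro: G0_gen_closed\<close>)
      also have "\<dots> = finprod (goursat_group R) (\<lambda>j. G_gen R (hcat B (col_block A 0 j)) (col_block A j 1)) {..<dim_col A}"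
        using c by (simp add: iv)
      also have "\<dots> = G_gen R B A" unfolding n by (rule G_gen_columns[symmetric]) (use c n in auto)
      finally have "iota R (kappa R (gamma R (G_gen R B A))) = G_gen R B A"
        using c by (simp add: gv kg)
      then show "(iota R \<circ> (kappa R \<circ> gamma R)) (presented_gen (G_gens R) (G_rels R) c) = id (presented_gen (G_gens R) (G_rels R) c)"
        by (simp add: c G_gen_def)
    qed (rule G.is_group)
    then show "iota R (kappa R (gamma R x)) = x" by simp
  qed
  have around_K0: "\<forall>x\<in>carrier (K0 R). gamma R (iota R (kappa R x)) = x"
  proof
    fix x assume x: "x \<in> carrier (K0 R)"
    have "(gamma R \<circ> (iota R \<circ> kappa R)) x = id x"
    proof (rule K0.hom_eqI[of "gamma R \<circ> (iota R \<circ> kappa R)" R "K0 R" id x])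
      show "gamma R \<circ> (iota R \<circ> kappa R) \<in> hom (presented_group (K0_gens R) (K0_rels R)) (K0 R)"
        unfolding K0_def[symmetric] by (rule Group.hom_compose[OF Group.hom_compose[OF kh ih] gh])
      show "id \<in> hom (presented_group (K0_gens R) (K0_rels R)) (K0 R)"
        unfolding K0_def[symmetric] by (auto simp: hom_def)
      show "x \<in> carrier (presented_group (K0_gens R) (K0_rels R))" using x by (simp add: K0_def)
      fix c assume "c \<in> K0_gens R"
      then obtain A where c: "c = lmod_class (coker_mod A)" by (rule K0_gensE)
      have "(gamma R \<circ> iota R) (kappa_value R A) = finprod (K0 R) (\<lambda>i. (gamma R \<circ> iota R) (G0_gen R (col_block A 0 i) (col_block A i 1))) {..<dim_col A}"
        unfolding kappa_value_def
        by (rule hom_finprod_lessThan[OF G0.comm_group_axioms K.comm_group_axioms Group.hom_compose[OF ih gh]])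
          (auto intro: G0_gen_closed)
      also have "\<dots> = finprod (K0 R) (\<lambda>i. gamma_value R (col_block A 0 i) (col_block A i 1)) {..<dim_col A}"
        by (simp add: iv gv)
      also have "\<dots> = K0_mat R A" using K0_mat_telescope[OF order_refl, of R A] by (simp only: col_block_full)
      finally have "gamma R (iota R (kappa R (K0_mat R A))) = K0_mat R A" by (simp add: kv)
      then show "(gamma R \<circ> (iota R \<circ> kappa R)) (presented_gen (K0_gens R) (K0_rels R) c) = id (presented_gen (K0_gens R) (K0_rels R) c)"
        by (simp add: c K0_mat_def)
    qed (rule K.is_group)
    then show "gamma R (iota R (kappa R x)) = x" by simp
  qed
  have maps: "iota R \<in> carrier (goursat_group0 R) \<rightarrow> carrier (goursat_group R)"
    "gamma R \<in> carrier (goursat_group R) \<rightarrow> carrier (K0 R)"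
    "kappa R \<in> carrier (K0 R) \<rightarrow> carrier (goursat_group0 R)"
    using ih gh kh unfolding hom_def by blast+
  have iso: "iota R \<in> iso (goursat_group0 R) (goursat_group R)" "gamma R \<in> iso (goursat_group R) (K0 R)"
    "kappa R \<in> iso (K0 R) (goursat_group0 R)"
    unfolding iso_def using ih gh kh bij_betw_triangle[OF maps around_G0 around_G]
      bij_betw_triangle[OF maps(2,3,1) around_G around_K0] bij_betw_triangle[OF maps(3,1,2) around_K0 around_G0] by simp_all
  show ?thesis by (intro conjI ex1_is_iota ex1_is_gamma ex1_is_kappa iso around_G0 around_G around_K0)
qed

end
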